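(* Let $\Gamma=(X,\sim)$ be a $\mathbb{Z}^n$-periodic discrete graph, $v\in l^\infty(X)$, and $\mathcal{H}_\Gamma=\Delta_\Gamma+vI$. Then for $p\in(1,\infty)$, $\mathcal{H}_\Gamma$ is Fredholm on $l^p(X)$ if and only if there is $p_0\in[1,\infty]$ such that all limit operators of $\mathcal{H}_\Gamma$ are invertible on $l^{p_0}(X)$. The essential spectrum of $\mathcal{H}_\Gamma$ on $l^p(X)$ does not depend on $p\in(1,\infty)$, and $\mathrm{sp}_{ess}\mathcal{H}_\Gamma=\bigcup_{\mathcal{H}^h_\Gamma\in\mathrm{op}(\mathcal{H}_\Gamma)}\mathrm{sp}\,\mathcal{H}^h_\Gamma$.
   Context: A discrete infinite graph is a countable set $X$ with an anti-reflexive symmetric relation $\sim$ such that each $x$ has finitely many $y$ with $x\sim y$; $m(x)$ is the number of such $y$. It is assumed connected, and $\rho$ is the graph distance. $\Gamma$ is a $\mathbb{Z}^n$-periodic discrete graph if it is a connected discrete infinite graph on which $\mathbb{Z}^n$ acts freely, $(\alpha,x)\mapsto\alpha\cdot x$, with $x\sim y\iff\alpha\cdot x\sim\alpha\cdot y$, and with finitely many orbits. The Laplacian is $(\Delta_\Gamma u)(x)=\frac{1}{m(x)}\sum_{y\sim x}u(y)$ and $vI$ is multiplication by $v$. $(T_\alpha u)(x)=u((-\alpha)\cdot x)$. For a sequence $h:\mathbb{N}\to\mathbb{Z}^n$ tending to infinity, $A_h$ is the limit operator of $A$ w.r.t. $h$ if $T_{h(m)}^{-1}AT_{h(m)}\to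 A_h$ strongly on $l^p(X)$ and $T_{h(m)}^{-1}A^*T_{h(m)}\to A_h^*$ strongly on $l^q(X)$, $1/p+1/q=1$; the set $\mathrm{op}(\mathcal{H}_\Gamma)$ of limit operators does not depend on $p\in(1,\infty)$, and they are the operators $\Delta_\Gamma+v^gI$ where $v^g(x)=\lim_m v(g(m)\cdot x)$ pointwise. $\mathrm{sp}_{ess}$ denotes the set of $\lambda$ with $A-\lambda I$ not Fredholm. *)

theory Defs
  imports "HOL-Analysis.Analysis" "HOL-Library.Extended_Real"
begin

definition periodic_graph ::
  "('a::countable \<Rightarrow> 'a \<Rightarrow> bool) \<Rightarrow> ((int ^ 'n::finite) \<Rightarrow> 'a \<Rightarrow> 'a) \<Rightarrow> bool" where
  "periodic_graph adj act \<longleftrightarrow>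
     infinite (UNIV :: 'a set) \<and>
     (\<forall>x. \<not> adj x x) \<and> (\<forall>x y. adj x y \<longleftrightarrow> adj y x) \<and>
     (\<forall>x. finite {y. adj x y}) \<and>
     (\<forall>x y. adj\<^sup>*\<^sup>* x y) \<and>
     (\<forall>x. act 0 x = x) \<and> (\<forall>a b x. act (a + b) x = act a (act b x)) \<and>
     (\<forall>a x. act a x = x \<longrightarrow> a = 0) \<and>
     (\<forall>a x y. adj x y \<longleftrightarrow> adj (act a x) (act a y)) \<and>
     finite (range (\<lambda>x. range (\<lambda>a. act a x)))"

definition degree :: "('a \<Rightarrow> 'a \<Rightarrow> bool) \<Rightarrow> 'a \<Rightarrow> nat" where
  "degree adj x = card {y. adj x y}"

definition laplacian :: "('a \<Rightarrow> 'a \<Rightarrow> bool) \<Rightarrow> ('a \<Rightarrow> complex) \<Rightarrow> 'a \<Rightarrow> complex" where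
  "laplacian adj u x = (1 / of_nat (degree adj x)) * (\<Sum>y\<in>{y. adj x y}. u y)"

definition schr :: "('a \<Rightarrow> 'a \<Rightarrow> bool) \<Rightarrow> ('a \<Rightarrow> complex) \<Rightarrow> ('a \<Rightarrow> complex) \<Rightarrow> 'a \<Rightarrow> complex" where
  "schr adj w u = (\<lambda>x. laplacian adj u x + w x * u x)"

definition lp :: "ereal \<Rightarrow> ('a \<Rightarrow> complex) set" where
  "lp p = {u. if p = \<infinity> then bounded (range u)
              else (\<lambda>x. norm (u x) powr real_of_ereal p) summable_on UNIV}"

definition lp_norm :: "ereal \<Rightarrow> ('a \<Rightarrow> complex) \<Rightarrow> real" where
  "lp_norm p u = (if p = \<infinity> then (SUP x. norm (u x))
                  else (\<Sum>\<^sub>\<infinity>x. norm (u x) powr real_of_ereal p) powr (1 / real_of_ereal p))"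

definition conj_exp :: "ereal \<Rightarrow> ereal" where
  "conj_exp p = ereal (real_of_ereal p / (real_of_ereal p - 1))"

definition cspan :: "('a \<Rightarrow> complex) set \<Rightarrow> ('a \<Rightarrow> complex) set" where
  "cspan B = {u. \<exists>c. u = (\<lambda>x. \<Sum>b\<in>B. c b * b x)}"

definition bounded_on :: "ereal \<Rightarrow> (('a \<Rightarrow> complex) \<Rightarrow> ('a \<Rightarrow> complex)) \<Rightarrow> bool" where
  "bounded_on p A \<longleftrightarrow>
     (\<forall>u\<in>lp p. A u \<in> lp p) \<and>
     (\<forall>u\<in>lp p. \<forall>w\<in>lp p. \<forall>c. A (\<lambda>x. u x + c * w x) = (\<lambda>x. A u x + c * A w x)) \<and>
     (\<exists>C. \<forall>u\<in>lp p. lp_norm p (A u) \<le> C * lp_norm p u)"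

definition fredholm_on :: "ereal \<Rightarrow> (('a \<Rightarrow> complex) \<Rightarrow> ('a \<Rightarrow> complex)) \<Rightarrow> bool" where
  "fredholm_on p A \<longleftrightarrow>
     bounded_on p A \<and>
     (\<exists>B. finite B \<and> B \<subseteq> lp p \<and> {u\<in>lp p. A u = (\<lambda>x. 0)} \<subseteq> cspan B) \<and>
     (\<forall>f g. (\<forall>k. f k \<in> A ` lp p) \<longrightarrow> g \<in> lp p \<longrightarrow>
            (\<lambda>k. lp_norm p (\<lambda>x. f k x - g x)) \<longlonglongrightarrow> 0 \<longrightarrow> g \<in> A ` lp p) \<and>
     (\<exists>B. finite B \<and> B \<subseteq> lp p \<and> lp p \<subseteq> {(\<lambda>x. a x + b x) | a b. a \<in> A ` lp p \<and> b \<in> cspan B})"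

definition invertible_on :: "ereal \<Rightarrow> (('a \<Rightarrow> complex) \<Rightarrow> ('a \<Rightarrow> complex)) \<Rightarrow> bool" where
  "invertible_on p A \<longleftrightarrow>
     bounded_on p A \<and> bij_betw A (lp p) (lp p) \<and>
     (\<exists>C. \<forall>u\<in>lp p. lp_norm p u \<le> C * lp_norm p (A u))"

definition spectrum_on :: "ereal \<Rightarrow> (('a \<Rightarrow> complex) \<Rightarrow> ('a \<Rightarrow> complex)) \<Rightarrow> complex set" where
  "spectrum_on p A = {z. \<not> invertible_on p (\<lambda>u x. A u x - z * u x)}"

definition ess_spectrum_on :: "ereal \<Rightarrow> (('a \<Rightarrow> complex) \<Rightarrow> ('a \<Rightarrow> complex)) \<Rightarrow> complex set" where
  "ess_spectrum_on p A = {z. \<not> fredholm_on p (\<lambda>u x. A u x - z * u x)}"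

definition shift :: "((int ^ 'n) \<Rightarrow> 'a \<Rightarrow> 'a) \<Rightarrow> (int ^ 'n) \<Rightarrow> ('a \<Rightarrow> complex) \<Rightarrow> 'a \<Rightarrow> complex" where
  "shift act \<alpha> u = (\<lambda>x. u (act (- \<alpha>) x))"

definition tends_to_infinity :: "(nat \<Rightarrow> (int ^ 'n::finite)) \<Rightarrow> bool" where
  "tends_to_infinity h \<longleftrightarrow> filterlim (\<lambda>m. \<Sum>i\<in>UNIV. \<bar>h m $ i\<bar>) at_top sequentially"

definition strong_conv :: "ereal \<Rightarrow> (nat \<Rightarrow> ('a \<Rightarrow> complex) \<Rightarrow> ('a \<Rightarrow> complex))
     \<Rightarrow> (('a \<Rightarrow> complex) \<Rightarrow> ('a \<Rightarrow> complex)) \<Rightarrow> bool" where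
  "strong_conv p As A \<longleftrightarrow> (\<forall>u\<in>lp p. (\<lambda>m. lp_norm p (\<lambda>x. As m u x - A u x)) \<longlonglongrightarrow> 0)"

definition adjoint_on :: "ereal \<Rightarrow> (('a \<Rightarrow> complex) \<Rightarrow> ('a \<Rightarrow> complex))
     \<Rightarrow> (('a \<Rightarrow> complex) \<Rightarrow> ('a \<Rightarrow> complex)) \<Rightarrow> bool" where
  "adjoint_on p A B \<longleftrightarrow>
     (\<forall>w\<in>lp (conj_exp p). B w \<in> lp (conj_exp p)) \<and>
     (\<forall>u\<in>lp p. \<forall>w\<in>lp (conj_exp p). (\<Sum>\<^sub>\<infinity>x. A u x * w x) = (\<Sum>\<^sub>\<infinity>x. u x * B w x))"

definition limit_operator :: "((int ^ 'n) \<Rightarrow> 'a \<Rightarrow> 'a) \<Rightarrow> ereal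
     \<Rightarrow> (('a \<Rightarrow> complex) \<Rightarrow> ('a \<Rightarrow> complex)) \<Rightarrow> (nat \<Rightarrow> (int ^ 'n))
     \<Rightarrow> (('a \<Rightarrow> complex) \<Rightarrow> ('a \<Rightarrow> complex)) \<Rightarrow> bool" where
  "limit_operator act p A h Ah \<longleftrightarrow>
     strong_conv p (\<lambda>m u. shift act (- h m) (A (shift act (h m) u))) Ah \<and>
     (\<exists>B Bh. adjoint_on p A B \<and> adjoint_on p Ah Bh \<and>
        strong_conv (conj_exp p) (\<lambda>m w. shift act (- h m) (B (shift act (h m) w))) Bh)"

text \<open>The potentials w such that Delta + w I is a limit operator of Delta + v I on l^p
  (w.r.t. some sequence h tending to infinity); op(H) = {Delta + w I | w in this set}.\<close>
definition limit_potentials :: "('a \<Rightarrow> 'a \<Rightarrow> bool) \<Rightarrow> ((int ^ 'n::finite) \<Rightarrow> 'a \<Rightarrow> 'a)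
     \<Rightarrow> ('a \<Rightarrow> complex) \<Rightarrow> ereal \<Rightarrow> ('a \<Rightarrow> complex) set" where
  "limit_potentials adj act v p =
     {w. \<exists>h. tends_to_infinity h \<and> limit_operator act p (schr adj v) h (schr adj w)}"

end

theory Submission
  imports Defs "HOL-Complex_Analysis.Great_Picard"
begin

text \<open>
  If \<open>H\<close> is Fredholm on \<open>l\<^sup>p\<close>, the open mapping theorem gives norm-controlled solutions of
  \<open>Hu = f\<close> modulo finite-dimensional spaces; translating along the defining sequence makes the
  finite-dimensional terms vanish, so a limit operator is bounded below, and pointwise limits of the
  translated solutions show that it is onto. No duality is needed.

  Conversely, a Combes--Thomas argument shows that the inverse of a limit operator on any single
  \<open>l\<^sup>p\<close> has a matrix with exponentially decaying entries. Hence each limit operator is bounded below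
  on \<open>l\<^sup>\<infinity>\<close>, and since the set of limit operators is invariant under translations and closed under
  pointwise limits, a compactness argument makes this bound, and with it the rate of decay, uniform.
  Far away \<open>H\<close> is close to some limit operator on each large ball, so truncated Green functions of
  limit operators, chosen row by row or column by column, are left and right parametrices of \<open>H\<close> whose
  errors are, off a finite set, small in the sense of the Schur test on all \<open>l\<^sup>p\<close> simultaneously.
\<close>

section \<open>The spaces of p-summable functions\<close>

text \<open>Two facts shape the proof. Invertibility is given on some \<open>lp p0\<close>, possibly
  with \<open>p0 = 1\<close> or \<open>p0 = \<infinity>\<close>, while the conclusion concerns
  another \<open>p\<close>. What passes between exponents is only the matrix of an inverse together
  with its decay, which Schur's test turns into a bound on every \<open>lp p\<close>. Moreover,
  uniformity over all limit operators must come from compactness, and the topology available is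
  pointwise convergence. The sup norm suits it: a function of norm one is nearly that large at some
  point, which a translation moves into a finite set, so mass cannot escape in the limit. Hence
  estimates are stated through \<open>lp_le\<close>. It joins membership to the norm bound because
  \<open>lp_norm\<close> is total and its value off \<open>lp p\<close> is a default (0 for finite
  exponents) that bounds nothing. Balls in this sense are closed under pointwise limits, so
  completeness, Neumann series and solutions along subsequences are obtained coordinatewise. The
  operators in use are banded, hence finite sums at each point, and commute with such
  limits.\<close>

definition lp_le :: "ereal \<Rightarrow> real \<Rightarrow> ('a \<Rightarrow> complex) \<Rightarrow> bool" where
  "lp_le p r u \<longleftrightarrow> u \<in> lp p \<and> lp_norm p u \<le> r"

lemma exponent_cases:
  assumes "1 \<le> (p::ereal)"
  obtains "p = \<infinity>" | q where "p = ereal q" "1 \<le> q"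
  using assms by (cases p) auto

lemma lp_leD: "lp_le p r u \<Longrightarrow> u \<in> lp p" "lp_le p r u \<Longrightarrow> lp_norm p u \<le> r"
  by (auto simp: lp_le_def)

lemma lp_le_lp_norm: "u \<in> lp p \<Longrightarrow> lp_le p (lp_norm p u) u"
  by (simp add: lp_le_def)

lemma lp_le_infty: "lp_le \<infinity> r u \<longleftrightarrow> (\<forall>x. norm (u x) \<le> r)"
proof
  assume *: "lp_le \<infinity> r u"
  then have "bdd_above (range (\<lambda>x. norm (u x)))"
    by (auto simp: lp_le_def lp_def bounded_iff bdd_above_def)
  then have "norm (u x) \<le> (SUP x. norm (u x))" for x
    by (intro cSUP_upper) auto
  moreover have "(SUP x. norm (u x)) \<le> r"
    using * by (simp add: lp_le_def lp_norm_def)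
  ultimately show "\<forall>x. norm (u x) \<le> r"
    using order_trans by blast
next
  assume "\<forall>x. norm (u x) \<le> r"
  moreover from this have "(SUP x. norm (u x)) \<le> r"
    by (intro cSUP_least) auto
  ultimately show "lp_le \<infinity> r u"
    by (auto simp: lp_le_def lp_def lp_norm_def bounded_iff)
qed

text \<open>For nonnegative terms, summability is boundedness of the finite partial sums. In this
  form Minkowski, Fatou, reindexing and Schur's test below become statements about finite sums. The
  clause \<open>0 \<le> r\<close> excludes negative radii, for which the \<open>powr\<close>
  inequality would say nothing about the norm.\<close>

lemma lp_le_finite:
  assumes "1 \<le> q"
  shows "lp_le (ereal q) r u \<longleftrightarrow>
    0 \<le> r \<and> (\<forall>F. finite F \<longrightarrow> (\<Sum>x\<in>F. norm (u x) powr q) \<le> r powr q)"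
proof
  let ?f = "\<lambda>x. norm (u x) powr q"
  assume *: "lp_le (ereal q) r u"
  then have s: "?f summable_on UNIV" and n: "(infsum ?f UNIV) powr (1/q) \<le> r"
    by (auto simp: lp_le_def lp_def lp_norm_def)
  have r: "0 \<le> r" using n powr_ge_zero order_trans by blast
  have "infsum ?f UNIV = ((infsum ?f UNIV) powr (1/q)) powr q"
    using assms by (simp add: powr_powr infsum_nonneg)
  also have "\<dots> \<le> r powr q" using n assms by (intro powr_mono2) auto
  finally have "sum ?f F \<le> r powr q" if "finite F" for F
    using finite_sum_le_infsum[OF s that] by fastforce
  with r show "0 \<le> r \<and> (\<forall>F. finite F \<longrightarrow> (\<Sum>x\<in>F. norm (u x) powr q) \<le> r powr q)"
    by blast
next
  let ?f = "\<lambda>x. norm (u x) powr q"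
  assume *: "0 \<le> r \<and> (\<forall>F. finite F \<longrightarrow> (\<Sum>x\<in>F. norm (u x) powr q) \<le> r powr q)"
  have s: "?f summable_on UNIV"
    by (rule nonneg_bdd_above_summable_on) (use * in \<open>auto intro!: bdd_aboveI2[of _ _ "r powr q"]\<close>)
  have "infsum ?f UNIV \<le> r powr q"
    by (rule infsum_le_finite_sums[OF s]) (use * in auto)
  then have "(infsum ?f UNIV) powr (1/q) \<le> (r powr q) powr (1/q)"
    using assms by (intro powr_mono2 infsum_nonneg) auto
  also have "\<dots> = r" using * assms by (simp add: powr_powr)
  finally show "lp_le (ereal q) r u" using s by (auto simp: lp_le_def lp_def lp_norm_def)
qed

lemma lp_le_at:
  assumes "1 \<le> p" "lp_le p r u"
  shows "norm (u x) \<le> r"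
  using assms(1)
proof (cases rule: exponent_cases)
  case 1
  then show ?thesis using assms by (simp add: lp_le_infty)
next
  case (2 q)
  with assms(2) have r: "0 \<le> r" and s: "\<And>F. finite F \<Longrightarrow> (\<Sum>x\<in>F. norm (u x) powr q) \<le> r powr q"
    by (auto simp: lp_le_finite)
  from s[of "{x}"] have "norm (u x) powr q \<le> r powr q" by simp
  then show ?thesis
    using r 2 powr_less_mono2[of q r "norm (u x)"] by (cases "norm (u x) \<le> r") auto
qed

lemma lp_le_nonneg:
  assumes "1 \<le> p" "lp_le p r u"
  shows "0 \<le> r"
  using lp_le_at[OF assms] norm_ge_zero order_trans by blast

lemma lp_norm_nonneg: "1 \<le> p \<Longrightarrow> u \<in> lp p \<Longrightarrow> 0 \<le> lp_norm p u"
  using lp_le_nonneg lp_le_lp_norm by blast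

lemma lp_le_mono:
  assumes "1 \<le> p" "lp_le p r u" "\<And>x. norm (w x) \<le> norm (u x)" "r \<le> s"
  shows "lp_le p s w"
  using assms(1)
proof (cases rule: exponent_cases)
  case 1
  have "norm (w x) \<le> s" for x
    using assms(3)[of x] assms(4) lp_le_at[OF assms(1,2), of x] by linarith
  then show ?thesis using 1 by (simp add: lp_le_infty)
next
  case (2 q)
  have "(\<Sum>x\<in>F. norm (w x) powr q) \<le> s powr q" if "finite F" for F
  proof -
    have "(\<Sum>x\<in>F. norm (w x) powr q) \<le> (\<Sum>x\<in>F. norm (u x) powr q)"
      using 2 assms(3) by (intro sum_mono powr_mono2) auto
    also have "\<dots> \<le> r powr q" using assms(2) 2 that by (simp add: lp_le_finite)
    also have "\<dots> \<le> s powr q" using 2 assms by (intro powr_mono2) (auto intro: lp_le_nonneg[OF assms(1,2)])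
    finally show ?thesis .
  qed
  moreover have "0 \<le> s" using lp_le_nonneg[OF assms(1,2)] assms(4) by simp
  ultimately show ?thesis using 2 by (simp add: lp_le_finite)
qed

lemma lp_le_scale:
  assumes "1 \<le> p" "lp_le p r u"
  shows "lp_le p (norm c * r) (\<lambda>x. c * u x)"
  using assms(1)
proof (cases rule: exponent_cases)
  case 1
  then show ?thesis using assms by (auto simp: lp_le_infty norm_mult intro: mult_left_mono)
next
  case (2 q)
  then show ?thesis using assms lp_le_nonneg[OF assms]
    by (simp add: lp_le_finite norm_mult powr_mult mult_left_mono flip: sum_distrib_left)
qed

text \<open>Moduli may vanish, so convexity is needed up to the endpoint 0. There it reduces to
  \<open>t powr q \<le> t\<close> for \<open>0 < t < 1\<close>.\<close>

lemma convex_on_powr_nonneg: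
  assumes "1 \<le> (q::real)"
  shows "convex_on {0..} (\<lambda>x. x powr q)"
proof (rule convex_onI)
  fix t x y :: real
  assume t: "0 < t" "t < 1" and xy: "x \<in> {0..}" "y \<in> {0..}"
  have tq: "s powr q \<le> s" if "0 < s" "s < 1" for s :: real
    using powr_mono'[of 1 q s] assms that by simp
  consider "x = 0" | "y = 0" | "x > 0" "y > 0" using xy by force
  then show "((1 - t) *\<^sub>R x + t *\<^sub>R y) powr q \<le> (1 - t) * x powr q + t * y powr q"
  proof cases
    case 1
    then show ?thesis using t xy tq[of t] assms by (simp add: powr_mult mult_right_mono)
  next
    case 2
    then show ?thesis using t xy tq[of "1 - t"] assms by (simp add: powr_mult mult_right_mono)
  next
    case 3
    then show ?thesis using convex_onD[OF powr_convex[OF assms], of t x y] t by simp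
  qed
qed auto

text \<open>Minkowski's inequality from convexity alone: \<open>(|u| + |w|) / (r + s)\<close> is the
  convex combination of \<open>|u| / r\<close> and \<open>|w| / s\<close> with weights
  \<open>r / (r + s)\<close> and \<open>s / (r + s)\<close>, and each normalised function has
  \<open>q\<close>-th power sums at most one. If a radius is 0 the normalisation is impossible, but
  then that function vanishes.\<close>

lemma lp_le_add:
  assumes p: "1 \<le> p" and u: "lp_le p r u" and w: "lp_le p s w"
  shows "lp_le p (r + s) (\<lambda>x. u x + w x)"
  using p
proof (cases rule: exponent_cases)
  case 1
  then show ?thesis using assms by (auto simp: lp_le_infty intro: norm_triangle_mono)
next
  case (2 q)
  have r: "0 \<le> r" and s: "0 \<le> s" using lp_le_nonneg assms by auto
  consider "r = 0" | "s = 0" | "r > 0" "s > 0" using r s by force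
  then show ?thesis
  proof cases
    case 1
    then have "u x = 0" for x using lp_le_at[OF p u, of x] by simp
    then show ?thesis using w 1 by simp
  next
    case 2
    then have "w x = 0" for x using lp_le_at[OF p w, of x] by simp
    then show ?thesis using u 2 by simp
  next
    case 3
    define t where "t = s / (r + s)"
    have t: "0 < t" "t < 1" "1 - t = r / (r + s)" using 3 by (auto simp: t_def field_simps)
    have le: "(norm (u x) + norm (w x)) powr q \<le> (r + s) powr q *
        ((1 - t) * (norm (u x) powr q / r powr q) + t * (norm (w x) powr q / s powr q))" for x
    proof -
      have "(norm (u x) + norm (w x)) powr q
          = ((r + s) * ((1 - t) * (norm (u x) / r) + t * (norm (w x) / s))) powr q"
      proof -
        have "(r + s) * ((1 - t) * (norm (u x) / r)) = norm (u x)"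
          "(r + s) * (t * (norm (w x) / s)) = norm (w x)"
          unfolding t(3) using 3 by (simp_all add: t_def)
        then show ?thesis by (simp add: distrib_left)
      qed
      also have "\<dots> = (r + s) powr q * ((1 - t) * (norm (u x) / r) + t * (norm (w x) / s)) powr q"
        using 3 t(1,2) by (subst powr_mult) auto
      also have "\<dots> \<le> (r + s) powr q *
          ((1 - t) * (norm (u x) / r) powr q + t * (norm (w x) / s) powr q)"
        using convex_onD[OF convex_on_powr_nonneg[OF 2(2)], of t "norm (u x) / r" "norm (w x) / s"] t 3
        by (intro mult_left_mono) auto
      finally show ?thesis using 3 by (simp add: powr_divide)
    qed
    have "(\<Sum>x\<in>F. norm (u x + w x) powr q) \<le> (r + s) powr q" if "finite F" for F
    proof -
      have "(\<Sum>x\<in>F. norm (u x + w x) powr q) \<le> (\<Sum>x\<in>F. (norm (u x) + norm (w x)) powr q)"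
        using 2 by (intro sum_mono powr_mono2 norm_triangle_ineq) auto
      also have "\<dots> \<le> (\<Sum>x\<in>F. (r + s) powr q *
          ((1 - t) * (norm (u x) powr q / r powr q) + t * (norm (w x) powr q / s powr q)))"
        by (intro sum_mono le)
      also have "\<dots> = (r + s) powr q * ((1 - t) * ((\<Sum>x\<in>F. norm (u x) powr q) / r powr q)
          + t * ((\<Sum>x\<in>F. norm (w x) powr q) / s powr q))"
        by (simp add: sum_distrib_left[symmetric] sum.distrib sum_divide_distrib[symmetric])
      also have "\<dots> \<le> (r + s) powr q * ((1 - t) * 1 + t * 1)"
        using u w 2 3 t that by (intro mult_left_mono add_mono) (auto simp: lp_le_finite divide_le_eq)
      finally show ?thesis by simp
    qed
    then show ?thesis using 2 3 by (simp add: lp_le_finite)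
  qed
qed

lemma lp_le_zero: "1 \<le> p \<Longrightarrow> 0 \<le> r \<Longrightarrow> lp_le p r (\<lambda>x. 0)"
  by (elim exponent_cases) (auto simp: lp_le_infty lp_le_finite)

lemma lp_le_sum:
  assumes "1 \<le> p" "finite I" "\<And>i. i \<in> I \<Longrightarrow> lp_le p (r i) (u i)"
  shows "lp_le p (\<Sum>i\<in>I. r i) (\<lambda>x. \<Sum>i\<in>I. u i x)"
  using assms(2,3)
  by (induction I rule: finite_induct) (auto simp: lp_le_zero assms(1) intro!: lp_le_add)

lemma lp_le_diff:
  assumes "1 \<le> p" "lp_le p r u" "lp_le p s w"
  shows "lp_le p (r + s) (\<lambda>x. u x - w x)"
  using lp_le_add[OF assms(1,2) lp_le_scale[OF assms(1,3), of "-1"]] by simp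

lemma lp_le_single:
  assumes "1 \<le> p"
  shows "lp_le p (norm c) (\<lambda>x. if x = y then c else 0)"
  using assms
proof (cases rule: exponent_cases)
  case 1
  then show ?thesis by (simp add: lp_le_infty)
next
  case (2 q)
  have "(\<Sum>x\<in>F. norm (if x = y then c else 0) powr q) \<le> norm c powr q" if "finite F" for F
  proof -
    have "(\<Sum>x\<in>F. norm (if x = y then c else 0) powr q) = (\<Sum>x\<in>F. if x = y then norm c powr q else 0)"
      using 2 by (intro sum.cong) auto
    also have "\<dots> \<le> norm c powr q" using that by simp
    finally show ?thesis .
  qed
  then show ?thesis using 2 by (simp add: lp_le_finite)
qed

lemma lp_le_restrict_finite:
  assumes "1 \<le> p" "finite F"
  shows "lp_le p (\<Sum>y\<in>F. norm (u y)) (\<lambda>x. if x \<in> F then u x else 0)"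
proof -
  have "(\<lambda>x. if x \<in> F then u x else 0) = (\<lambda>x. \<Sum>y\<in>F. if x = y then u y else 0)"
    using assms by auto
  then show ?thesis
    using lp_le_sum[OF assms, of "\<lambda>y. norm (u y)" "\<lambda>y x. if x = y then u y else 0"]
    by (simp add: lp_le_single[OF assms(1)])
qed

text \<open>Fatou's lemma for counting measure: each test involves finitely many coordinates only,
  so pointwise convergence suffices.\<close>

lemma lp_le_lim:
  assumes p: "1 \<le> p" and U: "\<forall>\<^sub>F n in sequentially. lp_le p r (U n)"
    and l: "\<And>x. (\<lambda>n. U n x) \<longlonglongrightarrow> u x"
  shows "lp_le p r u"
  using p
proof (cases rule: exponent_cases)
  case 1
  have "norm (u x) \<le> r" for x
    by (rule tendsto_upperbound[OF tendsto_norm[OF l]])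
      (use U in \<open>auto elim!: eventually_mono simp: 1 lp_le_infty\<close>)
  then show ?thesis by (simp add: 1 lp_le_infty)
next
  case (2 q)
  have "(\<Sum>x\<in>F. norm (u x) powr q) \<le> r powr q" if F: "finite F" for F
  proof (rule tendsto_upperbound)
    show "(\<lambda>n. \<Sum>x\<in>F. norm (U n x) powr q) \<longlonglongrightarrow> (\<Sum>x\<in>F. norm (u x) powr q)"
      using 2 by (intro tendsto_sum tendsto_powr2 tendsto_norm l) auto
    show "\<forall>\<^sub>F n in sequentially. (\<Sum>x\<in>F. norm (U n x) powr q) \<le> r powr q"
      using U F by (auto elim!: eventually_mono simp: 2 lp_le_finite)
  qed simp
  moreover have "0 \<le> r"
    using eventually_happens[OF U] lp_le_nonneg[OF p] by auto
  ultimately show ?thesis using 2 by (simp add: lp_le_finite)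
qed

lemma lp_le_reindex:
  assumes p: "1 \<le> p" and f: "bij f" and u: "lp_le p r u"
  shows "lp_le p r (\<lambda>x. u (f x))"
  using p
proof (cases rule: exponent_cases)
  case 1
  then show ?thesis using u by (simp add: lp_le_infty)
next
  case (2 q)
  have "(\<Sum>x\<in>F. norm (u (f x)) powr q) \<le> r powr q" if "finite F" for F
  proof -
    have "(\<Sum>x\<in>F. norm (u (f x)) powr q) = (\<Sum>x\<in>f ` F. norm (u x) powr q)"
      using f by (subst sum.reindex) (auto intro: inj_on_subset simp: bij_def)
    then show ?thesis using u that by (simp add: 2 lp_le_finite)
  qed
  then show ?thesis using 2 lp_le_nonneg[OF p u] by (simp add: lp_le_finite)
qed

text \<open>Jensen's inequality for the probability weights \<open>k y / sum k N\<close>; undoing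
  the normalisation leaves the factor \<open>sum k N powr (q - 1)\<close>, which is estimated
  through \<open>a\<close>.\<close>

lemma powr_weighted_sum_le:
  assumes q: "1 \<le> (q::real)" and N: "finite N" and k: "\<And>y. y \<in> N \<Longrightarrow> 0 \<le> k y"
    and t: "\<And>y. y \<in> N \<Longrightarrow> 0 \<le> t y" and a: "sum k N \<le> a"
  shows "(\<Sum>y\<in>N. k y * t y) powr q \<le> a powr (q - 1) * (\<Sum>y\<in>N. k y * t y powr q)"
proof (cases "sum k N = 0")
  case True
  then have "k y = 0" if "y \<in> N" for y using that k N by (simp add: sum_nonneg_eq_0_iff)
  then have "(\<Sum>y\<in>N. k y * t y) = 0" by simp
  then show ?thesis using k by (auto intro!: mult_nonneg_nonneg sum_nonneg)
next
  case False
  define s where "s = sum k N"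
  have s: "0 < s" using False k by (simp add: s_def order_less_le sum_nonneg)
  have "N \<noteq> {}" using False by auto
  then have "(\<Sum>y\<in>N. (k y / s) *\<^sub>R t y) powr q \<le> (\<Sum>y\<in>N. (k y / s) * t y powr q)"
    using s k t by (intro convex_on_sum[OF N _ convex_on_powr_nonneg[OF q]])
      (auto simp: s_def simp flip: sum_divide_distrib)
  then have *: "(\<Sum>y\<in>N. k y * t y / s) powr q \<le> (\<Sum>y\<in>N. k y * t y powr q / s)"
    by simp
  have "(\<Sum>y\<in>N. k y * t y) powr q = (s * (\<Sum>y\<in>N. k y * t y / s)) powr q"
    using s by (simp add: sum_distrib_left)
  also have "\<dots> = s powr q * (\<Sum>y\<in>N. k y * t y / s) powr q"
    using s k t by (subst powr_mult) (auto intro!: sum_nonneg)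
  also have "\<dots> \<le> s powr q * (\<Sum>y\<in>N. k y * t y powr q / s)"
    using * by (intro mult_left_mono) auto
  also have "\<dots> = s powr (q - 1) * (\<Sum>y\<in>N. k y * t y powr q)"
    using s by (simp add: sum_divide_distrib[symmetric] powr_diff)
  also have "\<dots> \<le> a powr (q - 1) * (\<Sum>y\<in>N. k y * t y powr q)"
    using s a q k by (intro mult_right_mono powr_mono2 sum_nonneg) (auto simp: s_def)
  finally show ?thesis .
qed

text \<open>Schur's test. Jensen applied to each row yields \<open>a powr (q - 1)\<close>, and
  summing over \<open>x\<close> first yields one more factor \<open>a\<close> from the columns, so
  one constant serves all exponents at once.\<close>

lemma lp_le_schur:
  assumes p: "1 \<le> p" and u: "lp_le p r u"
    and N: "\<And>x. finite (N x)" and k: "\<And>x y. 0 \<le> k x y"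
    and row: "\<And>x. (\<Sum>y\<in>N x. k x y) \<le> a"
    and col: "\<And>y T. finite T \<Longrightarrow> (\<Sum>x\<in>T. k x y) \<le> a"
    and g: "\<And>x. norm (g x) \<le> (\<Sum>y\<in>N x. k x y * norm (u y))"
  shows "lp_le p (a * r) g"
  using p
proof (cases rule: exponent_cases)
  case 1
  have "norm (g x) \<le> a * r" for x
  proof -
    have "norm (g x) \<le> (\<Sum>y\<in>N x. k x y * r)"
      by (intro order_trans[OF g] sum_mono mult_left_mono k lp_le_at[OF p u])
    also have "\<dots> \<le> a * r"
      using row lp_le_nonneg[OF p u] by (simp add: mult_right_mono flip: sum_distrib_right)
    finally show ?thesis .
  qed
  then show ?thesis by (simp add: 1 lp_le_infty)
next
  case (2 q)
  have a: "0 \<le> a" using col[of "{}"] by simp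
  have r: "0 \<le> r" using lp_le_nonneg[OF p u] .
  have "(\<Sum>x\<in>F. norm (g x) powr q) \<le> (a * r) powr q" if F: "finite F" for F
  proof -
    define Y where "Y = (\<Union>x\<in>F. N x)"
    have Y: "finite Y" using F N by (auto simp: Y_def)
    have "(\<Sum>x\<in>F. norm (g x) powr q) \<le> (\<Sum>x\<in>F. (\<Sum>y\<in>N x. k x y * norm (u y)) powr q)"
      using 2 by (intro sum_mono powr_mono2 g) auto
    also have "\<dots> \<le> (\<Sum>x\<in>F. a powr (q - 1) * (\<Sum>y\<in>N x. k x y * norm (u y) powr q))"
      using 2 by (intro sum_mono powr_weighted_sum_le N k row) auto
    also have "\<dots> \<le> (\<Sum>x\<in>F. a powr (q - 1) * (\<Sum>y\<in>Y. k x y * norm (u y) powr q))"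
      using Y by (intro sum_mono mult_left_mono sum_mono2) (auto simp: Y_def k)
    also have "\<dots> = a powr (q - 1) * (\<Sum>y\<in>Y. (\<Sum>x\<in>F. k x y) * norm (u y) powr q)"
      by (simp add: sum_distrib_left sum_distrib_right sum.swap[of _ F])
    also have "\<dots> \<le> a powr (q - 1) * (\<Sum>y\<in>Y. a * norm (u y) powr q)"
      by (intro mult_left_mono sum_mono mult_right_mono col F) auto
    also have "\<dots> = a powr q * (\<Sum>y\<in>Y. norm (u y) powr q)"
    proof (cases "a = 0")
      case False
      then show ?thesis using a by (simp add: powr_diff flip: sum_distrib_left)
    qed simp
    also have "\<dots> \<le> a powr q * r powr q"
      using u Y 2 by (intro mult_left_mono) (auto simp: lp_le_finite)
    finally show ?thesis using a r by (simp add: powr_mult)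
  qed
  then show ?thesis using 2 a r by (simp add: lp_le_finite)
qed

lemma lp_le_imp_lp: "lp_le p r u \<Longrightarrow> u \<in> lp p"
  by (rule lp_leD)

lemma lp_le_0_imp_eq_0:
  assumes "1 \<le> p" "lp_le p 0 u"
  shows "u x = 0"
  using lp_le_at[OF assms, of x] by simp

lemma lp_add: "1 \<le> p \<Longrightarrow> u \<in> lp p \<Longrightarrow> w \<in> lp p \<Longrightarrow> (\<lambda>x. u x + w x) \<in> lp p"
  by (rule lp_leD[OF lp_le_add[OF _ lp_le_lp_norm lp_le_lp_norm]])

lemma lp_diff: "1 \<le> p \<Longrightarrow> u \<in> lp p \<Longrightarrow> w \<in> lp p \<Longrightarrow> (\<lambda>x. u x - w x) \<in> lp p"
  by (rule lp_leD[OF lp_le_diff[OF _ lp_le_lp_norm lp_le_lp_norm]])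

lemma lp_scale: "1 \<le> p \<Longrightarrow> u \<in> lp p \<Longrightarrow> (\<lambda>x. c * u x) \<in> lp p"
  by (rule lp_leD[OF lp_le_scale[OF _ lp_le_lp_norm]])

lemma lp_sum:
  assumes "1 \<le> p" "finite B" "\<And>b. b \<in> B \<Longrightarrow> f b \<in> lp p"
  shows "(\<lambda>x. \<Sum>b\<in>B. f b x) \<in> lp p"
  by (rule lp_leD[OF lp_le_sum[OF assms(1,2) lp_le_lp_norm[OF assms(3)]]])

text \<open>Dominated convergence: off a finite set \<open>F\<close> the tail of \<open>u\<close> is
  small and \<open>g\<close> is bounded by \<open>M\<close>; on \<open>F\<close> only finitely many
  pointwise limits are taken.\<close>

lemma lp_norm_mult_tendsto_0:
  assumes q: "1 \<le> q" and u: "u \<in> lp (ereal q)" and M: "\<And>m x. norm (g m x) \<le> M"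
    and l: "\<And>x. (\<lambda>m. g m x) \<longlonglongrightarrow> 0"
  shows "(\<lambda>m. lp_norm (ereal q) (\<lambda>x. g m x * u x)) \<longlonglongrightarrow> 0"
proof (rule LIMSEQ_I)
  fix e :: real assume e: "0 < e"
  let ?f = "\<lambda>x. norm (u x) powr q"
  have M0: "0 \<le> M" using M norm_ge_zero order_trans by blast
  have s: "?f summable_on UNIV" using u by (simp add: lp_def)
  \<comment> \<open>A tail with \<open>q\<close>-th power sums at most \<open>d\<close> has norm at
    most \<open>e / (4 * (M + 1))\<close>, hence contributes at most \<open>e / 4\<close> after
    multiplication by \<open>g\<close>. The \<open>+ 1\<close> covers \<open>M = 0\<close>.\<close>
  define d where "d = (e / (4 * (M + 1))) powr q"
  have d: "0 < d" using e M0 by (simp add: d_def)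
  obtain F where F: "finite F" and "dist (sum ?f F) (infsum ?f UNIV) \<le> d"
    using infsum_finite_approximation[OF s d] by auto
  then have tail: "sum ?f T \<le> d" if T: "finite T" "T \<inter> F = {}" for T
  proof -
    have "sum ?f T + sum ?f F \<le> infsum ?f UNIV"
      using finite_sum_le_infsum[OF s, of "T \<union> F"] F T by (simp add: sum.union_disjoint)
    with \<open>dist _ _ \<le> d\<close> show ?thesis by (simp add: dist_real_def)
  qed
  have 1: "lp_le (ereal q) (e / 4) (\<lambda>x. g m x * (if x \<in> F then 0 else u x))" for m
  proof -
    have "lp_le (ereal q) (e / (4 * (M + 1))) (\<lambda>x. if x \<in> F then 0 else u x)"
    proof -
      have "(\<Sum>x\<in>T. norm (if x \<in> F then 0 else u x) powr q) \<le> d" if "finite T" for T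
      proof -
        have "(\<Sum>x\<in>T. norm (if x \<in> F then 0 else u x) powr q) = sum ?f (T - F)"
          using that by (intro sum.mono_neutral_cong_right) auto
        with tail[of "T - F"] that show ?thesis by auto
      qed
      then show ?thesis using q e M0 by (simp add: lp_le_finite d_def)
    qed
    from lp_le_scale[OF _ this, of "of_real (M + 1)"] q
    have *: "lp_le (ereal q) (norm (complex_of_real (M + 1)) * (e / (4 * (M + 1))))
        (\<lambda>x. of_real (M + 1) * (if x \<in> F then 0 else u x))" by simp
    have "norm (complex_of_real (M + 1)) * (e / (4 * (M + 1))) = e / 4"
      using M0 unfolding norm_of_real by (simp add: divide_simps)
    moreover have "norm (g m x) \<le> norm (complex_of_real (M + 1))" for x
      using M[of m x] M0 unfolding norm_of_real by simp
    ultimately show ?thesis using q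
      by (intro lp_le_mono[OF _ *]) (auto simp: norm_mult mult_right_mono simp del: of_real_add)
  qed
  have "(\<lambda>m. \<Sum>x\<in>F. norm (g m x * u x)) \<longlonglongrightarrow> (\<Sum>x\<in>F. norm (0 * u x))"
    by (intro tendsto_intros l)
  then have "\<forall>\<^sub>F m in sequentially. (\<Sum>x\<in>F. norm (g m x * u x)) < e / 4"
    using e by (intro order_tendstoD) auto
  then obtain m0 where m0: "\<And>m. m \<ge> m0 \<Longrightarrow> (\<Sum>x\<in>F. norm (g m x * u x)) < e / 4"
    by (auto simp: eventually_sequentially)
  have "norm (lp_norm (ereal q) (\<lambda>x. g m x * u x) - 0) < e" if "m \<ge> m0" for m
  proof -
    have "lp_le (ereal q) (e / 4 + (\<Sum>x\<in>F. norm (g m x * u x)))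
       (\<lambda>x. g m x * (if x \<in> F then 0 else u x) + (if x \<in> F then g m x * u x else 0))"
      using q by (intro lp_le_add 1 lp_le_restrict_finite F) auto
    also have "(\<lambda>x. g m x * (if x \<in> F then 0 else u x) + (if x \<in> F then g m x * u x else 0))
        = (\<lambda>x. g m x * u x)" by auto
    finally have *: "lp_le (ereal q) (e / 4 + (\<Sum>x\<in>F. norm (g m x * u x))) (\<lambda>x. g m x * u x)" .
    have "0 \<le> lp_norm (ereal q) (\<lambda>x. g m x * u x)"
      using q lp_leD[OF *] by (intro lp_norm_nonneg) auto
    then show ?thesis using lp_leD(2)[OF *] m0[OF that] e by simp
  qed
  then show "\<exists>no. \<forall>n\<ge>no. norm (lp_norm (ereal q) (\<lambda>x. g n x * u x) - 0) < e" by blast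
qed

section \<open>Lattice coordinates\<close>

definition l1 :: "int ^ 'n::finite \<Rightarrow> int" where
  "l1 a = (\<Sum>i\<in>UNIV. \<bar>a $ i\<bar>)"

lemma l1_nonneg: "0 \<le> l1 a"
  by (simp add: l1_def sum_nonneg)

lemma l1_zero [simp]: "l1 0 = 0"
  by (simp add: l1_def)

lemma l1_minus [simp]: "l1 (- a) = l1 a"
  by (simp add: l1_def)

lemma l1_add_le: "l1 (a + b) \<le> l1 a + l1 b"
  by (simp add: l1_def abs_triangle_ineq sum_mono flip: sum.distrib)

lemma component_le_l1: "\<bar>a $ i\<bar> \<le> l1 a"
  unfolding l1_def by (intro member_le_sum) auto

lemma int_box_eq_image: "{a::int ^ 'n::finite. \<forall>i. \<bar>a $ i\<bar> \<le> K} = vec_lambda ` PiE UNIV (\<lambda>_. {-K..K})"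
proof safe
  fix a :: "int ^ 'n" assume "\<forall>i. \<bar>a $ i\<bar> \<le> K"
  then have "vec_nth a \<in> PiE UNIV (\<lambda>_. {-K..K})" by (auto simp: abs_le_iff minus_le_iff)
  then show "a \<in> vec_lambda ` PiE UNIV (\<lambda>_. {-K..K})"
    by (metis imageI vec_nth_inverse)
qed (auto simp: abs_le_iff minus_le_iff)

lemma finite_l1_le: "finite {a::int ^ 'n::finite. l1 a \<le> K}"
proof (rule finite_subset)
  show "{a::int ^ 'n. l1 a \<le> K} \<subseteq> {a. \<forall>i. \<bar>a $ i\<bar> \<le> K}"
    using component_le_l1 order_trans by blast
  show "finite {a::int ^ 'n. \<forall>i. \<bar>a $ i\<bar> \<le> K}"
    unfolding int_box_eq_image by (intro finite_imageI finite_PiE) auto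
qed

text \<open>The nonnegative and the nonpositive integers each give a geometric series; counting 0
  twice only enlarges the bound.\<close>

lemma sum_exp_abs_le:
  assumes "0 < (\<epsilon>::real)"
  shows "(\<Sum>k\<in>{-K..K::int}. exp (- \<epsilon> * real_of_int \<bar>k\<bar>)) \<le> 2 / (1 - exp (- \<epsilon>))"
proof -
  define r where "r = exp (- \<epsilon>)"
  have r: "0 < r" "r < 1" using assms by (auto simp: r_def)
  have s: "(\<Sum>k\<in>int ` {0..nat K}. exp (- \<epsilon> * real_of_int \<bar>k\<bar>)) \<le> 1 / (1 - r)"
  proof -
    have "(\<Sum>k\<in>int ` {0..nat K}. exp (- \<epsilon> * real_of_int \<bar>k\<bar>)) = (\<Sum>j\<in>{0..nat K}. r ^ j)"
      by (subst sum.reindex) (auto simp: r_def mult.commute simp flip: exp_of_nat_mult)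
    also have "\<dots> \<le> (\<Sum>j. r ^ j)"
      using r by (intro sum_le_suminf summable_geometric) auto
    finally show ?thesis using r by (simp add: suminf_geometric)
  qed
  have "(\<Sum>k\<in>{-K..K}. exp (- \<epsilon> * real_of_int \<bar>k\<bar>)) \<le> (\<Sum>k\<in>int ` {0..nat K} \<union> uminus ` int ` {0..nat K}. exp (- \<epsilon> * real_of_int \<bar>k\<bar>))"
  proof (intro sum_mono2)
    show "{-K..K} \<subseteq> int ` {0..nat K} \<union> uminus ` int ` {0..nat K}"
    proof
      fix k assume "k \<in> {-K..K}"
      then have "k = int (nat k) \<and> nat k \<le> nat K \<or> k = - int (nat (-k)) \<and> nat (-k) \<le> nat K"
        by auto
      then show "k \<in> int ` {0..nat K} \<union> uminus ` int ` {0..nat K}" by fastforce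
    qed
  qed auto
  also have "\<dots> \<le> (\<Sum>k\<in>int ` {0..nat K}. exp (- \<epsilon> * real_of_int \<bar>k\<bar>)) + (\<Sum>k\<in>uminus ` int ` {0..nat K}. exp (- \<epsilon> * real_of_int \<bar>k\<bar>))"
    by (subst sum.union_inter[symmetric]) (auto intro!: sum_nonneg)
  also have "(\<Sum>k\<in>uminus ` int ` {0..nat K}. exp (- \<epsilon> * real_of_int \<bar>k\<bar>)) = (\<Sum>k\<in>int ` {0..nat K}. exp (- \<epsilon> * real_of_int \<bar>k\<bar>))"
    by (subst sum.reindex) auto
  finally show ?thesis using s by (simp add: r_def)
qed

text \<open>\<open>exp (- \<epsilon> * l1 a)\<close> is a product over the coordinates, so the sum
  over a box containing \<open>A\<close> is the \<open>CARD('n)\<close>-th power of a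
  one-dimensional sum, whose bound does not depend on the size of the box.\<close>

lemma sum_exp_l1_le:
  assumes "0 < (\<epsilon>::real)" "finite A"
  shows "(\<Sum>a\<in>A. exp (- \<epsilon> * l1 (a::int ^ 'n::finite))) \<le> (2 / (1 - exp (- \<epsilon>))) ^ CARD('n)"
proof -
  define K where "K = (\<Sum>a\<in>A. l1 a)"
  have "l1 a \<le> K" if "a \<in> A" for a
    unfolding K_def using that assms by (intro member_le_sum) (auto simp: l1_nonneg)
  then have AK: "A \<subseteq> {a. \<forall>i. \<bar>a $ i\<bar> \<le> K}"
    using component_le_l1 order_trans by blast
  have "(\<Sum>a\<in>A. exp (- \<epsilon> * l1 a)) \<le> (\<Sum>a\<in>vec_lambda ` PiE UNIV (\<lambda>_. {-K..K}). exp (- \<epsilon> * l1 (a::int^'n)))"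
    using AK unfolding int_box_eq_image by (intro sum_mono2 finite_imageI finite_PiE) auto
  also have "\<dots> = (\<Sum>f\<in>PiE (UNIV::'n set) (\<lambda>_. {-K..K}). \<Prod>i\<in>UNIV. exp (- \<epsilon> * \<bar>f i\<bar>))"
    by (subst sum.reindex)
      (auto simp: l1_def inj_on_def vec_lambda_inject exp_sum[symmetric] sum_distrib_left)
  also have "\<dots> = (\<Prod>i\<in>(UNIV::'n set). \<Sum>k\<in>{-K..K}. exp (- \<epsilon> * real_of_int \<bar>k\<bar>))"
    by (subst prod_sum_PiE) auto
  also have "\<dots> \<le> (\<Prod>i\<in>(UNIV::'n set). 2 / (1 - exp (- \<epsilon>)))"
    using sum_exp_abs_le[OF assms(1), of K] by (intro prod_mono) (auto intro!: sum_nonneg)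
  finally show ?thesis by simp
qed

lemma tends_to_infinity_iff:
  "tends_to_infinity h \<longleftrightarrow> (\<forall>K. \<forall>\<^sub>F m in sequentially. K \<le> l1 (h m))"
  by (simp add: tends_to_infinity_def filterlim_at_top l1_def)

lemma tends_to_infinity_avoids_finite:
  assumes "tends_to_infinity h" "finite A"
  shows "\<forall>\<^sub>F m in sequentially. h m \<notin> A"
proof -
  define K where "K = (\<Sum>a\<in>A. l1 a) + 1"
  have "l1 a < K" if "a \<in> A" for a
    using member_le_sum[OF that, of l1] assms by (simp add: K_def l1_nonneg)
  moreover have "\<forall>\<^sub>F m in sequentially. K \<le> l1 (h m)"
    using assms(1) by (simp add: tends_to_infinity_iff)
  ultimately show ?thesis by (fastforce elim!: eventually_mono)
qed

text \<open>Lattice balls are finite, so an injective sequence visits each of them only finitely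
  often.\<close>

lemma tends_to_infinity_inj:
  assumes "inj h"
  shows "tends_to_infinity h"
  unfolding tends_to_infinity_iff
proof
  fix K
  have "finite {m. l1 (h m) \<le> K}"
    using finite_vimageI[OF finite_l1_le assms, of K] by (simp add: vimage_def)
  then have "\<forall>\<^sub>F m in sequentially. \<not> l1 (h m) \<le> K"
    by (simp add: eventually_cofinite flip: cofinite_eq_sequentially)
  then show "\<forall>\<^sub>F m in sequentially. K \<le> l1 (h m)"
    by (auto elim!: eventually_mono)
qed

lemma tends_to_infinity_add_const:
  assumes "tends_to_infinity h"
  shows "tends_to_infinity (\<lambda>m. h m + b)"
  unfolding tends_to_infinity_iff
proof
  fix K
  have "l1 a \<le> l1 (a + b) + l1 b" for a :: "int ^ 'a" and b
    using l1_add_le[of "a + b" "- b"] by simp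
  moreover have "\<forall>\<^sub>F m in sequentially. K + l1 b \<le> l1 (h m)"
    using assms by (simp add: tends_to_infinity_iff)
  ultimately show "\<forall>\<^sub>F m in sequentially. K \<le> l1 (h m + b)"
    by (auto elim!: eventually_mono) (smt (verit))
qed

lemma tends_to_infinity_subseq:
  assumes "tends_to_infinity h" "strict_mono k"
  shows "tends_to_infinity (\<lambda>m. h (k m))"
  using assms filterlim_compose[OF _ filterlim_subseq[OF assms(2)]]
  by (simp add: tends_to_infinity_def)

section \<open>Orbit representatives and lattice coordinates of a periodic graph\<close>

locale lattice_graph =
  fixes adj :: "'a::countable \<Rightarrow> 'a \<Rightarrow> bool"
    and act :: "(int ^ 'n::finite) \<Rightarrow> 'a \<Rightarrow> 'a"
  assumes periodic: "periodic_graph adj act"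
begin

lemma finite_adj [simp]: "finite {y. adj x y}"
  and act_0 [simp]: "act 0 x = x"
  and act_add: "act (a + b) x = act a (act b x)"
  and act_free: "act a x = x \<Longrightarrow> a = 0"
  and adj_act [simp]: "adj (act a x) (act a y) \<longleftrightarrow> adj x y"
  and finite_orbits: "finite (range (\<lambda>x. range (\<lambda>a. act a x)))"
  and not_adj_refl [simp]: "\<not> adj x x"
  using periodic unfolding periodic_graph_def by metis+

lemma act_minus [simp]: "act (- a) (act a x) = x" "act a (act (- a) x) = x"
  by (simp_all flip: act_add)

lemma act_cancel: "act a x = act b x \<Longrightarrow> a = b"
  using act_free[of "- b + a" x] act_add[of "- b" a x] by simp

lemma bij_act: "bij (act a)"
  by (rule bij_betwI[where g = "act (- a)"]) auto

text \<open>The choice is made from the orbit as a set, so all points of one orbit get the same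
  representative. By freeness the translation \<open>coord x\<close> leading from it to
  \<open>x\<close> is unique.\<close>

definition rep :: "'a \<Rightarrow> 'a" where
  "rep x = (SOME y. y \<in> range (\<lambda>a. act a x))"

definition coord :: "'a \<Rightarrow> int ^ 'n" where
  "coord x = (SOME a. x = act a (rep x))"

lemma finite_rep: "finite (range rep)"
proof -
  have "range rep = (\<lambda>S. SOME y. y \<in> S) ` range (\<lambda>x. range (\<lambda>a. act a x))"
    by (auto simp: rep_def)
  then show ?thesis using finite_orbits by simp
qed

lemma rep_act [simp]: "rep (act b x) = rep x"
proof -
  have "range (\<lambda>a. act a (act b x)) = range (\<lambda>a. act a x)"
  proof safe
    fix a show "act a (act b x) \<in> range (\<lambda>a. act a x)"
      by (metis act_add rangeI)
    show "act a x \<in> range (\<lambda>a. act a (act b x))"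
      by (rule image_eqI[where x = "a - b"]) (simp_all flip: act_add)
  qed
  then show ?thesis by (simp add: rep_def)
qed

lemma act_coord_rep [simp]: "act (coord x) (rep x) = x"
proof -
  have "rep x \<in> range (\<lambda>a. act a x)"
    unfolding rep_def by (rule someI[of _ x]) (metis act_0 rangeI)
  then obtain a where "rep x = act a x" by auto
  then have "x = act (- a) (rep x)" by simp
  then show ?thesis unfolding coord_def by (metis (mono_tags, lifting) someI)
qed

lemma coord_act [simp]: "coord (act a x) = a + coord x"
proof (rule act_cancel)
  show "act (coord (act a x)) (rep x) = act (a + coord x) (rep x)"
    using act_coord_rep[of "act a x"] by (simp add: act_add del: act_coord_rep) simp
qed

text \<open>The distance of the lattice coordinates serves as a substitute for the graph distance:
  neighbours are at distance at most \<open>step\<close> (below), and exponential weights are uniformly summable.\<close>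

definition pd :: "'a \<Rightarrow> 'a \<Rightarrow> real" where
  "pd x y = l1 (coord x - coord y)"

lemma pd_nonneg [simp]: "0 \<le> pd x y"
  by (simp add: pd_def l1_nonneg)

lemma pd_refl [simp]: "pd x x = 0"
  by (simp add: pd_def)

lemma pd_sym: "pd x y = pd y x"
  unfolding pd_def by (metis l1_minus minus_diff_eq)

lemma pd_triangle: "pd x z \<le> pd x y + pd y z"
  using l1_add_le[of "coord x - coord y" "coord y - coord z"]
  by (simp add: pd_def flip: of_int_add)

lemma pd_act [simp]: "pd (act a x) (act a y) = pd x y"
  by (simp add: pd_def)

definition nbh :: "real \<Rightarrow> 'a \<Rightarrow> 'a set" where
  "nbh R x = {y. pd x y \<le> R}"

lemma nbh_iff: "y \<in> nbh R x \<longleftrightarrow> pd x y \<le> R"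
  by (simp add: nbh_def)

text \<open>A point is determined by its representative and its coordinate, so a ball has at most
  one point per orbit for each admissible coordinate difference. \<open>pd\<close> is only a
  pseudometric: distinct representatives are at distance 0.\<close>

lemma finite_nbh [simp]: "finite (nbh R x)"
proof (rule finite_subset)
  show "nbh R x \<subseteq> (\<lambda>(a, d). act (coord x - a) d) ` ({a. l1 a \<le> \<lfloor>R\<rfloor>} \<times> range rep)"
  proof
    fix y assume "y \<in> nbh R x"
    then have "(coord x - coord y, rep y) \<in> {a. l1 a \<le> \<lfloor>R\<rfloor>} \<times> range rep"
      by (auto simp: nbh_iff pd_def le_floor_iff)
    moreover have "y = (\<lambda>(a, d). act (coord x - a) d) (coord x - coord y, rep y)" by simp
    ultimately show "y \<in> (\<lambda>(a, d). act (coord x - a) d) ` ({a. l1 a \<le> \<lfloor>R\<rfloor>} \<times> range rep)"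
      by (rule image_eqI[rotated])
  qed
  show "finite ((\<lambda>(a, d). act (coord x - a) d) ` ({a. l1 a \<le> \<lfloor>R\<rfloor>} \<times> range rep))"
    using finite_l1_le finite_rep by blast
qed

text \<open>Pairing a point with its representative and its coordinate difference to
  \<open>x\<close> splits the sum into finitely many lattice sums, one per orbit. Only the
  difference enters, hence a bound independent of \<open>x\<close>.\<close>

lemma exp_pd_sum_bounded:
  assumes "0 < \<epsilon>"
  obtains S where "0 \<le> S" "\<And>x T. finite T \<Longrightarrow> (\<Sum>y\<in>T. exp (- \<epsilon> * pd x y)) \<le> S"
proof
  let ?S = "card (range rep) * (2 / (1 - exp (- \<epsilon>))) ^ CARD('n)"
  show "0 \<le> ?S" using assms by simp
  fix x T assume T: "finite (T :: 'a set)"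
  have inj: "inj_on (\<lambda>y. (rep y, coord x - coord y)) T"
    by (rule inj_on_inverseI[where g = "\<lambda>(d, a). act (coord x - a) d"]) simp
  have "(\<Sum>y\<in>T. exp (- \<epsilon> * pd x y)) = (\<Sum>(d, a)\<in>(\<lambda>y. (rep y, coord x - coord y)) ` T. exp (- \<epsilon> * l1 a))"
    by (subst sum.reindex[OF inj]) (simp add: pd_def)
  also have "\<dots> \<le> (\<Sum>(d, a)\<in>range rep \<times> (\<lambda>y. coord x - coord y) ` T. exp (- \<epsilon> * l1 a))"
    using T finite_rep by (intro sum_mono2) auto
  also have "\<dots> = (\<Sum>d\<in>range rep. \<Sum>a\<in>(\<lambda>y. coord x - coord y) ` T. exp (- \<epsilon> * l1 a))"
    by (rule sum.cartesian_product[symmetric])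
  also have "\<dots> \<le> (\<Sum>d\<in>range rep. (2 / (1 - exp (- \<epsilon>))) ^ CARD('n))"
    using T by (intro sum_mono sum_exp_l1_le[OF assms] finite_imageI)
  finally show "(\<Sum>y\<in>T. exp (- \<epsilon> * pd x y)) \<le> ?S" by simp
qed

lemma image_act_adj: "{y. adj (act a x) y} = act a ` {y. adj x y}"
proof safe
  fix y assume "adj (act a x) y"
  then have "adj x (act (- a) y)" by (metis act_minus(2) adj_act)
  then show "y \<in> act a ` {y. adj x y}" by (intro image_eqI[where x = "act (- a) y"]) auto
qed simp

lemma inj_act: "inj_on (act a) A"
  using bij_act[of a] by (auto simp: bij_def intro: inj_on_subset)

lemma degree_act [simp]: "degree adj (act a x) = degree adj x"
  by (simp add: degree_def image_act_adj card_image inj_act)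

text \<open>By invariance, the maximum over edges leaving representatives covers all edges.
  Inserting 0 keeps the set nonempty and the value nonnegative.\<close>

definition step :: real where
  "step = Max (insert 0 (\<Union>d\<in>range rep. pd d ` {y. adj d y}))"

lemma finite_steps: "finite (\<Union>d\<in>range rep. pd d ` {y. adj d y})"
  using finite_rep by (rule finite_UN_I) simp

lemma step_nonneg: "0 \<le> step"
  unfolding step_def using finite_steps by (intro Max_ge) auto

lemma adj_pd_le_step:
  assumes "adj x y"
  shows "pd x y \<le> step"
proof -
  define a where "a = - coord x"
  have a: "act a x = rep x" unfolding a_def by (metis act_coord_rep act_minus(1))
  have "pd x y = pd (rep x) (act a y)" by (simp flip: a)
  moreover have "adj (rep x) (act a y)" using assms by (simp flip: a)
  ultimately show ?thesis unfolding step_def using finite_steps by (intro Max_ge) auto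
qed

end

section \<open>Limit operators\<close>

text \<open>Young's inequality without its sharp constants: comparing \<open>t\<close> with
  \<open>s powr (q - 1)\<close> shows that \<open>s * t\<close> is at most \<open>s powr q\<close>
  in one case and at most \<open>t powr q'\<close> in the other.\<close>

lemma lp_mult_abs_summable:
  assumes "1 < q" "u \<in> lp (ereal q)" "w \<in> lp (ereal (q / (q - 1)))"
  shows "(\<lambda>x. norm (u x * w x)) summable_on UNIV"
proof -
  define q' where "q' = q / (q - 1)"
  have young: "s * t \<le> s powr q + t powr q'" if st: "0 \<le> s" "0 \<le> t" for s t :: real
  proof -
    consider "s = 0 \<or> t = 0" | "0 < s" "0 < t" "t \<le> s powr (q - 1)" | "0 < s" "0 < t" "s powr (q - 1) < t"
      using st by fastforce
    then show ?thesis
    proof cases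
      case 2
      have "s * t \<le> s powr 1 * s powr (q - 1)" using 2 by simp
      also have "\<dots> = s powr q" unfolding powr_add[symmetric] by simp
      finally show ?thesis by (smt (verit) powr_ge_zero)
    next
      case 3
      have "s = (s powr (q - 1)) powr (1 / (q - 1))" using 3 assms(1) by (simp add: powr_powr)
      also have "\<dots> \<le> t powr (1 / (q - 1))" using 3 assms(1) by (intro powr_mono2) auto
      finally have "s * t \<le> t powr (1 / (q - 1)) * t powr 1" using 3 by simp
      also have "\<dots> = t powr q'" using assms(1) unfolding q'_def powr_add[symmetric]
        by (simp add: field_simps)
      finally show ?thesis by (smt (verit) powr_ge_zero)
    qed auto
  qed
  have "(\<lambda>x. norm (u x) powr q + norm (w x) powr q') summable_on UNIV"
    using assms by (intro summable_on_add) (auto simp: lp_def q'_def)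
  then have "(\<lambda>x. norm (norm (u x) powr q + norm (w x) powr q')) summable_on UNIV"
    by (simp add: abs_of_nonneg)
  then show ?thesis
    by (rule Infinite_Sum.abs_summable_on_comparison_test) (simp add: norm_mult young)
qed

context lattice_graph
begin

text \<open>Any uniform bound serves, so one is fixed by choice. One exists because
  \<open>exp R * exp (- pd x y)\<close> is at least 1 on the ball and has uniformly bounded
  sums.\<close>

definition vol :: "real \<Rightarrow> real" where
  "vol R = (SOME Q. 0 \<le> Q \<and> (\<forall>x. real (card (nbh R x)) \<le> Q))"

lemma vol_props: "0 \<le> vol R \<and> (\<forall>x. real (card (nbh R x)) \<le> vol R)"
proof -
  obtain S where S: "0 \<le> S" "\<And>x T. finite T \<Longrightarrow> (\<Sum>y\<in>T. exp (- 1 * pd x y)) \<le> S"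
    using exp_pd_sum_bounded[of 1] by auto
  have "real (card (nbh R x)) \<le> exp R * S" for x
  proof -
    have "real (card (nbh R x)) = (\<Sum>y\<in>nbh R x. 1)" by simp
    also have "\<dots> \<le> (\<Sum>y\<in>nbh R x. exp R * exp (- 1 * pd x y))"
      by (intro sum_mono) (auto simp: nbh_iff simp flip: exp_add)
    also have "\<dots> = exp R * (\<Sum>y\<in>nbh R x. exp (- 1 * pd x y))"
      by (simp add: sum_distrib_left)
    also have "\<dots> \<le> exp R * S" by (intro mult_left_mono S) auto
    finally show ?thesis .
  qed
  then have "0 \<le> exp R * S \<and> (\<forall>x. real (card (nbh R x)) \<le> exp R * S)" using S(1) by simp
  then show ?thesis unfolding vol_def by (rule someI)
qed

lemma vol_nonneg: "0 \<le> vol R" and card_nbh_le_vol: "real (card (nbh R x)) \<le> vol R"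
  using vol_props by auto

text \<open>Schur's test for a constant kernel on a band; membership in balls is symmetric, so the
  columns have the same bound as the rows.\<close>

lemma lp_le_banded:
  assumes p: "1 \<le> p" and u: "lp_le p r u" and \<alpha>: "0 \<le> \<alpha>"
    and g: "\<And>x. norm (g x) \<le> \<alpha> * (\<Sum>y\<in>nbh R x. norm (u y))"
  shows "lp_le p (\<alpha> * vol R * r) g"
proof (rule lp_le_schur[OF p u, where k = "\<lambda>x y. if y \<in> nbh R x then \<alpha> else 0"])
  show "(\<Sum>y\<in>nbh R x. if y \<in> nbh R x then \<alpha> else 0) \<le> \<alpha> * vol R" for x
    using mult_left_mono[OF card_nbh_le_vol \<alpha>] by (simp add: mult.commute)
  show "(\<Sum>x\<in>T. if y \<in> nbh R x then \<alpha> else 0) \<le> \<alpha> * vol R" if "finite T" for y T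
  proof -
    have "(\<Sum>x\<in>T. if y \<in> nbh R x then \<alpha> else 0) = (\<Sum>x\<in>T \<inter> nbh R y. \<alpha>)"
      using that by (simp add: sum.If_cases nbh_iff pd_sym Int_def)
    also have "\<dots> \<le> (\<Sum>x\<in>nbh R y. \<alpha>)" using \<alpha> by (intro sum_mono2) auto
    also have "\<dots> \<le> \<alpha> * vol R"
      using mult_left_mono[OF card_nbh_le_vol \<alpha>] by (simp add: mult.commute)
    finally show ?thesis .
  qed
  show "norm (g x) \<le> (\<Sum>y\<in>nbh R x. (if y \<in> nbh R x then \<alpha> else 0) * norm (u y))" for x
    using g[of x] by (simp add: sum_distrib_left)
qed (use \<alpha> in auto)

section \<open>Banded matrices, with the Schroedinger operator as one of them\<close>

definition hmat :: "('a \<Rightarrow> complex) \<Rightarrow> 'a \<Rightarrow> 'a \<Rightarrow> complex" where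
  "hmat w x y = (if adj x y then 1 / of_nat (degree adj x) else if x = y then w x else 0)"

text \<open>Cutting the kernel to a band makes each value a finite sum: linearity, composition and
  pointwise limits then need no summability argument.\<close>

definition app :: "real \<Rightarrow> ('a \<Rightarrow> 'a \<Rightarrow> complex) \<Rightarrow> ('a \<Rightarrow> complex) \<Rightarrow> 'a \<Rightarrow> complex" where
  "app R k u = (\<lambda>x. \<Sum>y\<in>nbh R x. k x y * u y)"

lemma schr_eq_app: "schr adj w = app step (hmat w)"
proof (intro ext)
  fix u x
  have "app step (hmat w) u x = (\<Sum>y\<in>insert x {y. adj x y}. hmat w x y * u y)"
    unfolding app_def using step_nonneg
    by (intro sum.mono_neutral_right) (auto simp: nbh_iff hmat_def adj_pd_le_step)
  also have "\<dots> = schr adj w u x"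
    by (simp add: schr_def laplacian_def hmat_def sum_distrib_left)
  finally show "schr adj w u x = app step (hmat w) u x" by simp
qed

lemma norm_hmat_le: "\<forall>x. norm (w x) \<le> M \<Longrightarrow> norm (hmat w x y) \<le> 1 + M"
proof -
  assume "\<forall>x. norm (w x) \<le> M"
  then have "norm (w x) \<le> M" by simp
  moreover from this have "0 \<le> M" using norm_ge_zero order_trans by blast
  moreover have "norm (1 / of_nat (degree adj x) :: complex) \<le> 1"
    by (cases "degree adj x") (auto simp: norm_divide divide_simps simp del: of_nat_Suc)
  ultimately show ?thesis unfolding hmat_def by (auto intro: order_trans)
qed

lemma hmat_eq_0: "step < pd x y \<Longrightarrow> hmat w x y = 0"
  using adj_pd_le_step[of x y] step_nonneg by (auto simp: hmat_def)

lemma app_lp_le: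
  assumes "1 \<le> p" "lp_le p r u" "\<And>x y. norm (k x y) \<le> \<alpha>"
  shows "lp_le p (\<alpha> * vol R * r) (app R k u)"
proof (rule lp_le_banded[OF assms(1,2)])
  show "0 \<le> \<alpha>" using assms(3) norm_ge_zero order_trans by blast
  show "norm (app R k u x) \<le> \<alpha> * (\<Sum>y\<in>nbh R x. norm (u y))" for x
    unfolding app_def sum_distrib_left
    by (intro sum_norm_le) (simp add: norm_mult mult_right_mono assms(3))
qed

lemma app_lp:
  assumes "1 \<le> p" "u \<in> lp p" "\<And>x y. norm (k x y) \<le> \<alpha>"
  shows "app R k u \<in> lp p"
  using app_lp_le[OF assms(1) lp_le_lp_norm[OF assms(2)] assms(3)] by (rule lp_leD)

lemma app_linear: "app R k (\<lambda>x. u x + c * w x) = (\<lambda>x. app R k u x + c * app R k w x)"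
  by (simp add: app_def fun_eq_iff distrib_left sum.distrib sum_distrib_left mult.left_commute)

lemma app_add: "app R k (\<lambda>x. u x + w x) = (\<lambda>x. app R k u x + app R k w x)"
  using app_linear[of R k u 1 w] by simp

lemma app_diff: "app R k (\<lambda>x. u x - w x) = (\<lambda>x. app R k u x - app R k w x)"
  using app_linear[of R k u "-1" w] by simp

lemma app_scale: "app R k (\<lambda>x. c * w x) = (\<lambda>x. c * app R k w x)"
  by (simp add: app_def fun_eq_iff sum_distrib_left mult.left_commute)

lemma app_zero [simp]: "app R k (\<lambda>x. 0) = (\<lambda>x. 0)"
  by (simp add: app_def)

lemma app_sum:
  "app R k (\<lambda>x. \<Sum>i\<in>I. f i x) = (\<lambda>x. \<Sum>i\<in>I. app R k (f i) x)"
  by (simp add: app_def fun_eq_iff sum_distrib_left sum.swap[of _ I])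

lemma app_tendsto:
  assumes "\<And>y. (\<lambda>n. k n x y) \<longlonglongrightarrow> k' x y" "\<And>y. (\<lambda>n. u n y) \<longlonglongrightarrow> u' y"
  shows "(\<lambda>n. app R (k n) (u n) x) \<longlonglongrightarrow> app R k' u' x"
  unfolding app_def by (intro tendsto_intros assms)

lemma schr_lp_le:
  assumes "1 \<le> p" "lp_le p r u" "\<forall>x. norm (w x) \<le> M"
  shows "lp_le p ((1 + M) * vol step * r) (schr adj w u)"
  unfolding schr_eq_app by (rule app_lp_le[OF assms(1,2) norm_hmat_le[OF assms(3)]])

lemma bounded_on_schr:
  assumes "1 \<le> p" "bounded (range w)"
  shows "bounded_on p (schr adj w)"
proof -
  obtain M where M: "\<forall>x. norm (w x) \<le> M" using assms(2) by (auto simp: bounded_iff)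
  note * = schr_lp_le[OF assms(1) lp_le_lp_norm M]
  show ?thesis unfolding bounded_on_def
    using lp_leD[OF *] by (auto simp: schr_eq_app app_linear intro!: exI[of _ "(1 + M) * vol step"])
qed

text \<open>The Laplacian commutes with the action, so conjugation by a translation affects the
  potential alone.\<close>

lemma shift_schr: "shift act (- a) (schr adj v (shift act a u)) = schr adj (\<lambda>x. v (act a x)) u"
proof
  fix x
  have "(\<Sum>y | adj (act a x) y. u (act (- a) y)) = (\<Sum>y | adj x y. u y)"
    unfolding image_act_adj by (subst sum.reindex[OF inj_act]) simp
  then show "shift act (- a) (schr adj v (shift act a u)) x = schr adj (\<lambda>x. v (act a x)) u x"
    by (simp add: shift_def schr_def laplacian_def)
qed

lemma nbh_act: "nbh R (act a x) = act a ` nbh R x"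
proof safe
  fix y assume "y \<in> nbh R (act a x)"
  then have "act (- a) y \<in> nbh R x" using pd_act[of a x "act (- a) y"] by (simp add: nbh_iff)
  then show "y \<in> act a ` nbh R x" by (rule image_eqI[rotated]) simp
qed (simp add: nbh_iff)

text \<open>The transpose without complex conjugation, because the pairing in
  \<open>adjoint_on\<close> is bilinear. In general it differs from \<open>schr adj w\<close>, since
  the factor \<open>1 / degree\<close> is attached to the row index.\<close>

definition tschr :: "('a \<Rightarrow> complex) \<Rightarrow> ('a \<Rightarrow> complex) \<Rightarrow> 'a \<Rightarrow> complex" where
  "tschr w = app step (\<lambda>x y. hmat w y x)"

lemma hmat_act: "hmat v (act a x) (act a y) = hmat (\<lambda>x. v (act a x)) x y"
  using act_cancel bij_act[of a] by (auto simp: hmat_def bij_def inj_eq)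

lemma shift_tschr: "shift act (- a) (tschr v (shift act a u)) = tschr (\<lambda>x. v (act a x)) u"
proof
  fix x
  show "shift act (- a) (tschr v (shift act a u)) x = tschr (\<lambda>x. v (act a x)) u x"
    unfolding shift_def tschr_def app_def
    by (simp add: nbh_act sum.reindex[OF inj_act] hmat_act)
qed

lemma hmat_diff: "hmat v x y - hmat w x y = (if x = y then v x - w x else 0)"
  by (simp add: hmat_def)

lemma schr_tschr_diff:
  "schr adj v u x - schr adj w u x = (v x - w x) * u x"
  "tschr v u x - tschr w u x = (v x - w x) * u x"
proof -
  show "schr adj v u x - schr adj w u x = (v x - w x) * u x"
    by (simp add: schr_def algebra_simps)
  have "tschr v u x - tschr w u x = (\<Sum>y\<in>nbh step x. (hmat v y x - hmat w y x) * u y)"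
    by (simp add: tschr_def app_def sum_subtractf algebra_simps)
  also have "\<dots> = (\<Sum>y\<in>nbh step x. if y = x then (v x - w x) * u x else 0)"
    by (intro sum.cong) (auto simp: hmat_diff)
  also have "\<dots> = (v x - w x) * u x" using step_nonneg by (simp add: nbh_iff)
  finally show "tschr v u x - tschr w u x = (v x - w x) * u x" .
qed

text \<open>An interchange of two infinite sums. Absolute summability holds because the row sums
  \<open>g\<close> of the moduli again lie in \<open>lp q\<close> by the band structure, and their
  product with \<open>w\<close> is summable by Young's inequality.\<close>

lemma adjoint_on_schr:
  assumes q: "1 < q" and M: "\<forall>x. norm (v x) \<le> M"
  shows "adjoint_on (ereal q) (schr adj v) (tschr v)"
proof -
  define q' where "q' = q / (q - 1)"
  have q': "1 < q'" using q by (simp add: q'_def)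
  have conj: "conj_exp (ereal q) = ereal q'" by (simp add: conj_exp_def q'_def)
  note hM = norm_hmat_le[OF M]
  have M0: "0 \<le> M" using M norm_ge_zero order_trans by blast
  have "(\<Sum>\<^sub>\<infinity>x. schr adj v u x * w x) = (\<Sum>\<^sub>\<infinity>x. u x * tschr v w x)"
    if u: "u \<in> lp (ereal q)" and w: "w \<in> lp (ereal q')" for u w
  proof -
    define f where "f x y = hmat v x y * u y * w x" for x y
    define g where "g x = complex_of_real (\<Sum>y\<in>nbh step x. norm (hmat v x y * u y))" for x
    have f0: "f x y = 0" if "y \<notin> nbh step x" for x y
      using that by (auto simp: f_def nbh_iff intro!: hmat_eq_0)
    have row: "(\<Sum>\<^sub>\<infinity>y. F (f x y)) = (\<Sum>y\<in>nbh step x. F (f x y))" if "F 0 = 0"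
      for F :: "complex \<Rightarrow> 'z::{topological_comm_monoid_add,t2_space}" and x
      using that by (subst infsum_cong_neutral[where T = "nbh step x" and g = "\<lambda>y. F (f x y)"]) (auto simp: f0)
    have col: "(\<Sum>\<^sub>\<infinity>x. f x y) = (\<Sum>x\<in>nbh step y. f x y)" for y
      by (subst infsum_cong_neutral[where T = "nbh step y" and g = "\<lambda>x. f x y"]) (auto simp: f0 nbh_iff pd_sym)
    have g: "g \<in> lp (ereal q)"
    proof (rule lp_le_imp_lp[OF lp_le_banded[OF _ lp_le_lp_norm[OF u], of "1 + M" _ step]])
      show "norm (g x) \<le> (1 + M) * (\<Sum>y\<in>nbh step x. norm (u y))" for x
        unfolding g_def norm_of_real sum_distrib_left norm_mult
        by (subst abs_of_nonneg) (auto intro!: sum_nonneg sum_mono mult_right_mono hM)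
    qed (use q M0 in auto)
    have "(\<lambda>xy. norm (case xy of (x, y) \<Rightarrow> f x y)) summable_on (SIGMA x:UNIV. UNIV)"
    proof (subst Infinite_Sum.abs_summable_on_Sigma_iff, intro conjI ballI)
      fix x show "(\<lambda>y. norm (case (x, y) of (x, y) \<Rightarrow> f x y)) summable_on UNIV"
        by (subst summable_on_cong_neutral[where T = "nbh step x" and g = "\<lambda>y. norm (f x y)"]) (auto simp: f0)
    next
      have "(\<Sum>\<^sub>\<infinity>y. norm (f x y)) = norm (g x * w x)" for x
        unfolding row[of norm, OF norm_zero] unfolding f_def g_def norm_mult norm_of_real
        by (simp add: sum_nonneg norm_mult sum_distrib_right)
      then show "(\<lambda>x. norm (\<Sum>\<^sub>\<infinity>y. norm (case (x, y) of (x, y) \<Rightarrow> f x y))) summable_on UNIV"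
        using lp_mult_abs_summable[OF q g] w by (simp add: q'_def)
    qed
    then have "(\<lambda>(x, y). f x y) summable_on UNIV \<times> UNIV"
      by (rule abs_summable_summable)
    then have "(\<Sum>\<^sub>\<infinity>x. \<Sum>\<^sub>\<infinity>y. f x y) = (\<Sum>\<^sub>\<infinity>y. \<Sum>\<^sub>\<infinity>x. f x y)"
      by (rule infsum_swap_banach)
    moreover have "(\<Sum>\<^sub>\<infinity>y. f x y) = schr adj v u x * w x" for x
      using row[of "\<lambda>z. z" x] by (simp add: f_def schr_eq_app app_def sum_distrib_right)
    moreover have "(\<Sum>\<^sub>\<infinity>x. f x y) = u y * tschr v w y" for y
      unfolding col by (simp add: f_def tschr_def app_def sum_distrib_left mult_ac)
    ultimately show ?thesis by simp
  qed
  moreover have "tschr v w \<in> lp (ereal q')" if "w \<in> lp (ereal q')" for w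
    unfolding tschr_def using that q' hM by (intro app_lp[where \<alpha> = "1 + M"]) auto
  ultimately show ?thesis by (simp add: adjoint_on_def conj)
qed

section \<open>Limit potentials as pointwise limits of translates\<close>

definition lim_pot :: "('a \<Rightarrow> complex) \<Rightarrow> ('a \<Rightarrow> complex) set" where
  "lim_pot v = {w. \<exists>h. tends_to_infinity h \<and> (\<forall>x. (\<lambda>m. v (act (h m) x)) \<longlonglongrightarrow> w x)}"

lemma lim_pot_bound:
  assumes "\<forall>x. norm (v x) \<le> M" "w \<in> lim_pot v"
  shows "\<forall>x. norm (w x) \<le> M"
proof
  fix x
  from assms(2) obtain h where "(\<lambda>m. v (act (h m) x)) \<longlonglongrightarrow> w x" by (auto simp: lim_pot_def)
  then show "norm (w x) \<le> M" using assms(1) by (intro tendsto_upperbound[OF tendsto_norm]) auto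
qed

text \<open>Testing strong convergence on the delta function at \<open>x\<close> yields the
  pointwise limit at \<open>x\<close>. Conversely, the conjugated operator minus the limit is
  multiplication by a bounded function tending to 0 pointwise, so dominated convergence applies for
  both conjugate exponents.\<close>

lemma limit_potentials_eq_lim_pot:
  assumes "bounded (range v)" "1 < p" "p < \<infinity>"
  shows "limit_potentials adj act v p = lim_pot v"
proof -
  obtain M where M: "\<forall>x. norm (v x) \<le> M" using assms(1) by (auto simp: bounded_iff)
  obtain q where p: "p = ereal q" "1 < q" using assms by (cases p) auto
  show ?thesis
  proof (intro equalityI subsetI)
    fix w assume "w \<in> limit_potentials adj act v p"
    then obtain h where h: "tends_to_infinity h" and
      s: "strong_conv p (\<lambda>m u. shift act (- h m) (schr adj v (shift act (h m) u))) (schr adj w)"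
      by (auto simp: limit_potentials_def limit_operator_def)
    have "(\<lambda>m. v (act (h m) x)) \<longlonglongrightarrow> w x" for x
    proof -
      define \<delta> where "\<delta> = (\<lambda>y. if y = x then 1 else 0 :: complex)"
      have \<delta>: "\<delta> \<in> lp p" using lp_le_imp_lp[OF lp_le_single[of p 1 x]] p by (simp add: \<delta>_def)
      define d where "d m = (\<lambda>y. (v (act (h m) y) - w y) * \<delta> y)" for m
      have "d m = (\<lambda>y. if y = x then v (act (h m) x) - w x else 0)" for m
        by (auto simp: d_def \<delta>_def)
      then have "d m \<in> lp p" for m
        using lp_le_imp_lp[OF lp_le_single[of p _ x]] p by simp
      then have "norm (d m x) \<le> lp_norm p (d m)" for m
        using p by (intro lp_le_at[OF _ lp_le_lp_norm]) auto
      then have "norm (v (act (h m) x) - w x) \<le> lp_norm p (d m)" for m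
        by (simp add: d_def \<delta>_def)
      moreover have "(\<lambda>m. lp_norm p (d m)) \<longlonglongrightarrow> 0"
        using s \<delta> unfolding strong_conv_def shift_schr schr_tschr_diff d_def by blast
      ultimately have "(\<lambda>m. v (act (h m) x) - w x) \<longlonglongrightarrow> 0"
        by (rule_tac Lim_null_comparison[rotated]) (auto intro: always_eventually)
      then show ?thesis by (rule LIM_zero_cancel)
    qed
    with h show "w \<in> lim_pot v" by (auto simp: lim_pot_def)
  next
    fix w assume w: "w \<in> lim_pot v"
    then obtain h where h: "tends_to_infinity h" and l: "\<And>x. (\<lambda>m. v (act (h m) x)) \<longlonglongrightarrow> w x"
      by (auto simp: lim_pot_def)
    have wM: "\<forall>x. norm (w x) \<le> M" using lim_pot_bound[OF M w] .
    have *: "(\<lambda>m. lp_norm (ereal r) (\<lambda>x. (v (act (h m) x) - w x) * u x)) \<longlonglongrightarrow> 0"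
      if "1 < r" "u \<in> lp (ereal r)" for r u
    proof (rule lp_norm_mult_tendsto_0)
      show "norm (v (act (h m) x) - w x) \<le> M + M" for m x
        using norm_triangle_ineq4[of "v (act (h m) x)" "w x"] M wM by (smt (verit))
      show "(\<lambda>m. v (act (h m) x) - w x) \<longlonglongrightarrow> 0" for x using l by (simp add: LIM_zero)
    qed (use that in auto)
    have "1 < q / (q - 1)" using p by simp
    then have "limit_operator act p (schr adj v) h (schr adj w)"
      unfolding limit_operator_def p(1) conj_exp_def strong_conv_def shift_schr
      using adjoint_on_schr[OF p(2) M] adjoint_on_schr[OF p(2) wM]
      by (intro conjI exI[where x = "tschr v"] exI[where x = "tschr w"] ballI;
        simp add: shift_tschr schr_tschr_diff * p)
    with h show "w \<in> limit_potentials adj act v p" by (auto simp: limit_potentials_def)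
  qed
qed

lemma lim_pot_diff: "lim_pot (\<lambda>x. v x - z) = (\<lambda>w x. w x - z) ` lim_pot v"
proof (intro equalityI subsetI)
  fix w assume "w \<in> lim_pot (\<lambda>x. v x - z)"
  then obtain h where h: "tends_to_infinity h" "\<And>x. (\<lambda>m. v (act (h m) x) - z) \<longlonglongrightarrow> w x"
    by (auto simp: lim_pot_def)
  have "(\<lambda>m. v (act (h m) x)) \<longlonglongrightarrow> w x + z" for x
    using tendsto_add[OF h(2) tendsto_const[of z]] by simp
  then have "(\<lambda>x. w x + z) \<in> lim_pot v" using h(1) by (auto simp: lim_pot_def)
  then show "w \<in> (\<lambda>w x. w x - z) ` lim_pot v" by (rule image_eqI[rotated]) simp
qed (auto simp: lim_pot_def intro!: tendsto_intros)

lemma lim_pot_act: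
  assumes "w \<in> lim_pot v"
  shows "(\<lambda>x. w (act b x)) \<in> lim_pot v"
proof -
  obtain h where h: "tends_to_infinity h" "\<And>x. (\<lambda>m. v (act (h m) x)) \<longlonglongrightarrow> w x"
    using assms by (auto simp: lim_pot_def)
  then show ?thesis
    using tends_to_infinity_add_const[OF h(1), of b] by (auto simp: lim_pot_def act_add)
qed

text \<open>A diagonal sequence: its \<open>k\<close>-th term is taken from the sequence for
  \<open>W k\<close>, far enough out to have length at least \<open>k\<close> and to reproduce
  \<open>W k\<close> up to \<open>1 / (k + 1)\<close> on the points numbered up to
  \<open>k\<close>.\<close>

lemma lim_pot_closed:
  assumes W: "\<And>k. W k \<in> lim_pot v" and l: "\<And>x. (\<lambda>k. W k x) \<longlonglongrightarrow> w x"
  shows "w \<in> lim_pot v"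
proof -
  have "\<exists>h. tends_to_infinity h \<and> (\<forall>x. (\<lambda>m. v (act (h m) x)) \<longlonglongrightarrow> W k x)" for k
    using W by (simp add: lim_pot_def)
  then obtain h where h: "\<And>k. tends_to_infinity (h k)"
    and lh: "\<And>k x. (\<lambda>m. v (act (h k m) x)) \<longlonglongrightarrow> W k x" by metis
  define X where "X k = {x::'a. to_nat x \<le> k}" for k
  have X: "finite (X k)" for k
    using finite_vimageI[of "{..k}" "to_nat :: 'a \<Rightarrow> nat"] by (simp add: X_def vimage_def)
  have "\<exists>m. int k \<le> l1 (h k m) \<and> (\<forall>x\<in>X k. dist (v (act (h k m) x)) (W k x) < inverse (Suc k))" for k
  proof -
    have "\<forall>\<^sub>F m in sequentially. int k \<le> l1 (h k m)"
      using h tends_to_infinity_iff by blast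
    moreover have "\<forall>\<^sub>F m in sequentially. \<forall>x\<in>X k. dist (v (act (h k m) x)) (W k x) < inverse (Suc k)"
      using X lh by (intro eventually_ball_finite ballI tendstoD) auto
    ultimately have "\<forall>\<^sub>F m in sequentially. int k \<le> l1 (h k m) \<and> (\<forall>x\<in>X k. dist (v (act (h k m) x)) (W k x) < inverse (Suc k))"
      by (rule eventually_conj)
    then show ?thesis by (rule eventually_happens'[OF sequentially_bot])
  qed
  then obtain m where m: "\<And>k. int k \<le> l1 (h k (m k))"
    "\<And>k x. x \<in> X k \<Longrightarrow> dist (v (act (h k (m k)) x)) (W k x) < inverse (Suc k)" by metis
  have "tends_to_infinity (\<lambda>k. h k (m k))"
    unfolding tends_to_infinity_iff
  proof
    fix K
    show "\<forall>\<^sub>F k in sequentially. K \<le> l1 (h k (m k))"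
      using eventually_ge_at_top[of "nat K"]
    proof eventually_elim
      case (elim k)
      then show ?case using m(1)[of k] by linarith
    qed
  qed
  moreover have "(\<lambda>k. v (act (h k (m k)) x)) \<longlonglongrightarrow> w x" for x
  proof -
    have "(\<lambda>k. v (act (h k (m k)) x) - W k x) \<longlonglongrightarrow> 0"
    proof (rule Lim_null_comparison[OF _ LIMSEQ_inverse_real_of_nat])
      show "\<forall>\<^sub>F k in sequentially. norm (v (act (h k (m k)) x) - W k x) \<le> inverse (real (Suc k))"
        using eventually_ge_at_top[of "to_nat x"]
      proof eventually_elim
        case (elim k)
        then have "x \<in> X k" by (simp add: X_def)
        from m(2)[OF this] show ?case by (simp add: dist_norm)
      qed
    qed
    from tendsto_add[OF this l[of x]] show ?thesis by simp
  qed
  ultimately show ?thesis unfolding lim_pot_def by blast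
qed

lemma bounded_subseq_pointwise:
  assumes "\<And>n x. norm (f n x :: complex) \<le> M"
  obtains k :: "nat \<Rightarrow> nat" and g :: "'c::countable \<Rightarrow> complex"
  where "strict_mono k" "\<And>x. (\<lambda>n. f (k n) x) \<longlonglongrightarrow> g x"
proof -
  obtain k where k: "strict_mono (k::nat\<Rightarrow>nat)" "\<And>x::'c. x \<in> UNIV \<Longrightarrow> \<exists>l. (\<lambda>n. f (k n) x) \<longlonglongrightarrow> l"
    using function_convergent_subsequence[of "UNIV::'c set" f M] assms by blast
  then show thesis using that by (metis UNIV_I)
qed

lemma lim_pot_subseq:
  assumes M: "\<forall>x. norm (v x) \<le> M" and h: "tends_to_infinity h"
  obtains k w where "strict_mono k" "w \<in> lim_pot v" "\<And>x. (\<lambda>m. v (act (h (k m)) x)) \<longlonglongrightarrow> w x"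
proof -
  obtain k w where k: "strict_mono k" "\<And>x. (\<lambda>m. v (act (h (k m)) x)) \<longlonglongrightarrow> w x"
    using bounded_subseq_pointwise[of "\<lambda>m x. v (act (h m) x)" M] M by blast
  then show thesis using tends_to_infinity_subseq[OF h k(1)] that[OF k(1)]
    by (auto simp: lim_pot_def)
qed

end

section \<open>Limit operators of Fredholm operators\<close>

lemma lp_norm_tendsto_imp_pointwise:
  assumes p: "1 \<le> p" and "\<And>k. f k \<in> lp p" "g \<in> lp p"
    and l: "(\<lambda>k. lp_norm p (\<lambda>x. f k x - g x)) \<longlonglongrightarrow> 0"
  shows "(\<lambda>k. f k x) \<longlonglongrightarrow> g x"
proof -
  have "norm (f k x - g x) \<le> lp_norm p (\<lambda>x. f k x - g x)" for k
    by (rule lp_le_at[OF p lp_le_lp_norm[OF lp_diff[OF p]]]) (use assms in auto)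
  then have "(\<lambda>k. f k x - g x) \<longlonglongrightarrow> 0"
    by (intro Lim_null_comparison[OF _ l]) auto
  then show ?thesis by (rule LIM_zero_cancel)
qed

section \<open>Baire's theorem in closed sets of summable functions, and finite-dimensional
  spans\<close>

definition lp_closed :: "ereal \<Rightarrow> ('a \<Rightarrow> complex) set \<Rightarrow> bool" where
  "lp_closed p R \<longleftrightarrow> (\<forall>f g. (\<forall>k. f k \<in> R) \<longrightarrow> g \<in> lp p \<longrightarrow>
     (\<lambda>k. lp_norm p (\<lambda>x. f k x - g x)) \<longlonglongrightarrow> 0 \<longrightarrow> g \<in> R)"

text \<open>The norm metric on \<open>R\<close> is complete: Cauchy sequences converge pointwise,
  and by Fatou's lemma the limit is also a norm limit. Norm convergence implies pointwise
  convergence, so the sets \<open>G n\<close>, closed pointwise, are closed in the metric, and one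
  of them has interior points.\<close>

lemma lp_Baire:
  assumes q: "1 \<le> q" and R: "R \<subseteq> lp (ereal q)" "R \<noteq> {}"
    and cl: "lp_closed (ereal q) R"
    and G: "\<And>n f g. (\<And>k. f k \<in> G n \<inter> R) \<Longrightarrow> g \<in> R \<Longrightarrow> (\<And>x. (\<lambda>k. f k x) \<longlonglongrightarrow> g x) \<Longrightarrow> g \<in> G n"
    and cover: "R \<subseteq> (\<Union>n::nat. G n)"
  shows "\<exists>n. \<exists>f0\<in>R. \<exists>e>0. \<forall>f\<in>R. lp_norm (ereal q) (\<lambda>x. f0 x - f x) < e \<longrightarrow> f \<in> G n"
proof -
  define p where "p = ereal q"
  have p: "1 \<le> p" using q by (simp add: p_def)
  define d where "d f g = lp_norm p (\<lambda>x. f x - g x)" for f g :: "'a \<Rightarrow> complex"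
  have le: "lp_le p (d f g) (\<lambda>x. f x - g x)" if "f \<in> R" "g \<in> R" for f g
    unfolding d_def using that R by (intro lp_le_lp_norm lp_diff p) (auto simp: p_def)
  interpret Metric_space R d
  proof
    show "0 \<le> d f g" for f g by (simp add: d_def p_def lp_norm_def)
    show "d f g = d g f" for f g by (simp add: d_def p_def lp_norm_def norm_minus_commute)
    show "d f g = 0 \<longleftrightarrow> f = g" if "f \<in> R" "g \<in> R" for f g
    proof
      assume "d f g = 0"
      then have "f x - g x = 0" for x using lp_le_0_imp_eq_0[OF p, of "\<lambda>x. f x - g x"] le[OF that] by simp
      then show "f = g" by (simp add: fun_eq_iff)
    next
      assume "f = g"
      then show "d f g = 0" using q by (simp add: d_def p_def lp_norm_def)
    qed
    show "d f k \<le> d f g + d g k" if "f \<in> R" "g \<in> R" "k \<in> R" for f g k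
      using lp_leD(2)[OF lp_le_add[OF p le[OF that(1,2)] le[OF that(2,3)]]] by (simp add: d_def)
  qed
  have pointwise: "(\<lambda>k. f k x) \<longlonglongrightarrow> g x" if "range f \<subseteq> R" "limitin mtopology f g sequentially" for f g x
  proof (rule lp_norm_tendsto_imp_pointwise[OF p, where f = f and g = g])
    show "f k \<in> lp p" for k using that R by (auto simp: p_def)
    show "g \<in> lp p" using that(2) limitin_mspace R by (auto simp: p_def)
    show "(\<lambda>k. lp_norm p (\<lambda>x. f k x - g x)) \<longlonglongrightarrow> 0"
      using that(2) unfolding limitin_metric_dist_null by (simp add: d_def)
  qed
  have "mcomplete"
    unfolding mcomplete_def
  proof (intro allI impI)
    fix f assume f: "MCauchy f"
    then have fR: "f k \<in> R" for k by (auto simp: MCauchy_def)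
    have "Cauchy (\<lambda>k. f k x)" for x
      unfolding Cauchy_def
    proof (intro allI impI)
      fix \<epsilon> :: real assume "0 < \<epsilon>"
      then obtain N where N: "\<And>m n. N \<le> m \<Longrightarrow> N \<le> n \<Longrightarrow> d (f m) (f n) < \<epsilon>"
        using f unfolding MCauchy_def by metis
      have "dist (f m x) (f n x) < \<epsilon>" if "N \<le> m" "N \<le> n" for m n
        using lp_le_at[OF p le[OF fR[of m] fR[of n]], of x] N[OF that] by (simp add: dist_norm)
      then show "\<exists>M. \<forall>m\<ge>M. \<forall>n\<ge>M. dist (f m x) (f n x) < \<epsilon>" by blast
    qed
    then have "\<exists>l. (\<lambda>k. f k x) \<longlonglongrightarrow> l" for x
      using convergent_eq_Cauchy by blast
    then obtain g where g: "\<And>x. (\<lambda>k. f k x) \<longlonglongrightarrow> g x" by metis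
    have close: "\<exists>N. \<forall>n\<ge>N. lp_le p \<epsilon> (\<lambda>x. f n x - g x)" if "0 < \<epsilon>" for \<epsilon>
    proof -
      obtain N where N: "\<And>m n. N \<le> m \<Longrightarrow> N \<le> n \<Longrightarrow> d (f m) (f n) < \<epsilon>"
        using f \<open>0 < \<epsilon>\<close> unfolding MCauchy_def by metis
      have "lp_le p \<epsilon> (\<lambda>x. f n x - g x)" if n: "n \<ge> N" for n
      proof (rule lp_le_lim[OF p])
        show "\<forall>\<^sub>F m in sequentially. lp_le p \<epsilon> (\<lambda>x. f n x - f m x)"
          using eventually_ge_at_top[of N]
        proof eventually_elim
          case (elim m)
          show ?case
            by (rule lp_le_mono[OF p le[OF fR fR]]) (use N[OF n elim] in auto)
        qed
        show "(\<lambda>m. f n x - f m x) \<longlonglongrightarrow> f n x - g x" for x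
          by (intro tendsto_intros g)
      qed
      then show ?thesis by blast
    qed
    obtain N where "lp_le p 1 (\<lambda>x. f N x - g x)" using close[of 1] by auto
    from lp_le_imp_lp[OF this] have "(\<lambda>x. f N x - (f N x - g x)) \<in> lp p"
      using subsetD[OF R(1) fR[of N], folded p_def] by (rule_tac lp_diff[OF p, of "f N"])
    then have glp: "g \<in> lp p" by simp
    have l: "(\<lambda>k. lp_norm p (\<lambda>x. f k x - g x)) \<longlonglongrightarrow> 0"
    proof (rule LIMSEQ_I)
      fix \<epsilon> :: real assume "0 < \<epsilon>"
      then obtain N where N: "\<And>n. n \<ge> N \<Longrightarrow> lp_le p (\<epsilon>/2) (\<lambda>x. f n x - g x)"
        using close[of "\<epsilon>/2"] by auto
      have "norm (lp_norm p (\<lambda>x. f n x - g x) - 0) < \<epsilon>" if "n \<ge> N" for n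
        using lp_leD[OF N[OF that]] lp_norm_nonneg[OF p] \<open>0 < \<epsilon>\<close> by fastforce
      then show "\<exists>no. \<forall>n\<ge>no. norm (lp_norm p (\<lambda>x. f n x - g x) - 0) < \<epsilon>" by blast
    qed
    then have "g \<in> R" using cl fR glp unfolding lp_closed_def p_def[symmetric] by blast
    then show "\<exists>x. limitin mtopology f x sequentially"
      unfolding limitin_metric_dist_null using l fR by (auto simp: d_def)
  qed
  have closed: "closedin mtopology (G n \<inter> R)" for n
    unfolding metric_closedin_iff_sequentially_closed
  proof (intro conjI allI impI)
    fix f g assume *: "range f \<subseteq> G n \<inter> R \<and> limitin mtopology f g sequentially"
    then have "g \<in> R" using limitin_mspace by blast
    moreover have "g \<in> G n" by (rule G[of f]) (use * pointwise \<open>g \<in> R\<close> in auto)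
    ultimately show "g \<in> G n \<inter> R" by blast
  qed auto
  have "\<exists>n. mtopology interior_of (G n \<inter> R) \<noteq> {}"
  proof (rule ccontr)
    assume *: "\<not> ?thesis"
    have "mtopology interior_of \<Union>(range (\<lambda>n. G n \<inter> R)) = {}"
      using * closed by (intro metric_Baire_category_alt \<open>mcomplete\<close>) auto
    moreover have "\<Union>(range (\<lambda>n. G n \<inter> R)) = R" using cover by auto
    moreover have "mtopology interior_of R = R"
      using interior_of_topspace[of mtopology] by simp
    ultimately show False using R by simp
  qed
  then obtain n f0 where "f0 \<in> mtopology interior_of (G n \<inter> R)" by blast
  then obtain e where e: "0 < e" "f0 \<in> R" "mball f0 e \<subseteq> G n \<inter> R"
    unfolding metric_interior_of by blast
  have "f \<in> G n" if "f \<in> R" "lp_norm (ereal q) (\<lambda>x. f0 x - f x) < e" for f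
    using e that by (auto simp: subset_iff d_def p_def)
  with e show ?thesis by blast
qed

text \<open>Chebyshev's inequality: each such point contributes at least \<open>e powr q\<close> to
  sums bounded by \<open>r powr q\<close>, which limits the size of finite subsets.\<close>

lemma lp_superlevel_finite:
  assumes q: "1 \<le> q" and g: "g \<in> lp (ereal q)" and e: "0 < (e::real)"
  shows "finite {y. e \<le> norm (g y)}"
proof -
  obtain r where r: "lp_le (ereal q) r g" using lp_le_lp_norm[OF g] by blast
  have "card F \<le> nat \<lceil>r powr q / e powr q\<rceil>" if F: "F \<subseteq> {y. e \<le> norm (g y)}" "finite F" for F
  proof -
    have "card F * e powr q = (\<Sum>y\<in>F. e powr q)" by simp
    also have "\<dots> \<le> (\<Sum>y\<in>F. norm (g y) powr q)"
      using F q e by (intro sum_mono powr_mono2) auto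
    also have "\<dots> \<le> r powr q" using r F q by (simp add: lp_le_finite)
    finally have "card F \<le> r powr q / e powr q" using e by (simp add: field_simps)
    then show ?thesis by linarith
  qed
  then show ?thesis using finite_if_finite_subsets_card_bdd by blast
qed

lemma cspan_combine:
  assumes "finite B" "s \<in> cspan B" "t \<in> cspan B"
  shows "(\<lambda>x. s x + a * t x) \<in> cspan B"
proof -
  obtain c d where "s = (\<lambda>x. \<Sum>b\<in>B. c b * b x)" "t = (\<lambda>x. \<Sum>b\<in>B. d b * b x)"
    using assms by (auto simp: cspan_def)
  then have "(\<lambda>x. s x + a * t x) = (\<lambda>x. \<Sum>b\<in>B. (c b + a * d b) * b x)"
    by (simp add: distrib_right sum.distrib sum_distrib_left mult.assoc)
  then show ?thesis unfolding cspan_def by (intro CollectI exI[of _ "\<lambda>b. c b + a * d b"])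
qed

lemma cspan_lp:
  assumes "1 \<le> p" "finite B" "B \<subseteq> lp p" "s \<in> cspan B"
  shows "s \<in> lp p"
  using assms by (auto simp: cspan_def intro!: lp_sum lp_scale)

text \<open>Its purpose is to control the norm of a kernel element by its values on a fixed finite
  set, since those values can be followed along translations. A new generator enlarges the space of
  interpolation errors by at most one dimension, and a point where that error is nonzero repairs the
  interpolation.\<close>

lemma cspan_interpolation:
  assumes p: "1 \<le> p" and "finite B" "B \<subseteq> lp p"
  shows "\<exists>F e. finite F \<and> (\<forall>x\<in>F. e x \<in> lp p) \<and> (\<forall>s\<in>cspan B. s = (\<lambda>z. \<Sum>x\<in>F. s x * e x z))"
  using assms(2,3)
proof (induction B rule: finite_induct)
  case empty
  show ?case by (intro exI[of _ "{}"]) (simp add: cspan_def)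
next
  case (insert b B)
  then obtain F e where F: "finite F" "\<And>x. x \<in> F \<Longrightarrow> e x \<in> lp p"
    and e: "\<forall>s\<in>cspan B. s = (\<lambda>z. \<Sum>x\<in>F. s x * e x z)" by auto
  \<comment> \<open>The interpolation error of \<open>s\<close>. It vanishes on the old span, so on
    the enlarged span it is a multiple of \<open>T b\<close>.\<close>
  define T where "T s = (\<lambda>z. s z - (\<Sum>x\<in>F. s x * e x z))" for s
  have T: "\<exists>c. T s = (\<lambda>z. c * T b z)" if "s \<in> cspan (insert b B)" for s
  proof -
    obtain c where c: "s = (\<lambda>x. \<Sum>b'\<in>insert b B. c b' * b' x)" using \<open>s \<in> cspan (insert b B)\<close> unfolding cspan_def by blast
    define t where "t = (\<lambda>x. \<Sum>b'\<in>B. c b' * b' x)"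
    have s: "s = (\<lambda>x. c b * b x + t x)" using insert.hyps by (simp add: c t_def)
    have "t \<in> cspan B" by (auto simp: cspan_def t_def)
    have "T s z = c b * T b z" for z
    proof -
      have "(\<Sum>x\<in>F. s x * e x z) = c b * (\<Sum>x\<in>F. b x * e x z) + (\<Sum>x\<in>F. t x * e x z)"
        unfolding s by (simp add: distrib_right sum.distrib sum_distrib_left mult.assoc)
      also have "(\<Sum>x\<in>F. t x * e x z) = t z"
        using fun_cong[OF bspec[OF e \<open>t \<in> cspan B\<close>], of z] by (rule sym)
      finally show ?thesis unfolding T_def by (simp add: s right_diff_distrib)
    qed
    then show ?thesis by blast
  qed
  show ?case
  proof (cases "\<exists>x0. T b x0 \<noteq> 0")
    case False
    then have "T s = (\<lambda>z. 0)" if "s \<in> cspan (insert b B)" for s using T[OF that] by auto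
    then have "s = (\<lambda>z. \<Sum>x\<in>F. s x * e x z)" if "s \<in> cspan (insert b B)" for s
      using that by (simp add: T_def fun_eq_iff)
    then show ?thesis using F by blast
  next
    case True
    then obtain x0 where x0: "T b x0 \<noteq> 0" by blast
    define b' where "b' = (\<lambda>z. inverse (T b x0) * T b z)"
    have b': "b' \<in> lp p"
      unfolding b'_def T_def using insert.prems F p
      by (intro lp_scale lp_diff lp_sum) auto
    \<comment> \<open>Chosen so that \<open>s\<close> is reproduced as its old interpolant plus its
      error at \<open>x0\<close> times \<open>b'\<close>, which has value 1 at \<open>x0\<close>.
      The two conditionals are added, so \<open>x0\<close> may already lie in
      \<open>F\<close>.\<close>
    define e' where "e' x = (\<lambda>z. (if x \<in> F then e x z - e x x0 * b' z else 0)
      + (if x = x0 then b' z else 0))" for x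
    have zero: "(\<lambda>z. 0) \<in> lp p" using lp_le_imp_lp[OF lp_le_zero[OF p order_refl]] .
    have e': "\<forall>x\<in>insert x0 F. e' x \<in> lp p"
    proof
      fix x
      have "(\<lambda>z. if x \<in> F then e x z - e x x0 * b' z else 0) \<in> lp p"
      proof (cases "x \<in> F")
        case True
        have "(\<lambda>z. e x z - e x x0 * b' z) \<in> lp p"
          by (rule lp_diff[OF p F(2)[OF True] lp_scale[OF p b']])
        with True show ?thesis by simp
      qed (simp add: zero)
      moreover have "(\<lambda>z. if x = x0 then b' z else 0) \<in> lp p"
        by (cases "x = x0") (simp_all add: zero b')
      ultimately show "e' x \<in> lp p" unfolding e'_def by (rule lp_add[OF p])
    qed
    have "s = (\<lambda>z. \<Sum>x\<in>insert x0 F. s x * e' x z)" if "s \<in> cspan (insert b B)" for s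
    proof
      fix z
      obtain c where c: "T s = (\<lambda>z. c * T b z)" using T[OF \<open>s \<in> cspan (insert b B)\<close>] by blast
      have "T s z = T s x0 * b' z" unfolding fun_cong[OF c] b'_def using x0 by simp
      then have "s z = (\<Sum>x\<in>F. s x * e x z) + (s x0 - (\<Sum>x\<in>F. s x * e x x0)) * b' z"
        by (simp add: T_def algebra_simps)
      also have "\<dots> = (\<Sum>x\<in>F. s x * (e x z - e x x0 * b' z)) + s x0 * b' z"
        by (simp add: algebra_simps sum_subtractf sum_distrib_left sum_distrib_right)
      also have "(\<Sum>x\<in>F. s x * (e x z - e x x0 * b' z)) =
          (\<Sum>x\<in>insert x0 F. s x * (if x \<in> F then e x z - e x x0 * b' z else 0))"
        using F(1) by (intro sum.mono_neutral_cong_left) auto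
      also have "s x0 * b' z = (\<Sum>x\<in>insert x0 F. s x * (if x = x0 then b' z else 0))"
        using F(1) by (subst sum.remove[of _ x0]) (auto intro: sum.neutral)
      finally show "s z = (\<Sum>x\<in>insert x0 F. s x * e' x z)"
        by (simp only: e'_def distrib_left sum.distrib)
    qed
    with e' F(1) show ?thesis by (intro exI[of _ "insert x0 F"] exI[of _ e'] conjI ballI) blast+
  qed
qed

context lattice_graph
begin

text \<open>Only finitely many points carry values of modulus at least \<open>e\<close>, and by
  freeness each is reached from \<open>x\<close> by at most one translation. The exponent must be
  finite: nonzero constants violate this on \<open>lp \<infinity>\<close>.\<close>

lemma lp_act_tendsto_0:
  assumes q: "1 \<le> q" and g: "g \<in> lp (ereal q)" and h: "tends_to_infinity h"
  shows "(\<lambda>m. g (act (h m) x)) \<longlonglongrightarrow> 0"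
proof (rule tendstoI)
  fix e :: real assume e: "0 < e"
  have "inj (\<lambda>a. act a x)" by (rule injI) (rule act_cancel)
  then have "finite ((\<lambda>a. act a x) -` {y. e \<le> norm (g y)})"
    by (intro finite_vimageI lp_superlevel_finite[OF q g e])
  from tends_to_infinity_avoids_finite[OF h this]
  show "\<forall>\<^sub>F m in sequentially. dist (g (act (h m) x)) 0 < e"
    by (auto elim!: eventually_mono)
qed

text \<open>The images of balls are already closed, by pointwise compactness of balls, so Baire's theorem
  gives the open mapping property without successive approximation.\<close>

lemma schr_open_mapping:
  assumes q: "1 \<le> q" and v: "bounded (range v)" and B: "finite B" "B \<subseteq> lp (ereal q)"
    and R_def: "R = {(\<lambda>x. schr adj v u x + s x) | u s. u \<in> lp (ereal q) \<and> s \<in> cspan B}"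
    and cl: "lp_closed (ereal q) R"
  shows "\<exists>C\<ge>0. \<forall>f\<in>R. \<exists>u c. lp_le (ereal q) (C * lp_norm (ereal q) f) u \<and>
    (\<forall>b\<in>B. norm (c b) \<le> C * lp_norm (ereal q) f) \<and> f = (\<lambda>x. schr adj v u x + (\<Sum>b\<in>B. c b * b x))"
proof -
  define p where "p = ereal q"
  have p: "1 \<le> p" using q by (simp add: p_def)
  note [folded p_def, simp] = B
  define G where "G r = {(\<lambda>x. schr adj v u x + (\<Sum>b\<in>B. c b * b x)) | u c.
    lp_le p r u \<and> (\<forall>b\<in>B. norm (c b) \<le> r)}" for r :: real
  have Av: "schr adj v u \<in> lp p" if "u \<in> lp p" for u
    using bounded_on_schr[OF p v] that by (auto simp: bounded_on_def)
  have zero: "(\<lambda>x. 0) \<in> lp p" using lp_le_imp_lp[OF lp_le_zero[OF p]] by blast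
  have R_lp: "R \<subseteq> lp p"
    using Av cspan_lp[OF p, of B] B by (auto simp: R_def p_def intro!: lp_add[OF p, unfolded p_def])
  have R_comb: "(\<lambda>x. f x + t * g x) \<in> R" if "f \<in> R" "g \<in> R" for f g t
  proof -
    obtain u s u' s' where fg: "f = (\<lambda>x. schr adj v u x + s x)" "g = (\<lambda>x. schr adj v u' x + s' x)"
      "u \<in> lp p" "u' \<in> lp p" "s \<in> cspan B" "s' \<in> cspan B"
      using \<open>f \<in> R\<close> \<open>g \<in> R\<close> by (auto simp: R_def p_def)
    have "(\<lambda>x. f x + t * g x) = (\<lambda>x. schr adj v (\<lambda>x. u x + t * u' x) x + (s x + t * s' x))"
      by (simp add: fg schr_eq_app app_linear algebra_simps)
    moreover have "(\<lambda>x. u x + t * u' x) \<in> lp p" using fg by (intro lp_add lp_scale p)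
    moreover have "(\<lambda>x. s x + t * s' x) \<in> cspan B" using fg B by (intro cspan_combine)
    ultimately show ?thesis unfolding R_def p_def[symmetric] by (intro CollectI exI conjI)
  qed
  have cspan0: "(\<lambda>x. 0) \<in> cspan B" by (auto simp: cspan_def intro!: exI[of _ "\<lambda>_. 0"])
  have "(\<lambda>x. schr adj v (\<lambda>x. 0) x + 0) \<in> R"
    unfolding R_def p_def[symmetric] by (intro CollectI exI[of _ "\<lambda>x. 0"] conjI zero cspan0 refl)
  then have R0: "R \<noteq> {}" by blast
  have "\<exists>n. \<exists>f0\<in>R. \<exists>e>0. \<forall>f\<in>R. lp_norm (ereal q) (\<lambda>x. f0 x - f x) < e \<longrightarrow> f \<in> G (real n)"
  proof (rule lp_Baire[OF q R_lp[unfolded p_def] R0 cl, of "\<lambda>n. G (real n)"])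
    show "R \<subseteq> (\<Union>n. G (real n))"
    proof
      fix f assume "f \<in> R"
      then obtain u c where f: "u \<in> lp p" "f = (\<lambda>x. schr adj v u x + (\<Sum>b\<in>B. c b * b x))"
        by (auto simp: R_def p_def cspan_def)
      obtain n :: nat where n: "lp_norm p u + (\<Sum>b\<in>B. norm (c b)) \<le> n" using real_arch_simple by blast
      have "norm (c b) \<le> n" if "b \<in> B" for b
        using member_le_sum[OF that, of "\<lambda>b. norm (c b)"] n lp_norm_nonneg[OF p f(1)] by simp
      moreover have "lp_norm p u \<le> n" using n by (smt (verit) sum_nonneg norm_ge_zero)
      ultimately have "f \<in> G (real n)" using f by (auto simp: G_def lp_le_def)
      then show "f \<in> (\<Union>n. G (real n))" by blast
    qed
  next
    fix n f g
    assume f: "\<And>k. f k \<in> G (real n) \<inter> R" and g: "g \<in> R" and l: "\<And>x. (\<lambda>k. f k x) \<longlonglongrightarrow> g x"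
    define P where "P g u c \<longleftrightarrow> lp_le p (real n) u \<and> (\<forall>b\<in>B. norm (c b) \<le> real n) \<and>
       g = (\<lambda>x. schr adj v u x + (\<Sum>b\<in>B. c b * b x))" for g u c
    have "\<exists>u c. P (f k) u c" for k
      using IntD1[OF f[of k]] unfolding G_def P_def by blast
    then obtain u c where "\<And>k. P (f k) (u k) (c k)" by metis
    then have u: "\<And>k. lp_le p (real n) (u k)" and c: "\<And>k b. b \<in> B \<Longrightarrow> norm (c k b) \<le> real n"
      and fk: "\<And>k. f k = (\<lambda>x. schr adj v (u k) x + (\<Sum>b\<in>B. c k b * b x))"
      unfolding P_def by blast+
    obtain s U where s: "strict_mono (s::nat\<Rightarrow>nat)" and U: "\<And>x. (\<lambda>k. u (s k) x) \<longlonglongrightarrow> U x"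
      using bounded_subseq_pointwise[of u "real n"] lp_le_at[OF p u] by blast
    obtain t where t: "strict_mono (t::nat\<Rightarrow>nat)" and "\<And>b. b \<in> B \<Longrightarrow> \<exists>d. (\<lambda>k. c (s (t k)) b) \<longlonglongrightarrow> d"
      using function_convergent_subsequence[OF countable_finite[OF B(1)], of "\<lambda>k. c (s k)" "real n"] c
      by blast
    then obtain d where d: "\<And>b. b \<in> B \<Longrightarrow> (\<lambda>k. c (s (t k)) b) \<longlonglongrightarrow> d b" by metis
    have Ut: "(\<lambda>k. u (s (t k)) x) \<longlonglongrightarrow> U x" for x
      using LIMSEQ_subseq_LIMSEQ[OF U t] by (simp add: o_def)
    have "(\<lambda>k. f (s (t k)) x) \<longlonglongrightarrow> schr adj v U x + (\<Sum>b\<in>B. d b * b x)" for x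
      unfolding fk schr_eq_app by (intro tendsto_intros app_tendsto Ut d)
    moreover have "(\<lambda>k. f (s (t k)) x) \<longlonglongrightarrow> g x" for x
      using LIMSEQ_subseq_LIMSEQ[OF LIMSEQ_subseq_LIMSEQ[OF l s] t] by (simp add: o_def)
    ultimately have "g x = schr adj v U x + (\<Sum>b\<in>B. d b * b x)" for x
      using LIMSEQ_unique by blast
    moreover have "lp_le p (real n) U"
      by (rule lp_le_lim[OF p _ U]) (simp add: u)
    moreover have "norm (d b) \<le> real n" if "b \<in> B" for b
      by (rule tendsto_upperbound[OF tendsto_norm[OF d[OF that]]]) (use c that in auto)
    ultimately show "g \<in> G (real n)" unfolding G_def fun_eq_iff by blast
  qed
  then obtain n f0 e where e: "0 < e" "f0 \<in> R"
    and ball: "\<And>f. f \<in> R \<Longrightarrow> lp_norm (ereal q) (\<lambda>x. f0 x - f x) < e \<Longrightarrow> f \<in> G (real n)"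
    by blast
  \<comment> \<open>With \<open>r\<close> the norm of \<open>f\<close> and
    \<open>t = e / (2 * r)\<close>, both \<open>f0\<close> and \<open>f0 + t * f\<close> lie in
    \<open>G n\<close>. Their difference represents \<open>t * f\<close> with bound
    \<open>2 * n\<close>, and dividing by \<open>t\<close> gives
    \<open>4 * n * r / e\<close>.\<close>
  define C where "C = 4 * real n / e"
  have C: "0 \<le> C" using e by (simp add: C_def)
  have main: "\<exists>u c. lp_le p (C * lp_norm p f) u \<and>
    (\<forall>b\<in>B. norm (c b) \<le> C * lp_norm p f) \<and> f = (\<lambda>x. schr adj v u x + (\<Sum>b\<in>B. c b * b x))"
    if f: "f \<in> R" for f
  proof (cases "lp_norm p f = 0")
    case True
    have "f x = 0" for x using lp_le_0_imp_eq_0[OF p, of f x] True f R_lp by (auto simp: lp_le_def)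
    then have "f = (\<lambda>x. schr adj v (\<lambda>x. 0) x + (\<Sum>b\<in>B. 0 * b x))" by (simp add: schr_eq_app fun_eq_iff)
    moreover have "lp_le p (C * lp_norm p f) (\<lambda>x. 0)" using lp_le_zero[OF p order_refl] by (simp add: True)
    moreover have "0 \<le> C * lp_norm p f" by (simp add: True)
    ultimately show ?thesis
      by (intro exI[of _ "\<lambda>x. 0"] exI[of _ "\<lambda>b. 0"] conjI ballI) (simp_all only: norm_zero)
  next
    case False
    define r where "r = lp_norm p f"
    have r: "0 < r" using False lp_norm_nonneg[OF p, of f] f R_lp by (auto simp: r_def)
    define t where "t = e / (2 * r)"
    have t: "0 < t" using e r by (simp add: t_def)
    have "lp_le p (norm (- complex_of_real t) * r) (\<lambda>x. - complex_of_real t * f x)"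
      unfolding r_def using f R_lp by (intro lp_le_scale[OF p] lp_le_lp_norm) auto
    moreover have "norm (- complex_of_real t) = t" using t by simp
    moreover have "t * r = e / 2" using r by (simp add: t_def)
    ultimately have "lp_norm p (\<lambda>x. f0 x - (f0 x + of_real t * f x)) \<le> e / 2"
      using lp_leD(2) by fastforce
    then have "(\<lambda>x. f0 x + of_real t * f x) \<in> G n"
      using e by (intro ball R_comb f) (auto simp: p_def)
    moreover have "f0 \<in> G n"
    proof (rule ball)
      have "lp_norm p (\<lambda>x. f0 x - f0 x) \<le> 0" using lp_leD(2)[OF lp_le_zero[OF p, of 0]] by simp
      then show "lp_norm (ereal q) (\<lambda>x. f0 x - f0 x) < e" using e by (simp add: p_def)
    qed (rule e)
    ultimately obtain u c u' c' where
      1: "lp_le p n u" "\<And>b. b \<in> B \<Longrightarrow> norm (c b) \<le> n"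
        "(\<lambda>x. f0 x + of_real t * f x) = (\<lambda>x. schr adj v u x + (\<Sum>b\<in>B. c b * b x))"
      and 2: "lp_le p n u'" "\<And>b. b \<in> B \<Longrightarrow> norm (c' b) \<le> n"
        "f0 = (\<lambda>x. schr adj v u' x + (\<Sum>b\<in>B. c' b * b x))"
      unfolding G_def by blast
    define a where "a = complex_of_real (1 / t)"
    have na: "norm a * (real n + real n) = C * r"
      using r e t unfolding a_def norm_of_real by (simp add: t_def C_def)
    have "lp_le p (norm a * (real n + real n)) (\<lambda>x. a * (u x - u' x))"
      by (intro lp_le_scale lp_le_diff p 1 2)
    moreover have "norm (a * (c b - c' b)) \<le> C * r" if "b \<in> B" for b
    proof -
      have "norm (c b - c' b) \<le> n + n"
        using norm_triangle_ineq4[of "c b" "c' b"] 1(2)[OF that] 2(2)[OF that] by linarith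
      then show ?thesis unfolding na[symmetric] norm_mult by (intro mult_left_mono) auto
    qed
    moreover have "f = (\<lambda>x. schr adj v (\<lambda>x. a * (u x - u' x)) x + (\<Sum>b\<in>B. a * (c b - c' b) * b x))"
    proof
      fix x
      have "of_real t * f x = (schr adj v u x + (\<Sum>b\<in>B. c b * b x)) - (schr adj v u' x + (\<Sum>b\<in>B. c' b * b x))"
        using fun_cong[OF 1(3), of x] fun_cong[OF 2(3), of x] by (simp add: algebra_simps)
      then have "f x = a * ((schr adj v u x - schr adj v u' x) + ((\<Sum>b\<in>B. c b * b x) - (\<Sum>b\<in>B. c' b * b x)))"
        using t by (simp add: a_def field_simps)
      then show "f x = schr adj v (\<lambda>x. a * (u x - u' x)) x + (\<Sum>b\<in>B. a * (c b - c' b) * b x)"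
        by (simp add: schr_eq_app app_scale app_diff distrib_left sum_subtractf[symmetric]
            sum_distrib_left left_diff_distrib mult.assoc)
    qed
    ultimately show ?thesis unfolding na r_def
      by (intro exI[of _ "\<lambda>x. a * (u x - u' x)"] exI[of _ "\<lambda>b. a * (c b - c' b)"] conjI ballI)
  qed
  show ?thesis unfolding p_def[symmetric]
    by (rule exI[of _ C], rule conjI[OF C], rule ballI, rule main)
qed

lemma shift_lp_le: "1 \<le> p \<Longrightarrow> lp_le p r u \<Longrightarrow> lp_le p r (shift act a u)"
  unfolding shift_def by (rule lp_le_reindex[OF _ bij_act])

lemma shift_lp: "1 \<le> p \<Longrightarrow> u \<in> lp p \<Longrightarrow> shift act a u \<in> lp p"
  using lp_le_imp_lp[OF shift_lp_le[OF _ lp_le_lp_norm]] .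

lemma lp_norm_shift:
  assumes "1 \<le> p" "u \<in> lp p"
  shows "lp_norm p (shift act a u) = lp_norm p u"
proof (rule antisym)
  show "lp_norm p (shift act a u) \<le> lp_norm p u"
    by (rule lp_leD[OF shift_lp_le[OF assms(1) lp_le_lp_norm[OF assms(2)]]])
  have "lp_le p (lp_norm p (shift act a u)) (shift act (- a) (shift act a u))"
    by (intro shift_lp_le lp_le_lp_norm shift_lp assms)
  then show "lp_norm p u \<le> lp_norm p (shift act a u)"
    by (auto simp: shift_def dest: lp_leD)
qed

text \<open>The delicate half is the lower bound. A translate \<open>V\<close> of \<open>g\<close>
  differs from a norm-controlled solution \<open>u\<close> of the same equation by a kernel element,
  whose norm is governed by its values on a finite set \<open>F\<close>. There the translates of
  \<open>g\<close> tend to 0, while \<open>u\<close> stays below \<open>C1\<close> times the norm of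
  the image.\<close>

lemma fredholm_imp_limits_invertible:
  assumes v: "bounded (range v)" and q: "1 < q" and Fr: "fredholm_on (ereal q) (schr adj v)"
    and w: "w \<in> lim_pot v"
  shows "invertible_on (ereal q) (schr adj w)"
proof -
  define p where "p = ereal q"
  have p: "1 \<le> p" and q1: "1 \<le> q" using q by (auto simp: p_def)
  obtain M where M: "\<forall>x. norm (v x) \<le> M" using v by (auto simp: bounded_iff)
  have wM: "\<forall>x. norm (w x) \<le> M" using lim_pot_bound[OF M w] .
  then have bw: "bounded (range w)" by (auto simp: bounded_iff)
  obtain h where h: "tends_to_infinity h" and vh: "\<And>x. (\<lambda>m. v (act (h m) x)) \<longlonglongrightarrow> w x"
    using w by (auto simp: lim_pot_def)
  note Fr' = Fr[unfolded fredholm_on_def, folded p_def]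
  obtain B1 where B1: "finite B1" "B1 \<subseteq> lp p" "{u\<in>lp p. schr adj v u = (\<lambda>x. 0)} \<subseteq> cspan B1"
    using Fr' by (elim conjE exE) (rule that)
  obtain B2 where B2: "finite B2" "B2 \<subseteq> lp p"
      "lp p \<subseteq> {(\<lambda>x. a x + b x) | a b. a \<in> schr adj v ` lp p \<and> b \<in> cspan B2}"
    using Fr' by (elim conjE exE) (rule that)
  have cl: "lp_closed p (schr adj v ` lp p)" using Fr' by (simp add: lp_closed_def)
  have Av: "schr adj v u \<in> lp p" if "u \<in> lp p" for u
    using bounded_on_schr[OF p v] that by (auto simp: bounded_on_def)
  have Aw: "schr adj w u \<in> lp p" if "u \<in> lp p" for u
    using bounded_on_schr[OF p bw] that by (auto simp: bounded_on_def)
  \<comment> \<open>The open mapping lemma is used twice: with no extra generators, for the closed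
    range, and with \<open>B2\<close>, for the whole space.\<close>
  have R1: "schr adj v ` lp p = {(\<lambda>x. schr adj v u x + s x) | u s. u \<in> lp (ereal q) \<and> s \<in> cspan {}}"
    by (auto simp: cspan_def p_def)
  obtain C1 where C1: "0 \<le> C1" and om1: "\<And>f. f \<in> schr adj v ` lp p \<Longrightarrow>
      \<exists>u. lp_le p (C1 * lp_norm p f) u \<and> f = schr adj v u"
    using schr_open_mapping[OF q1 v finite.emptyI empty_subsetI R1] cl by (auto simp: p_def)
  have R2: "lp p = {(\<lambda>x. schr adj v u x + s x) | u s. u \<in> lp (ereal q) \<and> s \<in> cspan B2}"
  proof (intro equalityI subsetI)
    fix f :: "'a \<Rightarrow> complex" assume "f \<in> lp p"
    then show "f \<in> {(\<lambda>x. schr adj v u x + s x) | u s. u \<in> lp (ereal q) \<and> s \<in> cspan B2}"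
      using B2(3) by (fastforce simp: p_def)
  next
    fix f assume "f \<in> {(\<lambda>x. schr adj v u x + s x) | u s. u \<in> lp (ereal q) \<and> s \<in> cspan B2}"
    then show "f \<in> lp p"
      using Av cspan_lp[OF p B2(1,2)] by (auto simp: p_def intro!: lp_add[OF p, unfolded p_def])
  qed
  obtain C2 where C2: "0 \<le> C2" and om2: "\<And>f. f \<in> lp p \<Longrightarrow> \<exists>u c. lp_le p (C2 * lp_norm p f) u \<and>
    (\<forall>b\<in>B2. norm (c b) \<le> C2 * lp_norm p f) \<and> f = (\<lambda>x. schr adj v u x + (\<Sum>b\<in>B2. c b * b x))"
    using schr_open_mapping[OF q1 v B2(1) B2(2)[unfolded p_def] R2] unfolding p_def lp_closed_def by blast
  obtain F e where F: "finite F" "\<And>x. x \<in> F \<Longrightarrow> e x \<in> lp p"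
    and e: "\<And>s. s \<in> cspan B1 \<Longrightarrow> s = (\<lambda>z. \<Sum>x\<in>F. s x * e x z)"
    using cspan_interpolation[OF p B1(1,2)] by blast
  \<comment> \<open>The limiting constant: \<open>C1\<close> for the solution \<open>u\<close>, and
    for the kernel element \<open>C1\<close> at each point of \<open>F\<close>, weighted by the norm
    of the reconstructing function \<open>e x\<close>.\<close>
  define K where "K = C1 + (\<Sum>x\<in>F. C1 * lp_norm p (e x))"
  have lower: "lp_norm p g \<le> K * lp_norm p (schr adj w g)" if g: "g \<in> lp p" for g
  proof -
    define a where "a = lp_norm p (schr adj w g)"
    define \<eta> where "\<eta> m = lp_norm p (\<lambda>x. (v (act (h m) x) - w x) * g x)" for m
    have bd: "norm (v (act (h m) x) - w x) \<le> M + M" for m x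
      using norm_triangle_ineq4[of "v (act (h m) x)" "w x"] M wM by (smt (verit))
    have \<eta>: "\<eta> \<longlonglongrightarrow> 0"
      unfolding \<eta>_def p_def using g q1 bd vh
      by (intro lp_norm_mult_tendsto_0[where M = "M + M"]) (auto simp: p_def LIM_zero)
    have "lp_norm p g \<le> C1 * (a + \<eta> m) + (\<Sum>x\<in>F. (norm (g (act (- h m) x)) + C1 * (a + \<eta> m)) * lp_norm p (e x))" for m
    proof -
      define V where "V = shift act (h m) g"
      have V: "V \<in> lp p" unfolding V_def by (intro shift_lp p g)
      define f where "f = schr adj v V"
      have f: "f = shift act (h m) (schr adj (\<lambda>x. v (act (h m) x)) g)"
        unfolding f_def V_def shift_schr[symmetric] by (simp add: shift_def)
      have "lp_le p (a + \<eta> m) (\<lambda>x. schr adj w g x + (v (act (h m) x) - w x) * g x)"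
        unfolding a_def \<eta>_def
      proof (intro lp_le_add p lp_le_lp_norm Aw g)
        have "(\<lambda>x. (v (act (h m) x) - w x) * g x) = (\<lambda>x. schr adj (\<lambda>x. v (act (h m) x)) g x - schr adj w g x)"
          by (simp only: schr_tschr_diff)
        moreover have "schr adj (\<lambda>x. v (act (h m) x)) g \<in> lp p"
          unfolding shift_schr[symmetric] by (intro shift_lp p Av g)
        ultimately show "(\<lambda>x. (v (act (h m) x) - w x) * g x) \<in> lp p"
          using lp_diff[OF p _ Aw[OF g]] by simp
      qed
      also have "(\<lambda>x. schr adj w g x + (v (act (h m) x) - w x) * g x) = schr adj (\<lambda>x. v (act (h m) x)) g"
      proof
        fix x
        show "schr adj w g x + (v (act (h m) x) - w x) * g x = schr adj (\<lambda>x. v (act (h m) x)) g x"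
          using schr_tschr_diff(1)[of "\<lambda>x. v (act (h m) x)" g x w] by (simp only: algebra_simps)
      qed
      finally have "lp_le p (a + \<eta> m) f" unfolding f by (intro shift_lp_le p)
      then have nf: "lp_norm p f \<le> a + \<eta> m" by (rule lp_leD)
      have "f \<in> schr adj v ` lp p" using V by (simp add: f_def)
      then obtain u where u: "lp_le p (C1 * lp_norm p f) u" "f = schr adj v u" using om1 by blast
      have u': "lp_le p (C1 * (a + \<eta> m)) u"
        using u(1) nf C1 by (intro lp_le_mono[OF p u(1)] mult_left_mono) auto
      define k where "k = (\<lambda>x. V x - u x)"
      have k: "k \<in> lp p" unfolding k_def using V u by (intro lp_diff p) (auto dest: lp_leD)
      have "schr adj v k = (\<lambda>x. 0)"
        using u(2) unfolding k_def f_def schr_eq_app app_diff by simp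
      then have kk: "k = (\<lambda>z. \<Sum>x\<in>F. k x * e x z)" using k B1(3) by (intro e) auto
      have "lp_le p (\<Sum>x\<in>F. norm (k x) * lp_norm p (e x)) (\<lambda>z. \<Sum>x\<in>F. k x * e x z)"
        using F by (intro lp_le_sum p lp_le_scale lp_le_lp_norm)
      then have "lp_le p (\<Sum>x\<in>F. norm (k x) * lp_norm p (e x)) k" using kk by simp
      then have "lp_le p (C1 * (a + \<eta> m) + (\<Sum>x\<in>F. norm (k x) * lp_norm p (e x))) (\<lambda>x. u x + k x)"
        by (intro lp_le_add p u')
      then have "lp_norm p V \<le> C1 * (a + \<eta> m) + (\<Sum>x\<in>F. norm (k x) * lp_norm p (e x))"
        by (auto simp: k_def dest: lp_leD)
      also have "\<dots> \<le> C1 * (a + \<eta> m) + (\<Sum>x\<in>F. (norm (g (act (- h m) x)) + C1 * (a + \<eta> m)) * lp_norm p (e x))"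
      proof (intro add_left_mono sum_mono mult_right_mono)
        fix x assume "x \<in> F"
        then show "0 \<le> lp_norm p (e x)" using F p by (intro lp_norm_nonneg)
        show "norm (k x) \<le> norm (g (act (- h m) x)) + C1 * (a + \<eta> m)"
          using norm_triangle_ineq4[of "V x" "u x"] lp_le_at[OF p u', of x]
          by (simp add: k_def V_def shift_def)
      qed
      finally show ?thesis using lp_norm_shift[OF p g] by (simp add: V_def)
    qed
    moreover have "(\<lambda>m. C1 * (a + \<eta> m) + (\<Sum>x\<in>F. (norm (g (act (- h m) x)) + C1 * (a + \<eta> m)) * lp_norm p (e x)))
       \<longlonglongrightarrow> C1 * (a + 0) + (\<Sum>x\<in>F. (0 + C1 * (a + 0)) * lp_norm p (e x))"
    proof (intro tendsto_intros \<eta>)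
      fix x
      have "tends_to_infinity (\<lambda>m. - h m)" using h by (simp add: tends_to_infinity_iff)
      then show "(\<lambda>m. norm (g (act (- h m) x))) \<longlonglongrightarrow> 0"
        using lp_act_tendsto_0[OF q1 g[unfolded p_def]] by (intro tendsto_norm_zero)
    qed
    ultimately have "lp_norm p g \<le> C1 * (a + 0) + (\<Sum>x\<in>F. (0 + C1 * (a + 0)) * lp_norm p (e x))"
      by (intro LIMSEQ_le_const) auto
    also have "\<dots> = K * a"
      by (simp add: K_def algebra_simps sum_distrib_left sum_distrib_right)
    finally show ?thesis by (simp add: a_def)
  qed
  have surj: "f \<in> schr adj w ` lp p" if f: "f \<in> lp p" for f
  proof -
    \<comment> \<open>Translations preserve the norm of \<open>f\<close>, so one bound serves the
      solutions and coefficients for all \<open>m\<close>.\<close>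
    define D where "D = C2 * lp_norm p f"
    define P where "P g u c \<longleftrightarrow> lp_le p D u \<and> (\<forall>b\<in>B2. norm (c b) \<le> D) \<and>
        g = (\<lambda>x. schr adj v u x + (\<Sum>b\<in>B2. c b * b x))" for g u c
    have "\<exists>u c. P (shift act (h m) f) u c" for m
      using om2[OF shift_lp[OF p f]] unfolding lp_norm_shift[OF p f] D_def P_def by blast
    then obtain u c where "\<And>m. P (shift act (h m) f) (u m) (c m)" by metis
    then have u: "\<And>m. lp_le p D (u m)" and c: "\<And>m b. b \<in> B2 \<Longrightarrow> norm (c m b) \<le> D"
      and eq: "\<And>m. shift act (h m) f = (\<lambda>x. schr adj v (u m) x + (\<Sum>b\<in>B2. c m b * b x))"
      unfolding P_def by blast+
    define z where "z m = shift act (- h m) (u m)" for m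
    have z: "lp_le p D (z m)" for m unfolding z_def by (intro shift_lp_le p u)
    have fx: "f x = schr adj (\<lambda>x. v (act (h m) x)) (z m) x + (\<Sum>b\<in>B2. c m b * b (act (h m) x))" for m x
    proof -
      have "f x = shift act (h m) f (act (h m) x)" by (simp add: shift_def)
      also have "\<dots> = schr adj v (u m) (act (h m) x) + (\<Sum>b\<in>B2. c m b * b (act (h m) x))"
        by (simp add: eq)
      also have "schr adj v (u m) (act (h m) x) = schr adj (\<lambda>x. v (act (h m) x)) (z m) x"
        unfolding shift_schr[symmetric] by (simp add: shift_def z_def)
      finally show ?thesis .
    qed
    obtain s Z where s: "strict_mono (s::nat\<Rightarrow>nat)" and Z: "\<And>x. (\<lambda>m. z (s m) x) \<longlonglongrightarrow> Z x"
      using bounded_subseq_pointwise[of z D] lp_le_at[OF p z] by blast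
    have "f x = schr adj w Z x" for x
    proof (rule LIMSEQ_unique)
      have "(\<lambda>m. schr adj (\<lambda>x. v (act (h (s m)) x)) (z (s m)) x) \<longlonglongrightarrow> schr adj w Z x"
        unfolding schr_eq_app
      proof (intro app_tendsto Z)
        show "(\<lambda>m. hmat (\<lambda>x. v (act (h (s m)) x)) x y) \<longlonglongrightarrow> hmat w x y" for y
          using LIMSEQ_subseq_LIMSEQ[OF vh s] by (auto simp: hmat_def o_def)
      qed
      moreover have "(\<lambda>m. c (s m) b * b (act (h (s m)) x)) \<longlonglongrightarrow> 0" if "b \<in> B2" for b
      proof (rule Lim_null_comparison)
        show "\<forall>\<^sub>F m in sequentially. norm (c (s m) b * b (act (h (s m)) x)) \<le> D * norm (b (act (h (s m)) x))"
          using c[OF that] by (intro always_eventually allI) (simp add: norm_mult mult_right_mono)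
        have "(\<lambda>m. b (act (h (s m)) x)) \<longlonglongrightarrow> 0"
          using B2(2) that by (intro lp_act_tendsto_0[OF q1] tends_to_infinity_subseq[OF h s]) (auto simp: p_def)
        then show "(\<lambda>m. D * norm (b (act (h (s m)) x))) \<longlonglongrightarrow> 0"
          using tendsto_mult_right_zero tendsto_norm_zero by blast
      qed
      then have "(\<lambda>m. \<Sum>b\<in>B2. c (s m) b * b (act (h (s m)) x)) \<longlonglongrightarrow> 0"
        by (intro tendsto_null_sum)
      ultimately have "(\<lambda>m. schr adj (\<lambda>x. v (act (h (s m)) x)) (z (s m)) x
          + (\<Sum>b\<in>B2. c (s m) b * b (act (h (s m)) x))) \<longlonglongrightarrow> schr adj w Z x + 0"
        by (rule tendsto_add)
      then show "(\<lambda>m. f x) \<longlonglongrightarrow> schr adj w Z x" by (simp flip: fx)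
    qed simp
    moreover have "Z \<in> lp p"
      by (rule lp_le_imp_lp[OF lp_le_lim[OF p _ Z, of D]]) (simp add: z)
    ultimately show ?thesis by (auto simp: image_iff fun_eq_iff)
  qed
  have "inj_on (schr adj w) (lp p)"
  proof (rule inj_onI)
    fix u u' assume u: "u \<in> lp p" "u' \<in> lp p" and "schr adj w u = schr adj w u'"
    then have "schr adj w (\<lambda>x. u x - u' x) = (\<lambda>x. 0)" by (simp add: schr_eq_app app_diff)
    moreover have "lp_norm p (\<lambda>x::'a. 0) = 0"
      by (rule antisym[OF lp_leD(2)[OF lp_le_zero[OF p order_refl]]
            lp_norm_nonneg[OF p lp_leD(1)[OF lp_le_zero[OF p order_refl]]]])
    ultimately have "lp_le p 0 (\<lambda>x. u x - u' x)"
      using lower[of "\<lambda>x. u x - u' x"] lp_diff[OF p u] by (simp add: lp_le_def)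
    from lp_le_0_imp_eq_0[OF p this] show "u = u'" by (simp add: fun_eq_iff)
  qed
  then have "bij_betw (schr adj w) (lp p) (lp p)"
    using surj Aw by (auto simp: bij_betw_def)
  then show ?thesis
    unfolding invertible_on_def p_def[symmetric] using lower bounded_on_schr[OF p bw] by blast
qed

end

section \<open>Exponential decay of inverses\<close>

lemma exp_decay_small:
  assumes "0 \<le> (A::real)" "0 < \<epsilon>" "0 < \<tau>"
  obtains R where "0 \<le> R" "A * exp (- \<epsilon> * R) \<le> \<tau>"
proof
  define R where "R = A / (\<tau> * \<epsilon>)"
  show "0 \<le> R" using assms by (simp add: R_def)
  have "A \<le> \<tau> * (1 + \<epsilon> * R)" using assms by (simp add: R_def field_simps)
  also have "\<dots> \<le> \<tau> * exp (\<epsilon> * R)"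
    using assms exp_ge_add_one_self by (intro mult_left_mono) auto
  finally show "A * exp (- \<epsilon> * R) \<le> \<tau>"
    by (simp add: exp_minus field_simps)
qed

text \<open>For \<open>t < 0\<close> the claim amounts to
  \<open>2 \<le> exp t + exp (- t)\<close>.\<close>

lemma abs_one_minus_exp_le: "\<bar>1 - exp (t::real)\<bar> \<le> exp \<bar>t\<bar> - 1"
proof (cases "0 \<le> t")
  case False
  have "2 \<le> exp t + exp (- t)"
    using exp_ge_add_one_self[of t] exp_ge_add_one_self[of "- t"] by linarith
  then show ?thesis using False by simp
qed simp

text \<open>Evaluation on \<open>F\<close> is injective on \<open>N\<close>. Points are eliminated
  one at a time: subtracting a multiple of an \<open>s\<close> with \<open>s a \<noteq> 0\<close>
  leads to the elements vanishing at \<open>a\<close>, which the remaining points determine.\<close>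

lemma determined_by_finite_imp_finite_span:
  assumes "finite F" "\<And>u w c. u \<in> N \<Longrightarrow> w \<in> N \<Longrightarrow> (\<lambda>x. u x + c * w x) \<in> N"
    "\<And>u. u \<in> N \<Longrightarrow> (\<And>x. x \<in> F \<Longrightarrow> u x = 0) \<Longrightarrow> u = (\<lambda>x. 0)"
  shows "\<exists>B. finite B \<and> B \<subseteq> N \<and> N \<subseteq> cspan B"
  using assms
proof (induction F arbitrary: N rule: finite_induct)
  case empty
  then have "N \<subseteq> cspan {}" by (auto simp: cspan_def)
  then show ?case by (intro exI[of _ "{}"]) simp
next
  case (insert a F)
  show ?case
  proof (cases "\<exists>s\<in>N. s a \<noteq> 0")
    case False
    show ?thesis
    proof (rule insert.IH)
      show "(\<lambda>x. u x + c * w x) \<in> N" if "u \<in> N" "w \<in> N" for u w c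
        using that by (rule insert.prems(1))
      show "u = (\<lambda>x. 0)" if "u \<in> N" "\<And>x. x \<in> F \<Longrightarrow> u x = 0" for u
        using that False by (intro insert.prems(2)) auto
    qed
  next
    case True
    then obtain s where s: "s \<in> N" "s a \<noteq> 0" by blast
    define N0 where "N0 = {u\<in>N. u a = 0}"
    have "\<exists>B. finite B \<and> B \<subseteq> N0 \<and> N0 \<subseteq> cspan B"
    proof (rule insert.IH)
      show "(\<lambda>x. u x + c * w x) \<in> N0" if "u \<in> N0" "w \<in> N0" for u w c
        using that insert.prems(1)[of u w c] by (simp add: N0_def)
      show "u = (\<lambda>x. 0)" if "u \<in> N0" "\<And>x. x \<in> F \<Longrightarrow> u x = 0" for u
        using that by (intro insert.prems(2)) (auto simp: N0_def)
    qed
    then obtain B where B: "finite B" "B \<subseteq> N0" "N0 \<subseteq> cspan B" by blast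
    have sB: "s \<notin> B" using s B by (auto simp: N0_def)
    have "u \<in> cspan (insert s B)" if u: "u \<in> N" for u
    proof -
      define k where "k = u a / s a"
      have "(\<lambda>x. u x + (- k) * s x) \<in> N0"
        using insert.prems(1)[OF u s(1), of "- k"] s by (simp add: N0_def k_def)
      then obtain c where c: "(\<lambda>x. u x + (- k) * s x) = (\<lambda>x. \<Sum>b\<in>B. c b * b x)"
        using B(3) unfolding cspan_def by blast
      have "u x = (\<Sum>b\<in>insert s B. (c(s := k)) b * b x)" for x
      proof -
        have "(\<Sum>b\<in>B. (c(s := k)) b * b x) = (\<Sum>b\<in>B. c b * b x)"
          using sB by (intro sum.cong) auto
        then show ?thesis using fun_cong[OF c, of x] B(1) sB by (simp add: algebra_simps)
      qed
      then show ?thesis unfolding cspan_def by (intro CollectI exI[of _ "c(s := k)"] ext)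
    qed
    moreover have "insert s B \<subseteq> N" using s B by (auto simp: N0_def)
    ultimately show ?thesis using B(1) by (intro exI[of _ "insert s B"]) blast
  qed
qed

text \<open>A finite-dimensional space is closed under coordinatewise limits. Elimination of a point
  \<open>a\<close> survives the limit because the coefficients \<open>f k a / s a\<close>
  converge.\<close>

lemma finite_support_subspace_closed:
  fixes N :: "('a \<Rightarrow> complex) set"
  assumes "finite F" "\<And>u w c. u \<in> N \<Longrightarrow> w \<in> N \<Longrightarrow> (\<lambda>x. u x + c * w x) \<in> N"
    "\<And>u x. u \<in> N \<Longrightarrow> x \<notin> F \<Longrightarrow> u x = 0"
    "\<And>k. f k \<in> N" "\<And>x. (\<lambda>k. f k x) \<longlonglongrightarrow> g x"
  shows "g \<in> N"
  using assms
proof (induction F arbitrary: N f g rule: finite_induct)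
  case empty
  then have "f k x = 0" for k x by blast
  then have "g x = 0" for x using empty.prems(4)[of x] LIMSEQ_unique[OF tendsto_const, of 0] by simp
  then have "g = f 0" using \<open>\<And>k x. f k x = 0\<close> by auto
  then show ?case using empty.prems(3) by simp
next
  case (insert a F)
  show ?case
  proof (cases "\<exists>s\<in>N. s a \<noteq> 0")
    case False
    show ?thesis
    proof (rule insert.IH[where f = f])
      show "(\<lambda>x. u x + c * w x) \<in> N" if "u \<in> N" "w \<in> N" for u w c
        using that by (rule insert.prems(1))
      show "u x = 0" if "u \<in> N" "x \<notin> F" for u x
        using that False insert.prems(2)[of u x] by (cases "x = a") auto
    qed (fact insert.prems)+
  next
    case True
    then obtain s where s: "s \<in> N" "s a \<noteq> 0" by blast
    define N0 where "N0 = {u\<in>N. u a = 0}"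
    have "(\<lambda>x. g x + (- g a / s a) * s x) \<in> N0"
    proof (rule insert.IH[where f = "\<lambda>k x. f k x + (- f k a / s a) * s x"])
      show "(\<lambda>x. u x + c * w x) \<in> N0" if "u \<in> N0" "w \<in> N0" for u w c
        using that insert.prems(1)[of u w c] by (simp add: N0_def)
      show "u x = 0" if "u \<in> N0" "x \<notin> F" for u x
        using that insert.prems(2)[of u x] by (cases "x = a") (auto simp: N0_def)
      show "(\<lambda>x. f k x + (- f k a / s a) * s x) \<in> N0" for k
        using insert.prems(1)[OF insert.prems(3) s(1), of k "- f k a / s a"] s by (simp add: N0_def)
      show "(\<lambda>k. f k x + (- f k a / s a) * s x) \<longlonglongrightarrow> g x + (- g a / s a) * s x" for x
        using s by (intro tendsto_intros insert.prems(4))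
    qed
    then have "(\<lambda>x. g x + (- g a / s a) * s x) \<in> N" by (simp add: N0_def)
    from insert.prems(1)[OF this s(1), of "g a / s a"] show ?thesis
      by (simp add: algebra_simps)
  qed
qed

context lattice_graph
begin

text \<open>The weight \<open>exp (\<epsilon> * pd x y)\<close> is cut off at the height it has at the point of interest, so that the
  weighted function stays in \<open>lp p\<close>; conjugation by it changes the operator by a small perturbation.\<close>

lemma combes_thomas:
  assumes p: "1 \<le> p" and C: "0 \<le> C"
    and lower: "\<And>u. u \<in> lp p \<Longrightarrow> lp_norm p u \<le> C * lp_norm p (schr adj w u)"
    and \<epsilon>: "0 < \<epsilon>" "C * ((exp (\<epsilon> * step) - 1) * vol step) \<le> 1 / 2"
    and \<kappa>: "\<kappa> \<in> lp p" "schr adj w \<kappa> = (\<lambda>x. if x = y then 1 else 0)"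
  shows "norm (\<kappa> x) \<le> 2 * C * exp (- \<epsilon> * pd x y)"
proof -
  define N where "N = pd x y"
  define \<phi> where "\<phi> z = exp (\<epsilon> * min (pd z y) N)" for z
  define g where "g z = of_real (\<phi> z) * \<kappa> z" for z
  \<comment> \<open>A bound for the relative change of the weight along an edge.\<close>
  define \<alpha> where "\<alpha> = exp (\<epsilon> * step) - 1"
  have \<alpha>: "0 \<le> \<alpha>" using \<epsilon> step_nonneg by (simp add: \<alpha>_def)
  have \<phi>_pos: "0 < \<phi> z" for z by (simp add: \<phi>_def)
  have "lp_le p (norm (complex_of_real (exp (\<epsilon> * N))) * lp_norm p \<kappa>) (\<lambda>z. of_real (exp (\<epsilon> * N)) * \<kappa> z)"
    by (intro lp_le_scale[OF p] lp_le_lp_norm \<kappa>)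
  then have "lp_le p (norm (complex_of_real (exp (\<epsilon> * N))) * lp_norm p \<kappa>) g"
  proof (rule lp_le_mono[OF p])
    show "norm (g z) \<le> norm (complex_of_real (exp (\<epsilon> * N)) * \<kappa> z)" for z
      using \<epsilon> by (auto simp: g_def \<phi>_def norm_mult intro!: mult_right_mono)
  qed simp
  then have g: "g \<in> lp p" by (rule lp_leD)
  \<comment> \<open>The commutator of the operator with the weight, applied to
    \<open>\<kappa>\<close>. The diagonal, hence the potential, cancels; each edge term is estimated
    by \<open>g\<close> itself, so that the error can be absorbed into the left-hand side.\<close>
  define D where "D z = schr adj w g z - of_real (\<phi> z) * schr adj w \<kappa> z" for z
  have ratio: "norm (hmat w z y' * (of_real (\<phi> y') - of_real (\<phi> z)) * \<kappa> y') \<le> \<alpha> * norm (g y')" for z y'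
  proof (cases "adj z y'")
    case True
    have "\<bar>\<epsilon> * min (pd z y) N - \<epsilon> * min (pd y' y) N\<bar> \<le> \<epsilon> * step"
    proof -
      have "\<bar>min (pd z y) N - min (pd y' y) N\<bar> \<le> step"
        using pd_triangle[of z y y'] pd_triangle[of y' y z] pd_sym[of z y'] adj_pd_le_step[OF True]
        by linarith
      then have "\<epsilon> * \<bar>min (pd z y) N - min (pd y' y) N\<bar> \<le> \<epsilon> * step" using \<epsilon> by (intro mult_left_mono) auto
      then show ?thesis using \<epsilon> by (simp add: abs_mult right_diff_distrib[symmetric])
    qed
    then have "\<bar>1 - \<phi> z / \<phi> y'\<bar> \<le> \<alpha>"
      unfolding \<phi>_def exp_diff[symmetric] \<alpha>_def
      by (intro order_trans[OF abs_one_minus_exp_le]) simp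
    then have "\<bar>1 - \<phi> z / \<phi> y'\<bar> * \<phi> y' \<le> \<alpha> * \<phi> y'"
      using \<phi>_pos[of y'] by (intro mult_right_mono) auto
    moreover have "\<bar>1 - \<phi> z / \<phi> y'\<bar> * \<phi> y' = \<bar>(1 - \<phi> z / \<phi> y') * \<phi> y'\<bar>"
      using \<phi>_pos[of y'] by (simp add: abs_mult)
    moreover have "(1 - \<phi> z / \<phi> y') * \<phi> y' = \<phi> y' - \<phi> z"
      using \<phi>_pos[of y'] by (simp add: field_simps)
    ultimately have 1: "\<bar>\<phi> y' - \<phi> z\<bar> \<le> \<alpha> * \<phi> y'" by simp
    have 2: "norm (hmat w z y') \<le> 1"
      using True by (cases "degree adj z") (auto simp: hmat_def norm_divide divide_simps simp del: of_nat_Suc)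
    have "norm (hmat w z y' * (of_real (\<phi> y') - of_real (\<phi> z)) * \<kappa> y')
        = norm (hmat w z y') * \<bar>\<phi> y' - \<phi> z\<bar> * norm (\<kappa> y')"
      unfolding norm_mult of_real_diff[symmetric] norm_of_real ..
    also have "\<dots> \<le> 1 * (\<alpha> * \<phi> y') * norm (\<kappa> y')"
      by (intro mult_right_mono mult_mono 1 2) auto
    also have "\<dots> = \<alpha> * norm (g y')"
      using \<phi>_pos[of y'] unfolding g_def norm_mult norm_of_real by simp
    finally show ?thesis .
  next
    case False
    then show ?thesis using \<alpha> by (cases "z = y'") (auto simp: hmat_def)
  qed
  have "lp_le p (\<alpha> * vol step * lp_norm p g) D"
  proof (rule lp_le_banded[OF p lp_le_lp_norm[OF g] \<alpha>])
    fix z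
    have "D z = (\<Sum>y'\<in>nbh step z. hmat w z y' * (of_real (\<phi> y') - of_real (\<phi> z)) * \<kappa> y')"
      unfolding D_def schr_eq_app app_def g_def sum_distrib_left sum_subtractf[symmetric]
      by (intro sum.cong refl) (simp only: algebra_simps)
    also have "norm \<dots> \<le> (\<Sum>y'\<in>nbh step z. \<alpha> * norm (g y'))"
      by (intro sum_norm_le ratio)
    finally show "norm (D z) \<le> \<alpha> * (\<Sum>y'\<in>nbh step z. norm (g y'))"
      by (simp add: sum_distrib_left)
  qed
  then have "lp_le p (norm (1::complex) + \<alpha> * vol step * lp_norm p g) (\<lambda>z. (if z = y then 1 else 0) + D z)"
    by (intro lp_le_add lp_le_single p)
  also have "(\<lambda>z. (if z = y then 1 else 0) + D z) = schr adj w g"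
  proof
    fix z
    \<comment> \<open>The weight is 1 at the source \<open>y\<close>, so weighting leaves the delta
      function unchanged.\<close>
    have "\<phi> y = 1" by (simp add: \<phi>_def N_def min_def)
    then show "(if z = y then 1 else 0) + D z = schr adj w g z" unfolding D_def \<kappa>(2) by simp
  qed
  finally have "lp_norm p (schr adj w g) \<le> 1 + \<alpha> * vol step * lp_norm p g"
    by (auto dest: lp_leD)
  then have "lp_norm p g \<le> C * (1 + \<alpha> * vol step * lp_norm p g)"
    using lower[OF g] C mult_left_mono order_trans by blast
  also have "\<dots> = C + C * (\<alpha> * vol step) * lp_norm p g" by (simp add: algebra_simps)
  also have "\<dots> \<le> C + 1 / 2 * lp_norm p g"
    using \<epsilon>(2) lp_norm_nonneg[OF p g] unfolding \<alpha>_def by (intro add_left_mono mult_right_mono)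
  finally have "lp_norm p g \<le> 2 * C" by simp
  then have "norm (g x) \<le> 2 * C" using lp_le_at[OF p lp_le_lp_norm[OF g], of x] by simp
  then have "exp (\<epsilon> * pd x y) * norm (\<kappa> x) \<le> 2 * C"
    unfolding g_def norm_mult norm_of_real by (simp add: \<phi>_def N_def)
  then show ?thesis by (simp add: exp_minus field_simps)
qed

text \<open>\<open>d\<close> makes \<open>C * vol step * d\<close> at most 1/2, and
  \<open>\<epsilon>\<close> lets the weight grow by a factor of at most \<open>1 + d\<close> per
  edge; the added ones avoid division by 0. The rate depends on \<open>C\<close> and the graph
  alone, hence is common to operators with a common lower bound.\<close>

lemma combes_thomas_rate:
  assumes "0 \<le> C"
  obtains \<epsilon> where "0 < \<epsilon>" "C * ((exp (\<epsilon> * step) - 1) * vol step) \<le> 1 / 2"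
proof
  define d where "d = 1 / (2 * (C * vol step + 1))"
  have pos: "0 \<le> C * vol step" using assms vol_nonneg by simp
  then have d: "0 < d" by (simp add: d_def)
  define \<epsilon> where "\<epsilon> = ln (1 + d) / (step + 1)"
  show "0 < \<epsilon>" using d step_nonneg by (simp add: \<epsilon>_def)
  then have "\<epsilon> * step \<le> \<epsilon> * (step + 1)" by simp
  also have "\<dots> = ln (1 + d)" using step_nonneg by (simp add: \<epsilon>_def)
  finally have "exp (\<epsilon> * step) - 1 \<le> d" using d by (simp add: ln_ge_iff)
  then have "C * ((exp (\<epsilon> * step) - 1) * vol step) \<le> C * (d * vol step)"
    using assms vol_nonneg by (intro mult_left_mono mult_right_mono)
  also have "\<dots> = (C * vol step) * d" by simp
  also have "\<dots> \<le> 1 / 2" using pos by (simp add: d_def field_simps)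
  finally show "C * ((exp (\<epsilon> * step) - 1) * vol step) \<le> 1 / 2" .
qed

text \<open>A two-sided inverse recorded entrywise. The band structure makes both products finite
  sums, so no exponent occurs: in this form inverses pass from one exponent to another. The third
  clause is the product with \<open>K\<close> on the left, summed over a ball about the column index
  \<open>z\<close>.\<close>

definition green :: "('a \<Rightarrow> complex) \<Rightarrow> real \<Rightarrow> real \<Rightarrow> ('a \<Rightarrow> 'a \<Rightarrow> complex) \<Rightarrow> bool" where
  "green w C \<epsilon> K \<longleftrightarrow> (\<forall>x y. norm (K x y) \<le> C * exp (- \<epsilon> * pd x y)) \<and>
     (\<forall>x z. (\<Sum>y\<in>nbh step x. hmat w x y * K y z) = (if x = z then 1 else 0)) \<and>
     (\<forall>x z. (\<Sum>y\<in>nbh step z. hmat w y z * K x y) = (if x = z then 1 else 0))"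

lemma invertible_imp_green:
  assumes p: "1 \<le> p" and inv: "invertible_on p (schr adj w)"
  obtains C \<epsilon> K where "0 \<le> C" "0 < \<epsilon>" "green w C \<epsilon> K"
proof -
  have bij: "bij_betw (schr adj w) (lp p) (lp p)" and bd: "bounded_on p (schr adj w)"
    using inv by (auto simp: invertible_on_def)
  obtain C' where C': "\<forall>u\<in>lp p. lp_norm p u \<le> C' * lp_norm p (schr adj w u)"
    using inv by (auto simp: invertible_on_def)
  define C where "C = max 0 C'"
  have C: "0 \<le> C" by (simp add: C_def)
  have lower: "lp_norm p u \<le> C * lp_norm p (schr adj w u)" if "u \<in> lp p" for u
  proof -
    have "schr adj w u \<in> lp p" using bd that by (auto simp: bounded_on_def)
    then have "C' * lp_norm p (schr adj w u) \<le> C * lp_norm p (schr adj w u)"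
      using lp_norm_nonneg[OF p] by (intro mult_right_mono) (auto simp: C_def)
    then show ?thesis using C' that by fastforce
  qed
  define \<delta> where "\<delta> y = (\<lambda>x. if x = y then 1 else 0 :: complex)" for y :: 'a
  have \<delta>: "\<delta> y \<in> lp p" for y unfolding \<delta>_def by (rule lp_le_imp_lp[OF lp_le_single[OF p]])
  have "\<exists>k\<in>lp p. schr adj w k = \<delta> y" for y
  proof -
    have "\<delta> y \<in> schr adj w ` lp p" using \<delta> bij by (simp add: bij_betw_def)
    then show ?thesis by force
  qed
  then obtain \<kappa> where \<kappa>: "\<And>y. \<kappa> y \<in> lp p" "\<And>y. schr adj w (\<kappa> y) = \<delta> y" by metis
  obtain \<epsilon> where \<epsilon>: "0 < \<epsilon>" "C * ((exp (\<epsilon> * step) - 1) * vol step) \<le> 1 / 2"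
    using combes_thomas_rate[OF C] .
  have single: "schr adj w (\<delta> z) x = hmat w x z" for x z
  proof -
    have "schr adj w (\<delta> z) x = (\<Sum>y\<in>nbh step x. if y = z then hmat w x z else 0)"
      unfolding schr_eq_app app_def \<delta>_def by (intro sum.cong) auto
    also have "\<dots> = hmat w x z" using hmat_eq_0[of x z w] by (auto simp: nbh_iff)
    finally show ?thesis .
  qed
  have "green w (2 * C) \<epsilon> (\<lambda>x y. \<kappa> y x)"
    unfolding green_def
  proof (intro conjI allI)
    fix x y
    show "norm (\<kappa> y x) \<le> 2 * C * exp (- \<epsilon> * pd x y)"
      by (rule combes_thomas[OF p C lower \<epsilon> \<kappa>(1) \<kappa>(2)[unfolded \<delta>_def]])
  next
    fix x z
    show "(\<Sum>y\<in>nbh step x. hmat w x y * \<kappa> z y) = (if x = z then 1 else 0)"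
      using fun_cong[OF \<kappa>(2)[of z], of x] by (simp add: schr_eq_app app_def \<delta>_def)
  next
    fix x z
    \<comment> \<open>Column \<open>z\<close> of the product of the inverse with the operator. The
      operator maps it and the delta function at \<open>z\<close> to the same image, so injectivity
      turns the right inverse into a left one.\<close>
    define g where "g = (\<lambda>x. \<Sum>y\<in>nbh step z. hmat w y z * \<kappa> y x)"
    have "schr adj w g x = schr adj w (\<delta> z) x" for x
    proof -
      have "schr adj w g x = (\<Sum>y\<in>nbh step z. hmat w y z * schr adj w (\<kappa> y) x)"
        unfolding g_def schr_eq_app app_sum app_scale ..
      also have "\<dots> = (\<Sum>y\<in>nbh step z. if y = x then hmat w x z else 0)"
        unfolding \<kappa>(2) \<delta>_def by (intro sum.cong) auto
      also have "\<dots> = hmat w x z" using hmat_eq_0[of x z w] by (auto simp: nbh_iff pd_sym)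
      finally show ?thesis by (simp add: single)
    qed
    moreover have "g \<in> lp p" unfolding g_def by (intro lp_sum p lp_scale \<kappa>) simp
    ultimately have "g = \<delta> z"
      using bij \<delta> by (auto simp: bij_betw_def dest!: inj_onD[of _ _ g "\<delta> z"])
    then show "(\<Sum>y\<in>nbh step z. hmat w y z * \<kappa> y x) = (if x = z then 1 else 0)"
      by (simp add: g_def \<delta>_def fun_eq_iff)
  qed
  then show thesis using that[of "2 * C" \<epsilon>] C \<epsilon>(1) by simp
qed

text \<open>The matrix is kept and only its constants are replaced. Decay of any quality puts the
  columns into \<open>lp \<infinity>\<close>, where the lower bound yields new constants through the
  Combes-Thomas estimate. They no longer refer to \<open>C0\<close> and \<open>\<epsilon>0\<close>,
  which may vary with the operator.\<close>

lemma green_improve: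
  assumes G: "green w C0 \<epsilon>0 K" "0 \<le> C0" "0 < \<epsilon>0" and C: "0 \<le> C"
    and lower: "\<And>u. u \<in> lp \<infinity> \<Longrightarrow> lp_norm \<infinity> u \<le> C * lp_norm \<infinity> (schr adj w u)"
    and \<epsilon>: "0 < \<epsilon>" "C * ((exp (\<epsilon> * step) - 1) * vol step) \<le> 1 / 2"
  shows "green w (2 * C) \<epsilon> K"
proof -
  have "norm (K x y) \<le> 2 * C * exp (- \<epsilon> * pd x y)" for x y
  proof (rule combes_thomas[OF _ C lower \<epsilon>, where \<kappa> = "\<lambda>x. K x y"])
    have "norm (K x y) \<le> C0" for x
    proof -
      have "norm (K x y) \<le> C0 * exp (- \<epsilon>0 * pd x y)" using G(1) by (simp add: green_def)
      also have "\<dots> \<le> C0 * 1" using G by (intro mult_left_mono) auto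
      finally show ?thesis by simp
    qed
    then show "(\<lambda>x. K x y) \<in> lp \<infinity>" using lp_le_imp_lp[of \<infinity> C0 "\<lambda>x. K x y"] by (simp add: lp_le_infty)
    show "schr adj w (\<lambda>x. K x y) = (\<lambda>x. if x = y then 1 else 0)"
      using G(1) by (simp add: green_def schr_eq_app app_def)
  qed auto
  then show ?thesis using G(1) by (auto simp: green_def)
qed

text \<open>The residual has two sources: inside the radius the matrices differ by at most
  \<open>\<delta>\<close>, outside it the inverse has been cut off. In both cases half of the decay
  rate is kept for summability; beyond \<open>R\<close> the other half gives the factor
  \<open>exp (- (\<epsilon> / 2) * R)\<close>.\<close>

lemma truncation_residual:
  fixes a a' :: "'a \<Rightarrow> 'a \<Rightarrow> complex" and \<kappa> :: "'a \<Rightarrow> complex"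
  assumes C: "0 \<le> C" and \<epsilon>: "0 < \<epsilon>" and \<delta>: "0 \<le> \<delta>" and \<alpha>: "0 \<le> \<alpha>"
    and \<kappa>: "\<And>y. norm (\<kappa> y) \<le> C * exp (- \<epsilon> * pd y z)"
    and a': "\<And>x y. norm (a' x y) \<le> \<alpha>"
    and inv: "(\<Sum>y\<in>nbh step x. a' x y * \<kappa> y) = (if x = z then 1 else 0)"
    and close: "\<And>y. pd y z \<le> R \<Longrightarrow> norm (a x y - a' x y) \<le> \<delta>"
  shows "norm ((\<Sum>y\<in>nbh step x. a x y * (if pd y z \<le> R then \<kappa> y else 0)) - (if x = z then 1 else 0))
    \<le> vol step * C * exp (\<epsilon> * step) * (\<delta> + \<alpha> * exp (- (\<epsilon> / 2) * R)) * exp (- (\<epsilon> / 2) * pd x z)"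
proof -
  let ?d = "C * exp (\<epsilon> * step) * (\<delta> + \<alpha> * exp (- (\<epsilon> / 2) * R)) * exp (- (\<epsilon> / 2) * pd x z)"
  have summand: "norm (a x y * (if pd y z \<le> R then \<kappa> y else 0) - a' x y * \<kappa> y) \<le> ?d"
    if y: "y \<in> nbh step x" for y
  proof -
    \<comment> \<open>The factor \<open>exp (\<epsilon> * step)\<close> pays for passing from
      \<open>y\<close> to \<open>x\<close>, which are at distance at most
      \<open>step\<close>.\<close>
    define t where "t = exp (\<epsilon> * step) * exp (- (\<epsilon> / 2) * pd x z)"
    have le: "exp (- (\<epsilon> / 2) * pd y z) \<le> t"
    proof -
      have "pd x z \<le> step + pd y z" using pd_triangle[of x z y] y by (simp add: nbh_iff)
      then have "\<epsilon> / 2 * pd x z \<le> \<epsilon> / 2 * (step + pd y z)" using \<epsilon> by (intro mult_left_mono) auto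
      moreover have "0 \<le> \<epsilon> / 2 * step" using \<epsilon> step_nonneg by simp
      ultimately have "- (\<epsilon> / 2) * pd y z \<le> \<epsilon> * step + - (\<epsilon> / 2) * pd x z"
        by (simp add: algebra_simps)
      then show ?thesis unfolding t_def exp_add[symmetric] by simp
    qed
    have split: "exp (- \<epsilon> * pd y z) = exp (- (\<epsilon> / 2) * pd y z) * exp (- (\<epsilon> / 2) * pd y z)"
      by (simp flip: exp_add)
    have t: "0 \<le> t" by (simp add: t_def)
    have d: "?d = C * t * \<delta> + C * t * (\<alpha> * exp (- (\<epsilon> / 2) * R))"
      by (simp add: t_def algebra_simps)
    show ?thesis
    proof (cases "pd y z \<le> R")
      case True
      have "exp (- (\<epsilon> / 2) * pd y z) \<le> 1" using \<epsilon> by simp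
      then have "exp (- \<epsilon> * pd y z) \<le> t * 1" unfolding split using le t by (intro mult_mono) auto
      then have "norm (\<kappa> y) \<le> C * t" using \<kappa>[of y] C by (smt (verit) mult_left_mono)
      then have "norm (a x y - a' x y) * norm (\<kappa> y) \<le> \<delta> * (C * t)"
        using close[OF True] \<delta> by (intro mult_mono) auto
      moreover have "0 \<le> C * t * (\<alpha> * exp (- (\<epsilon> / 2) * R))" using C t \<alpha> by simp
      moreover have "a x y * (if pd y z \<le> R then \<kappa> y else 0) - a' x y * \<kappa> y = (a x y - a' x y) * \<kappa> y"
        using True by (simp add: left_diff_distrib)
      ultimately show ?thesis unfolding d norm_mult by (simp add: norm_mult mult_ac)
    next
      case False
      have "\<epsilon> / 2 * R \<le> \<epsilon> / 2 * pd y z" using False \<epsilon> by (intro mult_left_mono) auto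
      then have "exp (- (\<epsilon> / 2) * pd y z) \<le> exp (- (\<epsilon> / 2) * R)" by simp
      then have "exp (- \<epsilon> * pd y z) \<le> t * exp (- (\<epsilon> / 2) * R)"
        unfolding split using le t by (intro mult_mono) auto
      then have "C * exp (- \<epsilon> * pd y z) \<le> C * (t * exp (- (\<epsilon> / 2) * R))" using C by (intro mult_left_mono)
      then have "norm (\<kappa> y) \<le> C * (t * exp (- (\<epsilon> / 2) * R))" using \<kappa>[of y] by linarith
      then have "norm (a' x y) * norm (\<kappa> y) \<le> \<alpha> * (C * (t * exp (- (\<epsilon> / 2) * R)))"
        using a' \<alpha> by (intro mult_mono) auto
      moreover have "0 \<le> C * t * \<delta>" using C t \<delta> by simp
      moreover have "norm (a x y * (if pd y z \<le> R then \<kappa> y else 0) - a' x y * \<kappa> y) = norm (a' x y) * norm (\<kappa> y)"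
        using False by (simp add: norm_mult)
      ultimately show ?thesis unfolding d by (simp add: mult_ac)
    qed
  qed
  have d0: "0 \<le> ?d" using C \<delta> \<alpha> by simp
  have "norm ((\<Sum>y\<in>nbh step x. a x y * (if pd y z \<le> R then \<kappa> y else 0)) - (if x = z then 1 else 0))
      = norm (\<Sum>y\<in>nbh step x. a x y * (if pd y z \<le> R then \<kappa> y else 0) - a' x y * \<kappa> y)"
    unfolding inv[symmetric] sum_subtractf ..
  also have "\<dots> \<le> (\<Sum>y\<in>nbh step x. ?d)" by (intro sum_norm_le summand)
  also have "\<dots> = real (card (nbh step x)) * ?d" by simp
  also have "\<dots> \<le> vol step * ?d" using d0 by (intro mult_right_mono card_nbh_le_vol)
  finally show ?thesis by (simp only: mult.assoc)
qed

text \<open>The inner sums extend to the common ball \<open>nbh (R + S) x\<close> because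
  \<open>a\<close> vanishes beyond \<open>S\<close>; then two finite sums are exchanged.\<close>

lemma app_app:
  assumes a: "\<And>y z. S < pd y z \<Longrightarrow> a y z = 0"
  shows "app R b (app S a u) x = app (R + S) (\<lambda>x z. \<Sum>y\<in>nbh R x. b x y * a y z) u x"
proof -
  have sub: "nbh S y \<subseteq> nbh (R + S) x" if "y \<in> nbh R x" for y
  proof
    fix z assume "z \<in> nbh S y"
    then show "z \<in> nbh (R + S) x" using that pd_triangle[of x z y] by (simp add: nbh_iff)
  qed
  have "app R b (app S a u) x = (\<Sum>y\<in>nbh R x. b x y * (\<Sum>z\<in>nbh S y. a y z * u z))"
    by (simp add: app_def)
  also have "\<dots> = (\<Sum>y\<in>nbh R x. b x y * (\<Sum>z\<in>nbh (R + S) x. a y z * u z))"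
    using sub a by (intro sum.cong refl arg_cong2[of _ _ _ _ "(*)"] sum.mono_neutral_left) (auto simp: nbh_iff)
  also have "\<dots> = (\<Sum>y\<in>nbh R x. \<Sum>z\<in>nbh (R + S) x. b x y * a y z * u z)"
    by (simp add: sum_distrib_left mult.assoc)
  also have "\<dots> = (\<Sum>z\<in>nbh (R + S) x. \<Sum>y\<in>nbh R x. b x y * a y z * u z)"
    by (rule sum.swap)
  also have "\<dots> = app (R + S) (\<lambda>x z. \<Sum>y\<in>nbh R x. b x y * a y z) u x"
    by (simp add: app_def sum_distrib_right)
  finally show ?thesis .
qed

lemma app_exp_lp_le:
  assumes p: "1 \<le> p" and u: "lp_le p r u" and \<eta>: "0 \<le> \<eta>"
    and E: "\<And>x z. norm (E x z) \<le> \<eta> * exp (- \<epsilon> * pd x z)"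
    and S: "\<And>x T. finite T \<Longrightarrow> (\<Sum>y\<in>T. exp (- \<epsilon> * pd x y)) \<le> S"
  shows "lp_le p (\<eta> * S * r) (app R E u)"
proof (rule lp_le_schur[OF p u, where k = "\<lambda>x z. \<eta> * exp (- \<epsilon> * pd x z)" and N = "nbh R"])
  show "(\<Sum>y\<in>nbh R x. \<eta> * exp (- \<epsilon> * pd x y)) \<le> \<eta> * S" for x
    unfolding sum_distrib_left[symmetric] by (intro mult_left_mono S \<eta>) simp
  show "(\<Sum>x\<in>T. \<eta> * exp (- \<epsilon> * pd x y)) \<le> \<eta> * S" if "finite T" for y T
    unfolding sum_distrib_left[symmetric] pd_sym[of _ y] by (intro mult_left_mono S \<eta> that)
  show "norm (app R E u x) \<le> (\<Sum>y\<in>nbh R x. \<eta> * exp (- \<epsilon> * pd x y) * norm (u y))" for x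
    unfolding app_def by (intro sum_norm_le) (simp only: norm_mult mult_right_mono[OF E norm_ge_zero])
qed (use \<eta> in auto)

end

section \<open>Parametrices\<close>

context lattice_graph
begin

text \<open>Row \<open>x\<close> of the parametrix is the truncated Green function, based at \<open>x\<close>, of an operator that is close to
  the given one near \<open>x\<close>; for the right parametrix the same is done with columns.\<close>

lemma left_parametrix:
  assumes v: "\<forall>x. norm (v x) \<le> M" and C: "0 \<le> C" and \<epsilon>: "0 < \<epsilon>" and \<delta>: "0 \<le> \<delta>" and R: "0 \<le> R"
    and W: "\<And>x. x \<notin> F \<Longrightarrow> \<forall>y. norm (W x y) \<le> M"
    and K: "\<And>x. x \<notin> F \<Longrightarrow> green (W x) C \<epsilon> (K x)"
    and close: "\<And>x y. x \<notin> F \<Longrightarrow> pd y x \<le> R \<Longrightarrow> norm (v y - W x y) \<le> \<delta>"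
  shows "\<exists>B E. (\<forall>x y. norm (B x y) \<le> C) \<and> (\<forall>x z. norm (E x z) \<le>
      vol step * C * exp (\<epsilon> * step) * (\<delta> + (1 + M) * exp (- (\<epsilon> / 2) * R)) * exp (- (\<epsilon> / 2) * pd x z)) \<and>
    (\<forall>u x. app R B (schr adj v u) x = app (R + step) E u x + (if x \<in> F then 0 else u x))"
proof -
  define \<eta> where "\<eta> = vol step * C * exp (\<epsilon> * step) * (\<delta> + (1 + M) * exp (- (\<epsilon> / 2) * R))"
  have M: "0 \<le> M" using v norm_ge_zero order_trans by blast
  have \<eta>: "0 \<le> \<eta>" unfolding \<eta>_def using vol_nonneg C \<delta> M by simp
  define B where "B x y = (if x \<in> F then 0 else K x x y)" for x y
  \<comment> \<open>The kernel of the composition. Off \<open>F\<close>, \<open>E\<close> is its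
    deviation from the identity; rows in \<open>F\<close> are 0 in \<open>B\<close>, hence in
    \<open>P\<close> and \<open>E\<close>.\<close>
  define P where "P x z = (\<Sum>y\<in>nbh R x. B x y * hmat v y z)" for x z
  define E where "E x z = (if x \<in> F then 0 else P x z - (if x = z then 1 else 0))" for x z
  have KC: "norm (K x x' y) \<le> C * exp (- \<epsilon> * pd x' y)" if "x \<notin> F" for x x' y
    using K[OF that] by (simp add: green_def)
  have "norm (B x y) \<le> C" for x y
  proof (cases "x \<in> F")
    case False
    have "C * exp (- \<epsilon> * pd x y) \<le> C * 1" using C \<epsilon> by (intro mult_left_mono) auto
    then show ?thesis using KC[OF False, of x y] False by (simp add: B_def)
  qed (use C in \<open>simp add: B_def\<close>)
  moreover have "norm (E x z) \<le> \<eta> * exp (- (\<epsilon> / 2) * pd x z)" for x z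
  proof (cases "x \<in> F")
    case False
    \<comment> \<open>Seen from \<open>z\<close> with transposed matrices, row \<open>x\<close>
      becomes a truncated column about the centre \<open>x\<close>, to which the truncation estimate
      applies.\<close>
    have P: "P x z = (\<Sum>y\<in>nbh step z. hmat v y z * (if pd y x \<le> R then K x x y else 0))"
    proof -
      have "P x z = (\<Sum>y\<in>nbh R x \<inter> nbh step z. B x y * hmat v y z)"
        unfolding P_def by (intro sum.mono_neutral_right) (auto simp: nbh_iff pd_sym[of z] not_le intro: hmat_eq_0)
      also have "\<dots> = (\<Sum>y\<in>nbh step z. if pd y x \<le> R then B x y * hmat v y z else 0)"
        by (intro sum.mono_neutral_cong_left) (auto simp: nbh_iff pd_sym[of x])
      finally show ?thesis using False by (auto simp: B_def intro!: sum.cong)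
    qed
    have "norm ((\<Sum>y\<in>nbh step z. hmat v y z * (if pd y x \<le> R then K x x y else 0)) - (if z = x then 1 else 0))
      \<le> \<eta> * exp (- (\<epsilon> / 2) * pd z x)"
      unfolding \<eta>_def
    proof (rule truncation_residual[OF C \<epsilon> \<delta>, where a = "\<lambda>z y. hmat v y z" and a' = "\<lambda>z y. hmat (W x) y z"])
      show "norm (K x x y) \<le> C * exp (- \<epsilon> * pd y x)" for y
        using KC[OF False, of x y] by (simp add: pd_sym)
      show "norm (hmat (W x) y' z') \<le> 1 + M" for z' y' by (rule norm_hmat_le[OF W[OF False]])
      show "(\<Sum>y\<in>nbh step z. hmat (W x) y z * K x x y) = (if z = x then 1 else 0)"
        using K[OF False] by (auto simp: green_def)
      show "norm (hmat v y z - hmat (W x) y z) \<le> \<delta>" if "pd y x \<le> R" for y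
        using close[OF False that] \<delta> by (auto simp: hmat_diff)
    qed (use M in simp)
    then show ?thesis using False by (simp add: E_def P pd_sym eq_commute[of x])
  qed (use \<eta> in \<open>simp add: E_def\<close>)
  moreover have "app R B (schr adj v u) x = app (R + step) E u x + (if x \<in> F then 0 else u x)" for u x
  proof -
    have "app R B (schr adj v u) x = app (R + step) P u x"
      unfolding schr_eq_app P_def by (rule app_app) (rule hmat_eq_0)
    also have "\<dots> = (\<Sum>z\<in>nbh (R + step) x. E x z * u z + (if z = x then (if x \<in> F then 0 else u x) else 0))"
      unfolding app_def
    proof (intro sum.cong refl)
      fix z
      have "P x z = 0" if "x \<in> F" using that by (simp add: P_def B_def)
      then show "P x z * u z = E x z * u z + (if z = x then (if x \<in> F then 0 else u x) else 0)"
        by (auto simp: E_def algebra_simps)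
    qed
    also have "\<dots> = app (R + step) E u x + (if x \<in> nbh (R + step) x then (if x \<in> F then 0 else u x) else 0)"
      by (simp add: sum.distrib app_def)
    also have "\<dots> = app (R + step) E u x + (if x \<in> F then 0 else u x)"
      using R step_nonneg by (simp add: nbh_iff)
    finally show ?thesis .
  qed
  ultimately show ?thesis unfolding \<eta>_def by blast
qed

lemma right_parametrix:
  assumes v: "\<forall>x. norm (v x) \<le> M" and C: "0 \<le> C" and \<epsilon>: "0 < \<epsilon>" and \<delta>: "0 \<le> \<delta>" and R: "0 \<le> R"
    and W: "\<And>z. z \<notin> F \<Longrightarrow> \<forall>y. norm (W z y) \<le> M"
    and K: "\<And>z. z \<notin> F \<Longrightarrow> green (W z) C \<epsilon> (K z)"
    and close: "\<And>z y. z \<notin> F \<Longrightarrow> pd y z \<le> R \<Longrightarrow> norm (v y - W z y) \<le> \<delta>"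
  shows "\<exists>B E. (\<forall>x y. norm (B x y) \<le> C) \<and> (\<forall>x z. norm (E x z) \<le>
      vol step * C * exp (\<epsilon> * step) * (\<delta> + (1 + M) * exp (- (\<epsilon> / 2) * R)) * exp (- (\<epsilon> / 2) * pd x z)) \<and>
    (\<forall>u x. schr adj v (app R B u) x = app (step + R) E u x + (if x \<in> F then 0 else u x))"
proof -
  define \<eta> where "\<eta> = vol step * C * exp (\<epsilon> * step) * (\<delta> + (1 + M) * exp (- (\<epsilon> / 2) * R))"
  have M: "0 \<le> M" using v norm_ge_zero order_trans by blast
  have \<eta>: "0 \<le> \<eta>" unfolding \<eta>_def using vol_nonneg C \<delta> M by simp
  \<comment> \<open>Here the truncation at \<open>R\<close> is written into \<open>B\<close>: it is
    the inner factor of the composition and must vanish beyond \<open>R\<close>. In the left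
    parametrix the outer sum truncates.\<close>
  define B where "B y z = (if z \<in> F then 0 else if pd y z \<le> R then K z y z else 0)" for y z
  define P where "P x z = (\<Sum>y\<in>nbh step x. hmat v x y * B y z)" for x z
  define E where "E x z = (if z \<in> F then 0 else P x z - (if x = z then 1 else 0))" for x z
  have KC: "norm (K z x' y) \<le> C * exp (- \<epsilon> * pd x' y)" if "z \<notin> F" for z x' y
    using K[OF that] by (simp add: green_def)
  have "norm (B x z) \<le> C" for x z
  proof (cases "z \<in> F")
    case False
    have "C * exp (- \<epsilon> * pd x z) \<le> C * 1" using C \<epsilon> by (intro mult_left_mono) auto
    then show ?thesis using KC[OF False, of x z] False C by (simp add: B_def)
  qed (use C in \<open>simp add: B_def\<close>)
  moreover have "norm (E x z) \<le> \<eta> * exp (- (\<epsilon> / 2) * pd x z)" for x z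
  proof (cases "z \<in> F")
    case False
    have P: "P x z = (\<Sum>y\<in>nbh step x. hmat v x y * (if pd y z \<le> R then K z y z else 0))"
      using False by (simp add: P_def B_def)
    have "norm ((\<Sum>y\<in>nbh step x. hmat v x y * (if pd y z \<le> R then K z y z else 0)) - (if x = z then 1 else 0))
      \<le> \<eta> * exp (- (\<epsilon> / 2) * pd x z)"
      unfolding \<eta>_def
    proof (rule truncation_residual[OF C \<epsilon> \<delta>, where a = "hmat v" and a' = "hmat (W z)"])
      show "norm (K z y z) \<le> C * exp (- \<epsilon> * pd y z)" for y using KC[OF False] .
      show "norm (hmat (W z) y' z') \<le> 1 + M" for y' z' by (rule norm_hmat_le[OF W[OF False]])
      show "(\<Sum>y\<in>nbh step x. hmat (W z) x y * K z y z) = (if x = z then 1 else 0)"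
        using K[OF False] by (simp add: green_def)
      show "norm (hmat v x y - hmat (W z) x y) \<le> \<delta>" if "pd y z \<le> R" for y
        using close[OF False that] \<delta> by (auto simp: hmat_diff)
    qed (use M in simp)
    then show ?thesis using False by (simp add: E_def P)
  qed (use \<eta> in \<open>simp add: E_def\<close>)
  moreover have "schr adj v (app R B u) x = app (step + R) E u x + (if x \<in> F then 0 else u x)" for u x
  proof -
    have "schr adj v (app R B u) x = app (step + R) P u x"
      unfolding schr_eq_app P_def by (rule app_app) (simp add: B_def)
    also have "\<dots> = (\<Sum>z\<in>nbh (step + R) x. E x z * u z + (if z = x then (if x \<in> F then 0 else u x) else 0))"
      unfolding app_def
    proof (intro sum.cong refl)
      fix z
      have "P x z = 0" if "z \<in> F" using that by (simp add: P_def B_def)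
      then show "P x z * u z = E x z * u z + (if z = x then (if x \<in> F then 0 else u x) else 0)"
        by (auto simp: E_def algebra_simps)
    qed
    also have "\<dots> = app (step + R) E u x + (if x \<in> nbh (step + R) x then (if x \<in> F then 0 else u x) else 0)"
      by (simp add: sum.distrib app_def)
    also have "\<dots> = app (step + R) E u x + (if x \<in> F then 0 else u x)"
      using R step_nonneg by (simp add: nbh_iff)
    finally show ?thesis .
  qed
  ultimately show ?thesis unfolding \<eta>_def by blast
qed

section \<open>Lower bounds uniform over the limit operators, and approximation of the potential far
  away\<close>

lemma small_residual:
  assumes "0 \<le> C" "0 < \<epsilon>" "0 \<le> M" "0 \<le> S"
  obtains \<delta> R where "0 < \<delta>" "0 \<le> R"
    "vol step * C * exp (\<epsilon> * step) * (\<delta> + (1 + M) * exp (- (\<epsilon> / 2) * R)) * S \<le> 1 / 2"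
proof -
  define A where "A = vol step * C * exp (\<epsilon> * step)"
  have A: "0 \<le> A" using assms vol_nonneg by (simp add: A_def)
  \<comment> \<open>This keeps \<open>A * S * \<delta>\<close> below 1/4; with \<open>R\<close> so
    large that the truncation term is at most \<open>\<delta>\<close> too, the total is at most
    1/2.\<close>
  define \<delta> where "\<delta> = 1 / (4 * (A * S + 1))"
  have AS: "0 \<le> A * S" using A assms by simp
  have "0 < A * S + 1" using AS by linarith
  then have \<delta>: "0 < \<delta>" unfolding \<delta>_def by simp
  obtain R where R: "0 \<le> R" "(1 + M) * exp (- (\<epsilon> / 2) * R) \<le> \<delta>"
    using exp_decay_small[of "1 + M" "\<epsilon> / 2" \<delta>] assms \<delta> by auto
  have "A * (\<delta> + (1 + M) * exp (- (\<epsilon> / 2) * R)) * S \<le> A * (\<delta> + \<delta>) * S"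
    using R assms A by (intro mult_right_mono mult_left_mono) auto
  also have "\<dots> = 2 * \<delta> * (A * S)" by simp
  also have "\<dots> \<le> 1 / 2" using AS by (simp add: \<delta>_def field_simps)
  finally show thesis using that[OF \<delta> R(1)] by (simp add: A_def)
qed

text \<open>A left parametrix built from the operator's own Green function, with no exceptional
  points, recovers \<open>u\<close> up to a residual of at most half its norm, which is absorbed.
  This carries invertibility on \<open>lp p0\<close> to a lower bound on
  \<open>lp \<infinity>\<close> while using finite sums only.\<close>

lemma green_imp_bounded_below:
  assumes w: "\<forall>x. norm (w x) \<le> M" and C: "0 \<le> C" and \<epsilon>: "0 < \<epsilon>" and K: "green w C \<epsilon> K"
  obtains c where "\<And>u. u \<in> lp \<infinity> \<Longrightarrow> lp_norm \<infinity> u \<le> c * lp_norm \<infinity> (schr adj w u)"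
proof -
  have M: "0 \<le> M" using w norm_ge_zero order_trans by blast
  obtain S where S: "0 \<le> S" "\<And>x T. finite T \<Longrightarrow> (\<Sum>y\<in>T. exp (- (\<epsilon> / 2) * pd x y)) \<le> S"
    using exp_pd_sum_bounded[of "\<epsilon> / 2"] \<epsilon> by (metis half_gt_zero)
  obtain \<delta> R where \<delta>: "0 < \<delta>" and R: "0 \<le> R"
    and small: "vol step * C * exp (\<epsilon> * step) * (\<delta> + (1 + M) * exp (- (\<epsilon> / 2) * R)) * S \<le> 1 / 2"
    using small_residual[OF C \<epsilon> M S(1)] .
  define \<eta> where "\<eta> = vol step * C * exp (\<epsilon> * step) * (\<delta> + (1 + M) * exp (- (\<epsilon> / 2) * R))"
  have \<eta>: "0 \<le> \<eta>" unfolding \<eta>_def using vol_nonneg C \<delta> M by simp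
  obtain B E where B: "\<And>x y. norm (B x y) \<le> C"
    and E: "\<And>x z. norm (E x z) \<le> \<eta> * exp (- (\<epsilon> / 2) * pd x z)"
    and BA: "\<And>u x. app R B (schr adj w u) x = app (R + step) E u x + (if x \<in> {} then 0 else u x)"
    using left_parametrix[where F = "{}" and W = "\<lambda>_. w" and K = "\<lambda>_. K",
        OF w C \<epsilon> less_imp_le[OF \<delta>] R w K, folded \<eta>_def] \<delta> by force
  have "lp_norm \<infinity> u \<le> 2 * (C * vol R) * lp_norm \<infinity> (schr adj w u)" if u: "u \<in> lp \<infinity>" for u
  proof -
    define r where "r = lp_norm \<infinity> u"
    have p: "1 \<le> (\<infinity>::ereal)" by simp
    have ru: "lp_le \<infinity> r u" unfolding r_def by (rule lp_le_lp_norm[OF u])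
    have r: "0 \<le> r" by (rule lp_le_nonneg[OF p ru])
    have Au: "schr adj w u \<in> lp \<infinity>" by (rule lp_le_imp_lp[OF schr_lp_le[OF p ru w]])
    have "lp_le \<infinity> (C * vol R * lp_norm \<infinity> (schr adj w u) + \<eta> * S * r)
       (\<lambda>x. app R B (schr adj w u) x - app (R + step) E u x)"
      by (intro lp_le_diff p app_lp_le lp_le_lp_norm Au B app_exp_lp_le[OF p ru \<eta> E S(2)])
    also have "(\<lambda>x. app R B (schr adj w u) x - app (R + step) E u x) = u"
      by (simp add: BA)
    finally have "r \<le> C * vol R * lp_norm \<infinity> (schr adj w u) + \<eta> * S * r"
      unfolding r_def by (rule lp_leD)
    moreover have "\<eta> * S * r \<le> 1 / 2 * r"
      using small r unfolding \<eta>_def by (rule mult_right_mono)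
    ultimately show ?thesis by (simp add: r_def)
  qed
  then show thesis by (rule that)
qed

text \<open>A sequence of limit operators violating the bound is translated so that the almost-kernel functions are
  large at one of the finitely many orbit representatives; a pointwise limit then has a kernel.\<close>

lemma uniformly_bounded_below:
  assumes v: "\<forall>x. norm (v x) \<le> M"
    and each: "\<And>w. w \<in> lim_pot v \<Longrightarrow> \<exists>c. \<forall>u\<in>lp \<infinity>. lp_norm \<infinity> u \<le> c * lp_norm \<infinity> (schr adj w u)"
  obtains c where "0 \<le> c"
    "\<And>w u. w \<in> lim_pot v \<Longrightarrow> u \<in> lp \<infinity> \<Longrightarrow> lp_norm \<infinity> u \<le> c * lp_norm \<infinity> (schr adj w u)"
proof -
  have p: "1 \<le> (\<infinity>::ereal)" by simp
  have "\<exists>n::nat. \<forall>w\<in>lim_pot v. \<forall>u\<in>lp \<infinity>. lp_norm \<infinity> u \<le> real (Suc n) * lp_norm \<infinity> (schr adj w u)"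
  proof (rule ccontr)
    assume neg: "\<not> ?thesis"
    \<comment> \<open>Which representative carries the large value may vary with \<open>n\<close>;
      the sum over all of them is one expression that passes to pointwise limits.\<close>
    define Q where "Q n W U \<longleftrightarrow> W \<in> lim_pot v \<and> (\<forall>x. norm (U x) \<le> 1) \<and>
      1 / 2 \<le> (\<Sum>d\<in>range rep. norm (U d)) \<and> (\<forall>x. norm (schr adj W U x) \<le> inverse (real (Suc n)))"
      for n :: nat and W U :: "'a \<Rightarrow> complex"
    have "\<exists>W U. Q n W U" for n
    proof -
      obtain w u where w: "w \<in> lim_pot v" and u: "u \<in> lp \<infinity>"
        and less: "real (Suc n) * lp_norm \<infinity> (schr adj w u) < lp_norm \<infinity> u"
        using neg by (meson linorder_not_le)
      have wM: "\<forall>x. norm (w x) \<le> M" by (rule lim_pot_bound[OF v w])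
      define t where "t = lp_norm \<infinity> u"
      have ut: "lp_le \<infinity> t u" unfolding t_def by (rule lp_le_lp_norm[OF u])
      have Au: "schr adj w u \<in> lp \<infinity>" by (rule lp_le_imp_lp[OF schr_lp_le[OF p ut wM]])
      have "0 \<le> real (Suc n) * lp_norm \<infinity> (schr adj w u)"
        by (intro mult_nonneg_nonneg lp_norm_nonneg[OF p Au]) simp
      then have t: "0 < t" using less by (simp add: t_def)
      \<comment> \<open>The supremum need not be attained, so a point exceeding half of it is
        taken.\<close>
      obtain x0 where x0: "t / 2 < norm (u x0)"
      proof (rule ccontr)
        assume "\<not> thesis"
        then have "lp_le \<infinity> (t / 2) u" using that by (force simp: lp_le_infty not_less)
        then show False using t lp_leD(2)[of \<infinity> "t / 2" u] by (simp add: t_def)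
      qed
      define a where "a = coord x0"
      define U where "U x = inverse (of_real t) * u (act a x)" for x
      define W where "W x = w (act a x)" for x
      have "W \<in> lim_pot v" unfolding W_def by (rule lim_pot_act[OF w])
      moreover have "norm (U x) \<le> 1" for x
        using lp_le_at[OF p ut, of "act a x"] t by (simp add: U_def norm_mult norm_inverse norm_divide field_simps)
      moreover have "1 / 2 \<le> (\<Sum>d\<in>range rep. norm (U d))"
      proof -
        have "1 / 2 \<le> norm (U (rep x0))"
          using x0 t by (simp add: U_def a_def norm_mult norm_inverse norm_divide field_simps)
        also have "\<dots> \<le> (\<Sum>d\<in>range rep. norm (U d))"
          using finite_rep by (intro member_le_sum) auto
        finally show ?thesis .
      qed
      moreover have "norm (schr adj W U x) \<le> inverse (real (Suc n))" for x
      proof -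
        have "schr adj W (\<lambda>x. u (act a x)) x = schr adj w u (act a x)"
          unfolding W_def shift_schr[symmetric] by (simp add: shift_def)
        then have "schr adj W U x = inverse (of_real t) * schr adj w u (act a x)"
          unfolding U_def schr_eq_app app_scale by simp
        then have "norm (schr adj W U x) = norm (schr adj w u (act a x)) / t"
          using t by (simp add: norm_mult norm_inverse divide_inverse mult.commute)
        also have "\<dots> \<le> lp_norm \<infinity> (schr adj w u) / t"
          using lp_le_at[OF p lp_le_lp_norm[OF Au]] t by (intro divide_right_mono) auto
        also have "\<dots> \<le> inverse (real (Suc n))"
          using less t by (simp add: t_def field_simps)
        finally show ?thesis .
      qed
      ultimately show ?thesis unfolding Q_def by blast
    qed
    then obtain W U where "\<And>n. Q n (W n) (U n)" by metis
    then have W: "\<And>n. W n \<in> lim_pot v" and U1: "\<And>n x. norm (U n x) \<le> 1"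
      and Ud: "\<And>n. 1 / 2 \<le> (\<Sum>d\<in>range rep. norm (U n d))"
      and AU: "\<And>n x. norm (schr adj (W n) (U n) x) \<le> inverse (real (Suc n))"
      unfolding Q_def by blast+
    obtain s U' where s: "strict_mono s" and U': "\<And>x. (\<lambda>n. U (s n) x) \<longlonglongrightarrow> U' x"
      using bounded_subseq_pointwise[of U 1] U1 by blast
    have "norm (W (s n) x) \<le> M" for n x using lim_pot_bound[OF v W] by blast
    then obtain t W' where t: "strict_mono t" and W': "\<And>x. (\<lambda>n. W (s (t n)) x) \<longlonglongrightarrow> W' x"
      using bounded_subseq_pointwise[of "\<lambda>n. W (s n)" M] by blast
    have U'': "(\<lambda>n. U (s (t n)) x) \<longlonglongrightarrow> U' x" for x
      using LIMSEQ_subseq_LIMSEQ[OF U' t] by (simp add: o_def)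
    have st: "strict_mono (\<lambda>n. s (t n))" using s t by (simp add: strict_mono_def)
    have W'lim: "W' \<in> lim_pot v" by (rule lim_pot_closed[OF W W'])
    have "schr adj W' U' x = 0" for x
    proof (rule LIMSEQ_unique)
      show "(\<lambda>n. schr adj (W (s (t n))) (U (s (t n))) x) \<longlonglongrightarrow> schr adj W' U' x"
        unfolding schr_eq_app
      proof (intro app_tendsto U'')
        show "(\<lambda>n. hmat (W (s (t n))) x y) \<longlonglongrightarrow> hmat W' x y" for y
          using W' by (simp add: hmat_def)
      qed
      show "(\<lambda>n. schr adj (W (s (t n))) (U (s (t n))) x) \<longlonglongrightarrow> 0"
      proof (rule Lim_null_comparison)
        show "\<forall>\<^sub>F n in sequentially. norm (schr adj (W (s (t n))) (U (s (t n))) x) \<le> inverse (real (Suc (s (t n))))"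
          using AU by simp
        show "(\<lambda>n. inverse (real (Suc (s (t n))))) \<longlonglongrightarrow> 0"
          using LIMSEQ_subseq_LIMSEQ[OF LIMSEQ_inverse_real_of_nat st] by (simp add: o_def)
      qed
    qed
    then have zero: "schr adj W' U' = (\<lambda>x. 0)" by auto
    have U'le: "lp_le \<infinity> 1 U'"
      by (rule lp_le_lim[OF p _ U']) (simp add: lp_le_infty U1)
    obtain c where "lp_norm \<infinity> U' \<le> c * lp_norm \<infinity> (schr adj W' U')"
      using each[OF W'lim] lp_leD(1)[OF U'le] by blast
    then have "lp_norm \<infinity> U' \<le> 0" unfolding zero by (simp add: lp_norm_def)
    then have "lp_le \<infinity> 0 U'" using lp_leD(1)[OF U'le] by (simp add: lp_le_def)
    then have U'0: "U' x = 0" for x by (rule lp_le_0_imp_eq_0[OF p])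
    have "(\<lambda>n. \<Sum>d\<in>range rep. norm (U (s n) d)) \<longlonglongrightarrow> (\<Sum>d\<in>range rep. norm (U' d))"
      by (intro tendsto_intros U')
    then have "1 / 2 \<le> (\<Sum>d\<in>range rep. norm (U' d))"
      by (rule tendsto_lowerbound) (use Ud in auto)
    then show False by (simp add: U'0)
  qed
  then obtain n :: nat where "\<forall>w\<in>lim_pot v. \<forall>u\<in>lp \<infinity>. lp_norm \<infinity> u \<le> real (Suc n) * lp_norm \<infinity> (schr adj w u)"
    by blast
  then show thesis by (intro that[of "real (Suc n)"]) auto
qed

text \<open>Infinitely many bad points would include infinitely many in one orbit, hence an
  injective sequence of translations. A subsequence of the translated potentials converges to a
  limit potential, uniformly on the finite ball about the representative, and translating that limit
  back approximates \<open>v\<close> near a bad point.\<close>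

lemma approximate_by_lim_pot:
  assumes v: "\<forall>x. norm (v x) \<le> M" and \<delta>: "0 < \<delta>"
  shows "finite {y. \<not> (\<exists>w\<in>lim_pot v. \<forall>x. pd x y \<le> R \<longrightarrow> norm (v x - w x) \<le> \<delta>)}" (is "finite ?Bad")
proof (rule ccontr)
  assume inf: "infinite ?Bad"
  define Bad where "Bad = ?Bad"
  have Bad: "Bad = (\<Union>d\<in>range rep. {y\<in>Bad. rep y = d})" by auto
  have "\<exists>d\<in>range rep. infinite {y\<in>Bad. rep y = d}"
  proof (rule ccontr)
    assume "\<not> ?thesis"
    then have "finite (\<Union>d\<in>range rep. {y\<in>Bad. rep y = d})" by (intro finite_UN_I finite_rep) blast
    then have "finite Bad" by (subst Bad)
    with inf show False unfolding Bad_def by contradiction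
  qed
  then obtain d where "infinite {y\<in>Bad. rep y = d}" by blast
  then obtain y :: "nat \<Rightarrow> 'a" where y: "inj y" "range y \<subseteq> {y\<in>Bad. rep y = d}"
    using infinite_countable_subset by blast
  have rep_y: "rep (y k) = d" and bad: "y k \<in> Bad" for k using y(2) by auto
  define h where "h k = coord (y k)" for k
  have yh: "y k = act (h k) d" for k
    using act_coord_rep[of "y k"] by (simp add: h_def rep_y)
  have "inj h"
  proof (rule injI)
    fix i j assume "h i = h j"
    then have "y i = y j" by (simp add: yh)
    with y(1) show "i = j" by (rule injD)
  qed
  then have "tends_to_infinity h" by (rule tends_to_infinity_inj)
  then obtain k w where k: "strict_mono k" and w: "w \<in> lim_pot v"
    and l: "\<And>x. (\<lambda>m. v (act (h (k m)) x)) \<longlonglongrightarrow> w x"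
    using lim_pot_subseq[OF v] by blast
  have "\<forall>\<^sub>F m in sequentially. \<forall>x\<in>nbh R d. dist (v (act (h (k m)) x)) (w x) < \<delta>"
    using \<delta> by (intro eventually_ball_finite ballI tendstoD[OF l]) auto
  then obtain m where m: "\<And>x. x \<in> nbh R d \<Longrightarrow> dist (v (act (h (k m)) x)) (w x) < \<delta>"
    using eventually_happens'[OF sequentially_bot] by blast
  define a where "a = h (k m)"
  have "norm (v x - w (act (- a) x)) \<le> \<delta>" if x: "pd x (y (k m)) \<le> R" for x
  proof -
    have "pd (act (- a) x) d = pd (act a (act (- a) x)) (act a d)" by (simp only: pd_act)
    also have "\<dots> = pd x (y (k m))" by (simp add: yh a_def)
    finally have "act (- a) x \<in> nbh R d" using x by (simp add: nbh_iff pd_sym)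
    from m[OF this] show ?thesis by (simp add: a_def dist_norm)
  qed
  then have "\<forall>x. pd x (y (k m)) \<le> R \<longrightarrow> norm (v x - w (act (- a) x)) \<le> \<delta>" by simp
  then have "\<exists>w\<in>lim_pot v. \<forall>x. pd x (y (k m)) \<le> R \<longrightarrow> norm (v x - w x) \<le> \<delta>"
    by (rule bexI[OF _ lim_pot_act[OF w]])
  then show False using bad[of "k m"] unfolding Bad_def mem_Collect_eq by contradiction
qed

section \<open>From parametrices to the Fredholm property\<close>

lemma solve_perturbed_identity:
  assumes p: "1 \<le> p" and E: "\<And>r u. lp_le p r u \<Longrightarrow> lp_le p (r / 2) (app R E u)"
    and f: "lp_le p r f"
  obtains s where "lp_le p (2 * r) s" "\<And>x. s x + app R E s x = f x"
proof -
  \<comment> \<open>Terms of the Neumann series. It is summed pointwise, and Fatou's lemma puts the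
    sum into the ball of radius \<open>2 * r\<close>; the band structure of \<open>app R E\<close>
    carries the recursion of the partial sums to the limit, for \<open>p = \<infinity>\<close> as
    well.\<close>
  define d where "d n = ((\<lambda>u x. - app R E u x) ^^ n) f" for n
  have d0: "d 0 = f" and dS: "d (Suc n) = (\<lambda>x. - app R E (d n) x)" for n by (auto simp: d_def)
  have r: "0 \<le> r" using lp_le_nonneg[OF p f] .
  have dn: "lp_le p (r * (1 / 2) ^ n) (d n)" for n
  proof (induction n)
    case 0
    then show ?case using f by (simp add: d0)
  next
    case (Suc n)
    from lp_le_mono[OF p E[OF Suc], of "d (Suc n)" "r * (1 / 2) ^ Suc n"]
    show ?case by (simp add: dS)
  qed
  define s where "s n x = (\<Sum>k<n. d k x)" for n x
  have geo: "(\<Sum>k<n. r * (1 / 2) ^ k) \<le> 2 * r" for n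
  proof -
    have "(\<Sum>k<n. (1 / 2 :: real) ^ k) \<le> (\<Sum>k. (1 / 2) ^ k)"
      by (intro sum_le_suminf summable_geometric) auto
    also have "\<dots> = 2" by (simp add: suminf_geometric)
    finally show ?thesis using r by (simp add: sum_distrib_left[symmetric] mult_left_mono mult.commute[of 2])
  qed
  have sn: "lp_le p (2 * r) (s n)" for n
  proof -
    have "lp_le p (\<Sum>k<n. r * (1 / 2) ^ k) (s n)"
      unfolding s_def by (intro lp_le_sum p dn) simp
    then show ?thesis by (rule lp_le_mono[OF p _ order_refl geo])
  qed
  have "summable (\<lambda>n. d n x)" for x
  proof (rule summable_comparison_test')
    show "summable (\<lambda>n. r * (1 / 2) ^ n)" by (intro summable_mult summable_geometric) simp
    show "norm (d n x) \<le> r * (1 / 2) ^ n" for n by (rule lp_le_at[OF p dn])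
  qed
  then have lim: "(\<lambda>n. s n x) \<longlonglongrightarrow> (\<Sum>n. d n x)" for x
    unfolding s_def by (rule summable_LIMSEQ)
  define t where "t x = (\<Sum>n. d n x)" for x
  have lim: "(\<lambda>n. s n x) \<longlonglongrightarrow> t x" for x using lim by (simp add: t_def)
  have step_eq: "s (Suc n) x = f x - app R E (s n) x" for n x
  proof -
    have "s (Suc n) x = f x + (\<Sum>k<n. - app R E (d k) x)"
      unfolding s_def sum.lessThan_Suc_shift d0 dS ..
    also have "(\<Sum>k<n. - app R E (d k) x) = - app R E (s n) x"
      unfolding s_def using fun_cong[OF app_sum[of R E d "{..<n}"], of x] by (simp add: sum_negf)
    finally show ?thesis by simp
  qed
  have "t x + app R E t x = f x" for x
  proof -
    have "(\<lambda>n. f x - app R E (s n) x) \<longlonglongrightarrow> f x - app R E t x"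
      by (intro tendsto_intros app_tendsto lim)
    moreover have "(\<lambda>n. f x - app R E (s n) x) \<longlonglongrightarrow> t x"
      using LIMSEQ_Suc[OF lim[of x]] by (simp add: step_eq)
    ultimately have "t x = f x - app R E t x" by (rule LIMSEQ_unique[rotated])
    then show ?thesis by simp
  qed
  moreover have "lp_le p (2 * r) t"
    by (rule lp_le_lim[OF p _ lim]) (simp add: sn)
  ultimately show thesis by (intro that)
qed

text \<open>A kernel element vanishing on \<open>F\<close> satisfies \<open>u = - app R E u\<close>,
  where the right side has at most half the norm, hence is 0. So kernel elements are determined by
  their values on \<open>F\<close>.\<close>

lemma left_parametrix_imp_kernel_finite:
  assumes p: "1 \<le> p" and F: "finite F"
    and E: "\<And>r u. lp_le p r u \<Longrightarrow> lp_le p (r / 2) (app R E u)"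
    and BA: "\<And>u x. app Q B (schr adj v u) x = app R E u x + (if x \<in> F then 0 else u x)"
  shows "\<exists>B. finite B \<and> B \<subseteq> lp p \<and> {u\<in>lp p. schr adj v u = (\<lambda>x. 0)} \<subseteq> cspan B"
proof -
  let ?N = "{u\<in>lp p. schr adj v u = (\<lambda>x. 0)}"
  have "\<exists>B. finite B \<and> B \<subseteq> ?N \<and> ?N \<subseteq> cspan B"
  proof (rule determined_by_finite_imp_finite_span[OF F])
    show "(\<lambda>x. u x + c * w x) \<in> ?N" if "u \<in> ?N" "w \<in> ?N" for u w c
      using that by (auto simp: schr_eq_app app_linear intro!: lp_add lp_scale p)
    show "u = (\<lambda>x. 0)" if u: "u \<in> ?N" and uF: "\<And>x. x \<in> F \<Longrightarrow> u x = 0" for u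
    proof -
      have "app R E u x + u x = 0" for x
        using BA[of u x] u uF by (cases "x \<in> F") (auto simp: app_def)
      then have eq: "u x = - app R E u x" for x by (metis add.commute eq_neg_iff_add_eq_0)
      have "lp_le p (lp_norm p u) u" using u by (intro lp_le_lp_norm) simp
      from lp_le_mono[OF p E[OF this], of u "lp_norm p u / 2"]
      have "lp_le p (lp_norm p u / 2) u" using eq by (metis norm_minus_cancel order_refl)
      then have "lp_norm p u \<le> 0" using lp_leD(2) by fastforce
      then have "lp_le p 0 u" using u by (simp add: lp_le_def)
      then show ?thesis by (intro ext lp_le_0_imp_eq_0[OF p])
    qed
  qed
  then show ?thesis by blast
qed

text \<open>The identity plus \<open>app R E\<close> is onto, so every function is an element of the
  range plus the restriction of some \<open>s\<close> to \<open>F\<close>. For closedness, this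
  splitting reduces the claim to range elements supported in the finite set \<open>F\<close>, where
  subspaces are closed.\<close>

lemma right_parametrix_imp_range:
  assumes p: "1 \<le> p" and F: "finite F" and v: "bounded (range v)"
    and E: "\<And>r u. lp_le p r u \<Longrightarrow> lp_le p (r / 2) (app R E u)"
    and B: "\<And>u. u \<in> lp p \<Longrightarrow> app Q B u \<in> lp p"
    and AB: "\<And>u x. schr adj v (app Q B u) x = app R E u x + (if x \<in> F then 0 else u x)"
  shows "\<exists>B. finite B \<and> B \<subseteq> lp p \<and> lp p \<subseteq> {(\<lambda>x. a x + b x) | a b. a \<in> schr adj v ` lp p \<and> b \<in> cspan B}"
    and "(\<And>k. f k \<in> schr adj v ` lp p) \<Longrightarrow> g \<in> lp p \<Longrightarrow>
      (\<lambda>k. lp_norm p (\<lambda>x. f k x - g x)) \<longlonglongrightarrow> 0 \<Longrightarrow> g \<in> schr adj v ` lp p"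
proof -
  define PF where "PF s x = (if x \<in> F then s x else 0)" for s :: "'a \<Rightarrow> complex" and x
  have decomp: "(\<lambda>x. s x + app R E s x) = (\<lambda>x. schr adj v (app Q B s) x + PF s x)" for s
    by (auto simp: AB PF_def fun_eq_iff)
  have Alin: "(\<lambda>x. u x + c * w x) \<in> schr adj v ` lp p"
    if "u \<in> schr adj v ` lp p" "w \<in> schr adj v ` lp p" for u w c
  proof -
    obtain u' w' where "u = schr adj v u'" "w = schr adj v w'" "u' \<in> lp p" "w' \<in> lp p"
      using \<open>u \<in> schr adj v ` lp p\<close> \<open>w \<in> schr adj v ` lp p\<close> by blast
    then show ?thesis
      by (intro image_eqI[of _ _ "\<lambda>x. u' x + c * w' x"]) (auto simp: schr_eq_app app_linear intro!: lp_add lp_scale p)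
  qed
  define \<delta> where "\<delta> y = (\<lambda>x. if x = y then 1 else 0 :: complex)" for y :: 'a
  have \<delta>_inj: "inj_on \<delta> F" by (rule inj_onI) (metis \<delta>_def zero_neq_one)
  show "\<exists>B. finite B \<and> B \<subseteq> lp p \<and> lp p \<subseteq> {(\<lambda>x. a x + b x) | a b. a \<in> schr adj v ` lp p \<and> b \<in> cspan B}"
  proof (intro exI[of _ "\<delta> ` F"] conjI subsetI)
    show "finite (\<delta> ` F)" using F by simp
    show "u \<in> lp p" if "u \<in> \<delta> ` F" for u
      using that lp_le_imp_lp[OF lp_le_single[OF p]] by (auto simp: \<delta>_def)
    fix f :: "'a \<Rightarrow> complex" assume "f \<in> lp p"
    then obtain s where s: "lp_le p (2 * lp_norm p f) s" "\<And>x. s x + app R E s x = f x"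
      using solve_perturbed_identity[OF p E lp_le_lp_norm] by blast
    \<comment> \<open>\<open>cspan\<close> indexes coefficients by the functions themselves, so the
      values of \<open>s\<close> are transported along the injective
      \<open>\<delta>\<close>.\<close>
    have "PF s = (\<lambda>x. \<Sum>b\<in>\<delta> ` F. s (inv_into F \<delta> b) * b x)"
    proof
      fix x
      have "(\<Sum>b\<in>\<delta> ` F. s (inv_into F \<delta> b) * b x) = (\<Sum>y\<in>F. s y * \<delta> y x)"
        by (subst sum.reindex[OF \<delta>_inj]) (simp add: inv_into_f_f[OF \<delta>_inj])
      also have "\<dots> = (\<Sum>y\<in>F. if y = x then s x else 0)" by (intro sum.cong) (auto simp: \<delta>_def)
      finally show "PF s x = (\<Sum>b\<in>\<delta> ` F. s (inv_into F \<delta> b) * b x)" using F by (simp add: PF_def)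
    qed
    then have "PF s \<in> cspan (\<delta> ` F)"
      unfolding cspan_def by (intro CollectI exI[of _ "\<lambda>b. s (inv_into F \<delta> b)"])
    moreover have "schr adj v (app Q B s) \<in> schr adj v ` lp p" using B lp_leD(1)[OF s(1)] by blast
    moreover have "f = (\<lambda>x. schr adj v (app Q B s) x + PF s x)"
      using decomp[of s] s(2) by (simp add: fun_eq_iff)
    ultimately show "f \<in> {(\<lambda>x. a x + b x) | a b. a \<in> schr adj v ` lp p \<and> b \<in> cspan (\<delta> ` F)}"
      by (intro CollectI exI conjI)
  qed
  assume f: "\<And>k. f k \<in> schr adj v ` lp p" and g: "g \<in> lp p"
    and l: "(\<lambda>k. lp_norm p (\<lambda>x. f k x - g x)) \<longlonglongrightarrow> 0"
  have f_lp: "f k \<in> lp p" for k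
    using f[of k] bounded_on_schr[OF p v] by (auto simp: bounded_on_def)
  obtain s where s: "lp_le p (2 * lp_norm p g) s" "\<And>x. s x + app R E s x = g x"
    using solve_perturbed_identity[OF p E lp_le_lp_norm[OF g]] by blast
  \<comment> \<open>The differences \<open>f k - g\<close> are solved separately with norm control,
    so that the solutions \<open>s + d k\<close> for \<open>f k\<close> tend pointwise to the
    solution \<open>s\<close> for \<open>g\<close>.\<close>
  have "\<exists>d. lp_le p (2 * lp_norm p (\<lambda>x. f k x - g x)) d \<and> (\<forall>x. d x + app R E d x = f k x - g x)" for k
    using solve_perturbed_identity[OF p E lp_le_lp_norm[OF lp_diff[OF p f_lp g]]] by metis
  then obtain d where d: "\<And>k. lp_le p (2 * lp_norm p (\<lambda>x. f k x - g x)) (d k)"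
    "\<And>k x. d k x + app R E (d k) x = f k x - g x" by metis
  have dlim: "(\<lambda>k. d k x) \<longlonglongrightarrow> 0" for x
  proof (rule Lim_null_comparison)
    show "\<forall>\<^sub>F k in sequentially. norm (d k x) \<le> 2 * lp_norm p (\<lambda>x. f k x - g x)"
      using lp_le_at[OF p d(1)] by simp
    show "(\<lambda>k. 2 * lp_norm p (\<lambda>x. f k x - g x)) \<longlonglongrightarrow> 0" using tendsto_mult_right_zero[OF l] by simp
  qed
  define N where "N = {t \<in> schr adj v ` lp p. \<forall>x. x \<notin> F \<longrightarrow> t x = 0}"
  have "PF s \<in> N"
  proof (rule finite_support_subspace_closed[OF F, where f = "\<lambda>k. PF (\<lambda>x. s x + d k x)"])
    show "(\<lambda>x. u x + c * w x) \<in> N" if "u \<in> N" "w \<in> N" for u w c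
      using that Alin[of u w c] by (simp add: N_def)
    show "u x = 0" if "u \<in> N" "x \<notin> F" for u x using that by (simp add: N_def)
    show "PF (\<lambda>x. s x + d k x) \<in> N" for k
    proof -
      define t where "t = (\<lambda>x. s x + d k x)"
      have t: "t \<in> lp p" unfolding t_def by (rule lp_add[OF p lp_leD(1)[OF s(1)] lp_leD(1)[OF d(1)]])
      have "t x + app R E t x = f k x" for x
      proof -
        have "t x + app R E t x = (s x + app R E s x) + (d k x + app R E (d k) x)"
          unfolding t_def app_add by simp
        then show ?thesis unfolding s(2) d(2) by simp
      qed
      then have "PF t = (\<lambda>x. f k x + (-1) * schr adj v (app Q B t) x)"
        using fun_cong[OF decomp[of t]] by (auto simp: fun_eq_iff algebra_simps)
      also have "\<dots> \<in> schr adj v ` lp p"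
        using B[OF t] by (intro Alin f) auto
      finally show ?thesis by (simp add: N_def PF_def t_def)
    qed
    show "(\<lambda>k. PF (\<lambda>x. s x + d k x) x) \<longlonglongrightarrow> PF s x" for x
      using tendsto_add[OF tendsto_const dlim, of "s x" x] by (simp add: PF_def)
  qed
  then have "PF s \<in> schr adj v ` lp p" by (simp add: N_def)
  from Alin[OF _ this, of "schr adj v (app Q B s)" 1]
  have "(\<lambda>x. schr adj v (app Q B s) x + PF s x) \<in> schr adj v ` lp p"
    using B[OF lp_leD(1)[OF s(1)]] by simp
  then show "g \<in> schr adj v ` lp p" unfolding decomp[symmetric] s(2) .
qed

text \<open>The order of choices matters: \<open>p0\<close> enters only through the existence of
  Green functions; \<open>c\<close> and \<open>\<epsilon>\<close> are then uniform over the limit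
  operators, \<open>\<delta>\<close> and \<open>R\<close> make all residuals small, and the finite
  set \<open>F\<close> is determined last. None of these constants involves
  \<open>p\<close>.\<close>

lemma limits_invertible_imp_fredholm:
  assumes v: "bounded (range v)" and p0: "1 \<le> p0"
    and inv: "\<And>w. w \<in> lim_pot v \<Longrightarrow> invertible_on p0 (schr adj w)"
    and p: "1 \<le> p"
  shows "fredholm_on p (schr adj v)"
proof -
  obtain M where M: "\<forall>x. norm (v x) \<le> M" using v by (auto simp: bounded_iff)
  have M0: "0 \<le> M" using M norm_ge_zero order_trans by blast
  note wM = lim_pot_bound[OF M]
  have "\<exists>c. \<forall>u\<in>lp \<infinity>. lp_norm \<infinity> u \<le> c * lp_norm \<infinity> (schr adj w u)" if w: "w \<in> lim_pot v" for w
  proof -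
    obtain C \<epsilon> K where "0 \<le> C" "0 < \<epsilon>" "green w C \<epsilon> K" using invertible_imp_green[OF p0 inv[OF w]] .
    from green_imp_bounded_below[OF wM[OF w] this] show ?thesis by metis
  qed
  then obtain c where c: "0 \<le> c"
    "\<And>w u. w \<in> lim_pot v \<Longrightarrow> u \<in> lp \<infinity> \<Longrightarrow> lp_norm \<infinity> u \<le> c * lp_norm \<infinity> (schr adj w u)"
    using uniformly_bounded_below[OF M] by metis
  obtain \<epsilon> where \<epsilon>: "0 < \<epsilon>" "c * ((exp (\<epsilon> * step) - 1) * vol step) \<le> 1 / 2"
    using combes_thomas_rate[OF c(1)] .
  have "\<exists>K. green w (2 * c) \<epsilon> K" if w: "w \<in> lim_pot v" for w
  proof -
    obtain C \<epsilon>' K where "green w C \<epsilon>' K" "0 \<le> C" "0 < \<epsilon>'"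
      using invertible_imp_green[OF p0 inv[OF w]] by metis
    from green_improve[OF this c(1) c(2)[OF w] \<epsilon>] show ?thesis by blast
  qed
  then obtain K where K: "\<And>w. w \<in> lim_pot v \<Longrightarrow> green w (2 * c) \<epsilon> (K w)" by metis
  define C where "C = 2 * c"
  have C: "0 \<le> C" using c(1) by (simp add: C_def)
  obtain S where S: "0 \<le> S" "\<And>x T. finite T \<Longrightarrow> (\<Sum>y\<in>T. exp (- (\<epsilon> / 2) * pd x y)) \<le> S"
    using exp_pd_sum_bounded[of "\<epsilon> / 2"] \<epsilon>(1) by (metis half_gt_zero)
  obtain \<delta> R where \<delta>: "0 < \<delta>" and R: "0 \<le> R"
    and small: "vol step * C * exp (\<epsilon> * step) * (\<delta> + (1 + M) * exp (- (\<epsilon> / 2) * R)) * S \<le> 1 / 2"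
    using small_residual[OF C \<epsilon>(1) M0 S(1)] .
  define \<eta> where "\<eta> = vol step * C * exp (\<epsilon> * step) * (\<delta> + (1 + M) * exp (- (\<epsilon> / 2) * R))"
  have \<eta>: "0 \<le> \<eta>" unfolding \<eta>_def using vol_nonneg C \<delta> M0 by simp
  define F where "F = {y. \<not> (\<exists>w\<in>lim_pot v. \<forall>x. pd x y \<le> R \<longrightarrow> norm (v x - w x) \<le> \<delta>)}"
  have F: "finite F" unfolding F_def by (rule approximate_by_lim_pot[OF M \<delta>])
  have "\<exists>w. y \<notin> F \<longrightarrow> w \<in> lim_pot v \<and> (\<forall>x. pd x y \<le> R \<longrightarrow> norm (v x - w x) \<le> \<delta>)" for y
    unfolding F_def by blast
  then obtain W where W: "\<And>y. y \<notin> F \<Longrightarrow> W y \<in> lim_pot v"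
    "\<And>y x. y \<notin> F \<Longrightarrow> pd x y \<le> R \<Longrightarrow> norm (v x - W y x) \<le> \<delta>" by metis
  have WM: "\<forall>y. norm (W x y) \<le> M" if "x \<notin> F" for x using wM[OF W(1)[OF that]] .
  have KW: "green (W x) C \<epsilon> (K (W x))" if "x \<notin> F" for x using K[OF W(1)[OF that]] by (simp add: C_def)
  have half: "lp_le p (r / 2) (app Q E u)"
    if "\<And>x z. norm (E x z) \<le> \<eta> * exp (- (\<epsilon> / 2) * pd x z)" "lp_le p r u" for E r u Q
  proof -
    have "\<eta> * S * r \<le> 1 / 2 * r"
      using small lp_le_nonneg[OF p that(2)] unfolding \<eta>_def by (rule mult_right_mono)
    then show ?thesis
      by (intro lp_le_mono[OF p app_exp_lp_le[OF p that(2) \<eta> that(1) S(2)]]) auto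
  qed
  have "\<exists>B E. (\<forall>x y. norm (B x y) \<le> C) \<and> (\<forall>x z. norm (E x z) \<le> \<eta> * exp (- (\<epsilon> / 2) * pd x z)) \<and>
    (\<forall>u x. app R B (schr adj v u) x = app (R + step) E u x + (if x \<in> F then 0 else u x))"
    unfolding \<eta>_def
    by (rule left_parametrix[where W = W and K = "\<lambda>x. K (W x)", OF M C \<epsilon>(1) less_imp_le[OF \<delta>] R])
      (erule WM | erule KW | erule (1) W(2))+
  then obtain B1 E1 where 1: "\<And>x y. norm (B1 x y) \<le> C"
    "\<And>x z. norm (E1 x z) \<le> \<eta> * exp (- (\<epsilon> / 2) * pd x z)"
    "\<And>u x. app R B1 (schr adj v u) x = app (R + step) E1 u x + (if x \<in> F then 0 else u x)"
    by blast
  have "\<exists>B E. (\<forall>x y. norm (B x y) \<le> C) \<and> (\<forall>x z. norm (E x z) \<le> \<eta> * exp (- (\<epsilon> / 2) * pd x z)) \<and>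
    (\<forall>u x. schr adj v (app R B u) x = app (step + R) E u x + (if x \<in> F then 0 else u x))"
    unfolding \<eta>_def
    by (rule right_parametrix[where W = W and K = "\<lambda>x. K (W x)", OF M C \<epsilon>(1) less_imp_le[OF \<delta>] R])
      (erule WM | erule KW | erule (1) W(2))+
  then obtain B2 E2 where 2: "\<And>x y. norm (B2 x y) \<le> C"
    "\<And>x z. norm (E2 x z) \<le> \<eta> * exp (- (\<epsilon> / 2) * pd x z)"
    "\<And>u x. schr adj v (app R B2 u) x = app (step + R) E2 u x + (if x \<in> F then 0 else u x)"
    by blast
  have B2: "app R B2 u \<in> lp p" if "u \<in> lp p" for u by (rule app_lp[OF p that 2(1)])
  note range_props = right_parametrix_imp_range[OF p F v half[OF 2(2)] B2 2(3)]
  show ?thesis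
    unfolding fredholm_on_def
  proof (intro conjI allI impI)
    show "bounded_on p (schr adj v)" by (rule bounded_on_schr[OF p v])
    show "\<exists>B. finite B \<and> B \<subseteq> lp p \<and> {u\<in>lp p. schr adj v u = (\<lambda>x. 0)} \<subseteq> cspan B"
      by (rule left_parametrix_imp_kernel_finite[OF p F half[OF 1(2)] 1(3)])
    show "g \<in> schr adj v ` lp p" if "\<forall>k. f k \<in> schr adj v ` lp p" "g \<in> lp p"
      "(\<lambda>k. lp_norm p (\<lambda>x. f k x - g x)) \<longlonglongrightarrow> 0" for f g
      by (rule range_props(2)[where f = f and g = g]) (assumption | rule spec[OF that(1)] that)+
  qed (rule range_props(1); assumption)
qed

end

section \<open>The spectral parameter as a shift of the potential\<close>

lemma schr_minus: "(\<lambda>u x. schr adj v u x - z * u x) = schr adj (\<lambda>x. v x - z)"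
  by (simp add: schr_def fun_eq_iff algebra_simps)

theorem theorem6p1:
  fixes adj :: "'a::countable \<Rightarrow> 'a \<Rightarrow> bool"
    and act :: "(int ^ 'n::finite) \<Rightarrow> 'a \<Rightarrow> 'a"
    and v :: "'a \<Rightarrow> complex"
  assumes "periodic_graph adj act"
    and "bounded (range v)"
  shows "(\<forall>p. 1 < p \<and> p < \<infinity> \<longrightarrow>
            (fredholm_on p (schr adj v) \<longleftrightarrow>
              (\<exists>p0. 1 \<le> p0 \<and>
                 (\<forall>w\<in>limit_potentials adj act v p. invertible_on p0 (schr adj w))))) \<and>
         (\<forall>p1 p2. 1 < p1 \<and> p1 < \<infinity> \<and> 1 < p2 \<and> p2 < \<infinity> \<longrightarrow>
            ess_spectrum_on p1 (schr adj v) = ess_spectrum_on p2 (schr adj v)) \<and>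
         (\<forall>p. 1 < p \<and> p < \<infinity> \<longrightarrow>
            ess_spectrum_on p (schr adj v) =
              (\<Union>w\<in>limit_potentials adj act v p. spectrum_on p (schr adj w)))"
proof -
  interpret lattice_graph adj act by standard (rule assms(1))
  have shifted: "bounded (range (\<lambda>x. v x - z))" for z
    using bounded_translation_minus[OF assms(2), of z] by (simp add: image_image)
  \<comment> \<open>Both implications are used for every shifted potential \<open>v - z\<close>;
    subtracting \<open>z\<close> commutes with taking limit potentials, which gives the spectral
    statements.\<close>
  have Fr_imp: "\<forall>w\<in>lim_pot (\<lambda>x. v x - z). invertible_on p (schr adj w)"
    if p: "1 < p" "p < \<infinity>" and Fr: "fredholm_on p (schr adj (\<lambda>x. v x - z))" for p z
  proof -
    obtain q where "p = ereal q" "1 < q" using p by (cases p) auto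
    then show ?thesis using fredholm_imp_limits_invertible[OF shifted] Fr by blast
  qed
  have imp_Fr: "fredholm_on p (schr adj (\<lambda>x. v x - z))"
    if "1 < p" "1 \<le> p0" "\<forall>w\<in>lim_pot (\<lambda>x. v x - z). invertible_on p0 (schr adj w)" for p p0 z
    using limits_invertible_imp_fredholm[OF shifted that(2) bspec[OF that(3)]] that(1) by simp
  have ess: "z \<notin> ess_spectrum_on p (schr adj v) \<longleftrightarrow> fredholm_on p (schr adj (\<lambda>x. v x - z))" for z p
    by (simp add: ess_spectrum_on_def schr_minus)
  have spec: "z \<notin> (\<Union>w\<in>lim_pot v. spectrum_on p (schr adj w)) \<longleftrightarrow>
      (\<forall>w\<in>lim_pot (\<lambda>x. v x - z). invertible_on p (schr adj w))" for z p
    by (simp add: spectrum_on_def schr_minus lim_pot_diff)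
  have lim: "limit_potentials adj act v p = lim_pot v" if "1 < p" "p < \<infinity>" for p
    by (rule limit_potentials_eq_lim_pot[OF assms(2) that])
  show ?thesis
  proof (intro conjI allI impI)
    fix p :: ereal assume p: "1 < p \<and> p < \<infinity>"
    show "fredholm_on p (schr adj v) \<longleftrightarrow>
        (\<exists>p0. 1 \<le> p0 \<and> (\<forall>w\<in>limit_potentials adj act v p. invertible_on p0 (schr adj w)))"
      using Fr_imp[of p 0] imp_Fr[of p _ 0] p lim[of p] by (auto intro: less_imp_le)
  next
    fix p1 p2 :: ereal assume p: "1 < p1 \<and> p1 < \<infinity> \<and> 1 < p2 \<and> p2 < \<infinity>"
    \<comment> \<open>A Fredholm operator on \<open>lp p1\<close> has limit operators invertible on
      \<open>lp p1\<close>, and \<open>p0 = p1\<close> then serves as the exponent in the criterion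
      for \<open>p2\<close>.\<close>
    have "z \<notin> ess_spectrum_on p1 (schr adj v) \<longleftrightarrow> z \<notin> ess_spectrum_on p2 (schr adj v)" for z
      unfolding ess using Fr_imp[of p1 z] Fr_imp[of p2 z] imp_Fr[of p1 p2 z] imp_Fr[of p2 p1 z] p
      by (auto intro: less_imp_le)
    then show "ess_spectrum_on p1 (schr adj v) = ess_spectrum_on p2 (schr adj v)" by blast
  next
    fix p :: ereal assume p: "1 < p \<and> p < \<infinity>"
    have "z \<notin> ess_spectrum_on p (schr adj v) \<longleftrightarrow> z \<notin> (\<Union>w\<in>lim_pot v. spectrum_on p (schr adj w))" for z
      unfolding ess spec using Fr_imp[of p z] imp_Fr[of p p z] p by (auto intro: less_imp_le)
    then show "ess_spectrum_on p (schr adj v) =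
        (\<Union>w\<in>limit_potentials adj act v p. spectrum_on p (schr adj w))"
      using lim[of p] p by blast
  qed
qed

end
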